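(* Let $B$ be either of the skew-symmetric matrices \[\begin{pmatrix} 0&1&1&1\\-1&0&1&0\\-1&-1&0&-1\\-1&0&1&0 \end{pmatrix}\quad\text{or}\quad \begin{pmatrix} 0&2&0\\-2&0&1\\0&-1&0 \end{pmatrix},\] let $n$ be its size, let $(\mathbf{x},B)$ be a labeled seed with exchange matrix $B$, and let $S$ be its labeled mutation class and $\mathcal{A}=\mathcal{A}(\mathbf{x},B)$ its cluster algebra. Then $B$ is not of finite mutation type, but $W=\mathrm{Aut}_{M_n}(S)$ (and $\mathrm{Aut}(\mathcal{A})\cong \mathrm{Aut}_{M_n}(S)$). In particular, the property $W=\mathrm{Aut}_{M_n}(S)$ does not characterize finite mutation type.
   Context: **Labeled seeds.** Let $\mathcal{F}$ be a field isomorphic to the field of rational functions in $n$ variables over $\mathbb{Q}$, and $[1,n]=\{1,\dots,n\}$. A labeled seed of rank $n$ is a pair $(\mathbf{x},B)$ with $\mathbf{x}=(x_1,\dots,x_n)$ an $n$-tuple of free generators of $\mathcal{F}$ and $B=(b_{ij})$ an $n\times n$ skew-symmetric integer matrix. With $[a]_+=\max(a,0)$, the mutation $\mu_k(\mathbf{x},B)=(\mathbf{x}',B')$, $k\in[1,n]$, is given by $x'_k=\big(\prod_i x_i^{[b_{ik}]_+}+\prod_i x_i^{[-b_{ik}]_+}\big)/x_k$, $x'_i=x_i$ for $i\ne k$; $b'_{ij}=-b_{ij}$ if $i=k$ or $j=k$, and $b'_{ij}=b_{ij}+\mathrm{sgn}(b_{ik})[b_{ik}b_{kj}]_+$ otherwise.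 Mutation equivalence means being related by a finite sequence of mutations. $B$ is of finite mutation type if only finitely many matrices are mutation equivalent to $B$. An (unlabeled) seed is a class of labeled seeds up to simultaneous relabeling. The cluster algebra $\mathcal{A}(\mathbf{x},B)$ (trivial coefficients) is the $\mathbb{Z}$-subalgebra of $\mathcal{F}$ generated by all entries (cluster variables) of the tuples in labeled seeds mutation equivalent to $(\mathbf{x},B)$; its seeds are those represented by such labeled seeds, and the set of cluster variables of a seed is a cluster. **The groups.** $\sigma\in S_n$ acts on labeled seeds by $\sigma(\mathbf{x},B)=\big((x_{\sigma(i)})_i,(b_{\sigma(i)\sigma(j)})_{i,j}\big)$. The global mutation group is $M_n=S_n\ltimes\langle\mu_1,\dots,\mu_n:\mu_i^2=1\rangle$ with $\mu_i\sigma=\sigma\mu_{\sigma(i)}$. The labeled mutation class $S$ is the $M_n$-orbit of $(\mathbf{x},B)$, i.e. all labeled seeds obtained from $(\mathbf{x},B)$ by finitely many mutations and permutations. $\mathrm{Aut}_{M_n}(S)$ is the group of bijections $S\to S$ commuting with the action of $M_n$ (i.e. with all $\mu_k$ and all $\sigma\in S_n$). $W=\{f\in\mathrm{Aut}_{M_n}(S): \text{if } f(\mathbf{x},B)=(\mathbf{x}',B')\text{ then }B'=B\text{ or }B'=-B\}$. **Cluster automorphisms.** A $\mathbb{Z}$-algebra automorphism $f$ of $\mathcal{A}$ is a cluster automorphism if there is a seed $(\mathbf{x}',B')$ of $\mathcal{A}$ such that (1) $f(\mathbf{x}')$ is a cluster, and (2) $f(\mu_{x,\mathbf{x}'}(x))=\mu_{f(x),f(\mathbf{x}')}(f(x))$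 for every $x\in\mathbf{x}'$, where $\mu_{x,\mathbf{x}'}(x)$ is the new cluster variable obtained by mutating the seed with cluster $\mathbf{x}'$ at $x$ (a seed is determined by its cluster). $\mathrm{Aut}(\mathcal{A})$ is the group of all cluster automorphisms. *)

theory Defs
  imports "HOL-Analysis.Cartesian_Space" "HOL-Algebra.Bij" "HOL-Library.Poly_Mapping"
begin

section \<open>Free generators of the ambient field\<close>

text \<open>The ambient field is a type \<open>'a\<close>; the index set \<open>[1,n]\<close> is a finite type \<open>'n\<close>.
  Polynomials over the rationals in variables indexed by \<open>'n\<close> are finitely supported maps from
  exponent vectors to coefficients. The existence of a tuple of free generators says precisely
  that \<open>'a\<close> is isomorphic to the field of rational functions in these variables.\<close>

definition eval_poly :: "(('n::finite \<Rightarrow>\<^sub>0 nat) \<Rightarrow>\<^sub>0 rat) \<Rightarrow> 'a::field_char_0 ^ 'n \<Rightarrow> 'a" where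
  "eval_poly p x =
     (\<Sum>m\<in>Poly_Mapping.keys p.
        of_rat (Poly_Mapping.lookup p m) * (\<Prod>i\<in>UNIV. (x $ i) ^ Poly_Mapping.lookup m i))"

definition algebraically_independent :: "'a::field_char_0 ^ 'n::finite \<Rightarrow> bool" where
  "algebraically_independent x \<longleftrightarrow> (\<forall>p. eval_poly p x = 0 \<longrightarrow> p = 0)"

definition is_subring :: "'a::ring_1 set \<Rightarrow> bool" where
  "is_subring R \<longleftrightarrow> 1 \<in> R \<and> (\<forall>a\<in>R. \<forall>b\<in>R. a - b \<in> R \<and> a * b \<in> R)"

definition is_subfield :: "'a::field set \<Rightarrow> bool" where
  "is_subfield K \<longleftrightarrow> is_subring K \<and> (\<forall>a\<in>K. inverse a \<in> K)"

definition free_generators :: "'a::field_char_0 ^ 'n::finite \<Rightarrow> bool" where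
  "free_generators x \<longleftrightarrow>
     algebraically_independent x \<and> is_subfield hull (range (($) x)) = UNIV"


section \<open>Labeled seeds and mutation\<close>

type_synonym ('a, 'n) seed = "('a ^ 'n) \<times> (int ^ 'n ^ 'n)"

definition labeled_seed :: "('a::field_char_0, 'n::finite) seed \<Rightarrow> bool" where
  "labeled_seed s \<longleftrightarrow> free_generators (fst s) \<and> transpose (snd s) = - snd s"

definition pos_part :: "int \<Rightarrow> int" where
  "pos_part a = max a 0"

definition mutate_matrix :: "'n::finite \<Rightarrow> int ^ 'n ^ 'n \<Rightarrow> int ^ 'n ^ 'n" where
  "mutate_matrix k B =
     (\<chi> i j. if i = k \<or> j = k then - B $ i $ j
             else B $ i $ j + sgn (B $ i $ k) * pos_part (B $ i $ k * B $ k $ j))"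

definition mutate_vars :: "'n::finite \<Rightarrow> ('a::field, 'n) seed \<Rightarrow> 'a ^ 'n" where
  "mutate_vars k s = (case s of (x, B) \<Rightarrow>
     (\<chi> i. if i = k
           then ((\<Prod>j\<in>UNIV. (x $ j) ^ nat (pos_part (B $ j $ k)))
                  + (\<Prod>j\<in>UNIV. (x $ j) ^ nat (pos_part (- B $ j $ k)))) / x $ k
           else x $ i))"

definition mutate :: "'n::finite \<Rightarrow> ('a::field, 'n) seed \<Rightarrow> ('a, 'n) seed" where
  "mutate k s = (mutate_vars k s, mutate_matrix k (snd s))"

definition permute :: "('n::finite \<Rightarrow> 'n) \<Rightarrow> ('a, 'n) seed \<Rightarrow> ('a, 'n) seed" where
  "permute \<sigma> s = (\<chi> i. fst s $ \<sigma> i, \<chi> i j. snd s $ \<sigma> i $ \<sigma> j)"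

definition finite_mutation_type :: "int ^ 'n::finite ^ 'n \<Rightarrow> bool" where
  "finite_mutation_type B \<longleftrightarrow> finite {C. (\<lambda>P Q. \<exists>k. Q = mutate_matrix k P)\<^sup>*\<^sup>* B C}"

definition mutation_class :: "('a::field, 'n::finite) seed \<Rightarrow> ('a, 'n) seed set" where
  "mutation_class s = {t. (\<lambda>p q. \<exists>k. q = mutate k p)\<^sup>*\<^sup>* s t}"


section \<open>The labeled mutation class and its automorphisms\<close>

text \<open>The orbit of \<open>s\<close> under the global mutation group, whose generators are the mutations
  and the permutations.\<close>

definition labeled_mutation_class :: "('a::field, 'n::finite) seed \<Rightarrow> ('a, 'n) seed set" where
  "labeled_mutation_class s =
     {t. (\<lambda>p q. (\<exists>k. q = mutate k p) \<or> (\<exists>\<sigma>. bij \<sigma> \<and> q = permute \<sigma> p))\<^sup>*\<^sup>* s t}"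

definition Aut_M :: "('a::field, 'n::finite) seed \<Rightarrow> (('a, 'n) seed \<Rightarrow> ('a, 'n) seed) set" where
  "Aut_M s =
     {f \<in> Bij (labeled_mutation_class s).
        \<forall>t\<in>labeled_mutation_class s.
          (\<forall>k. f (mutate k t) = mutate k (f t)) \<and>
          (\<forall>\<sigma>. bij \<sigma> \<longrightarrow> f (permute \<sigma> t) = permute \<sigma> (f t))}"

definition Aut_M_group ::
    "('a::field, 'n::finite) seed \<Rightarrow> (('a, 'n) seed \<Rightarrow> ('a, 'n) seed) monoid" where
  "Aut_M_group s = BijGroup (labeled_mutation_class s) \<lparr>carrier := Aut_M s\<rparr>"

definition W :: "('a::field, 'n::finite) seed \<Rightarrow> (('a, 'n) seed \<Rightarrow> ('a, 'n) seed) set" where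
  "W s = {f \<in> Aut_M s. \<forall>t\<in>labeled_mutation_class s. snd (f t) = snd t \<or> snd (f t) = - snd t}"


section \<open>The cluster algebra and its cluster automorphisms\<close>

definition cluster :: "('a, 'n::finite) seed \<Rightarrow> 'a set" where
  "cluster t = range (($) (fst t))"

definition clusters :: "('a::field, 'n::finite) seed \<Rightarrow> 'a set set" where
  "clusters s = cluster ` mutation_class s"

definition cluster_algebra :: "('a::field, 'n::finite) seed \<Rightarrow> 'a set" where
  "cluster_algebra s = is_subring hull (\<Union>(clusters s))"

text \<open>The new variable obtained by mutating the seed with cluster \<open>X\<close> at \<open>v \<in> X\<close>. The
  description is well-defined because a seed is determined by its cluster.\<close>

definition exchange :: "('a::field, 'n::finite) seed \<Rightarrow> 'a set \<Rightarrow> 'a \<Rightarrow> 'a" where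
  "exchange s X v =
     (THE v'. \<exists>t\<in>mutation_class s. \<exists>k.
        cluster t = X \<and> fst t $ k = v \<and> fst (mutate k t) $ k = v')"

definition algebra_automorphisms :: "'a::ring_1 set \<Rightarrow> ('a \<Rightarrow> 'a) set" where
  "algebra_automorphisms A =
     {f \<in> Bij A. f 1 = 1 \<and> (\<forall>a\<in>A. \<forall>b\<in>A. f (a + b) = f a + f b \<and> f (a * b) = f a * f b)}"

definition cluster_automorphisms :: "('a::field, 'n::finite) seed \<Rightarrow> ('a \<Rightarrow> 'a) set" where
  "cluster_automorphisms s =
     {f \<in> algebra_automorphisms (cluster_algebra s).
        \<exists>X\<in>clusters s. f ` X \<in> clusters s \<and>
          (\<forall>v\<in>X. f (exchange s X v) = exchange s (f ` X) (f v))}"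

definition cluster_aut_group :: "('a::field, 'n::finite) seed \<Rightarrow> ('a \<Rightarrow> 'a) monoid" where
  "cluster_aut_group s = BijGroup (cluster_algebra s) \<lparr>carrier := cluster_automorphisms s\<rparr>"


section \<open>The two exchange matrices\<close>

definition B4 :: "int ^ 4 ^ 4" where
  "B4 = vector [vector [ 0,  1, 1,  1],
                vector [-1,  0, 1,  0],
                vector [-1, -1, 0, -1],
                vector [-1,  0, 1,  0]]"

definition B3 :: "int ^ 3 ^ 3" where
  "B3 = vector [vector [ 0,  2, 0],
                vector [-2,  0, 1],
                vector [ 0, -1, 0]]"

end

theory Submission
  imports Defs "HOL-Computational_Algebra.Polynomial"
begin

text \<open>
  Why the theorem is true. An automorphism \<open>f\<close> of the labeled mutation class commutes with all
  mutations and permutations, so it preserves and reflects the relations that hold between them.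
  At a seed with matrix \<open>B\<close>, the mutations in directions \<open>i \<noteq> j\<close> commute exactly when
  \<open>B $ i $ j = 0\<close> (\<open>mutate_commute_iff\<close>), and if \<open>B $ i $ j \<noteq> 0\<close> then the pentagon relation, five
  alternating mutations giving a transposition, forces \<open>\<bar>B $ i $ j\<bar> = 1\<close>; conversely it holds when
  \<open>B $ i $ j = 1\<close> (\<open>pentagon_relation\<close>, \<open>pentagon_relation_imp\<close>). So the matrices of \<open>t\<close> and \<open>f t\<close>
  have their entries \<open>0\<close> and their entries \<open>1\<close> or \<open>-1\<close> in the same positions, for every seed
  \<open>t\<close>. For \<open>B4\<close>, comparing these patterns at the initial seed and at its neighbours leaves only \<open>B4\<close>
  and \<open>- B4\<close>. For \<open>B3\<close> they leave the weight of the double arrow open, and the Markov constant,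
  which is the same on the whole mutation class, forces it to be two. Hence \<open>W = Aut_M\<close>. Both
  mutation classes contain an oriented triangle with an arrow of weight three, and alternating
  mutations at the ends of that arrow make the other weights grow without bound
  (\<open>growing_triangle_mutate\<close>).

  Everything else rests on the fact that a labeled seed is determined by its tuple of cluster
  variables (\<open>labeled_seed_determined\<close>). This is proved with the two-form
  \<open>\<Sum>i j. b i j * dlog (x i) \<and> dlog (x j)\<close>, which mutation preserves: if two seeds have the same
  variables then their matrices are the coefficients of the same two-form in the same
  coordinates. The computation is carried out with real numbers. A rational function of free generators is
  specialised at a positive real point; exchange relations are free of subtraction, so mutated
  variables specialise to positive reals along with the initial ones, and one can differentiate
  along curves through the point.

  The isomorphism sends a cluster automorphism to the map it induces on seeds. Since a seed is
  determined by its cluster, the exchange partner of a variable in a cluster is well defined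
  (\<open>exchange_eq\<close>). Compatibility with exchange at one cluster says that the exchange binomials
  of two seeds agree; as the variables are algebraically independent, the columns of the two
  matrices agree up to sign, and connectedness makes the sign uniform
  (\<open>cluster_automorphisms_iff\<close>). Conversely, an element of \<open>Aut_M\<close> that preserves the initial
  matrix up to sign extends from the initial variables to an automorphism of the field, which
  maps the cluster algebra onto itself (\<open>seed_map_surj\<close>); this is where \<open>W = Aut_M\<close> enters.
\<close>


section \<open>Specialising the free generators\<close>

definition mono_eval :: "('n::finite \<Rightarrow>\<^sub>0 nat) \<Rightarrow> 'a::field_char_0 ^ 'n \<Rightarrow> 'a" where
  "mono_eval m x = (\<Prod>i\<in>UNIV. (x $ i) ^ Poly_Mapping.lookup m i)"

lemma eval_poly_superset:
  assumes "finite K" "Poly_Mapping.keys p \<subseteq> K"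
  shows "eval_poly p x = (\<Sum>m\<in>K. of_rat (Poly_Mapping.lookup p m) * mono_eval m x)"
  unfolding eval_poly_def mono_eval_def
  by (rule sum.mono_neutral_left) (use assms in \<open>auto simp: in_keys_iff\<close>)

lemma mono_eval_add: "mono_eval (m + m') x = mono_eval m x * mono_eval m' x"
  by (simp add: mono_eval_def lookup_add power_add prod.distrib)

lemma eval_poly_zero [simp]: "eval_poly 0 x = 0"
  by (simp add: eval_poly_def)

lemma eval_poly_single: "eval_poly (Poly_Mapping.single m c) x = of_rat c * mono_eval m x"
  using eval_poly_superset[of "{m}" "Poly_Mapping.single m c" x] by simp

lemma eval_poly_one [simp]: "eval_poly 1 x = 1"
  by (metis (no_types, lifting) eval_poly_single lookup_zero mono_eval_def mult.left_neutral
      of_rat_1 power_0 prod.neutral single_one)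

lemma eval_poly_var: "eval_poly (Poly_Mapping.single (Poly_Mapping.single i 1) 1) x = x $ i"
proof -
  have "mono_eval (Poly_Mapping.single i 1) x = (\<Prod>j\<in>UNIV. if j = i then x $ j else 1)"
    unfolding mono_eval_def by (rule prod.cong) (auto simp: lookup_single when_def)
  then show ?thesis by (simp add: eval_poly_single)
qed

lemma eval_poly_add: "eval_poly (p + q) x = eval_poly p x + eval_poly q x"
proof -
  let ?K = "Poly_Mapping.keys p \<union> Poly_Mapping.keys q"
  have K: "finite ?K" "Poly_Mapping.keys (p + q) \<subseteq> ?K"
    using keys_add[of p q] by auto
  show ?thesis
    by (simp add: eval_poly_superset[OF K] eval_poly_superset[OF K(1)]
        lookup_add of_rat_add algebra_simps sum.distrib)
qed

lemma eval_poly_uminus: "eval_poly (- p) x = - eval_poly p x"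
  using eval_poly_add[of p "- p" x] by (simp add: add_eq_0_iff)

lemma eval_poly_diff: "eval_poly (p - q) x = eval_poly p x - eval_poly q x"
  using eval_poly_add[of p "- q" x] by (simp add: eval_poly_uminus)

lemma poly_mapping_add_induct [case_names zero single add]:
  fixes p :: "'k \<Rightarrow>\<^sub>0 'c::comm_monoid_add"
  assumes "P 0" "\<And>k c. P (Poly_Mapping.single k c)" "\<And>p q. P p \<Longrightarrow> P q \<Longrightarrow> P (p + q)"
  shows "P p"
proof (induction p rule: update_induct)
  case const
  then show ?case by (rule assms(1))
next
  case (update f a b)
  have "Poly_Mapping.update a b f = f + Poly_Mapping.single a b"
    by (rule poly_mapping_eqI)
      (use update in \<open>auto simp: lookup_update lookup_add lookup_single when_def in_keys_iff\<close>)
  then show ?case using assms(2,3) update by simp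
qed

lemma eval_poly_mult: "eval_poly (p * q) x = eval_poly p x * eval_poly q x"
proof (induction p rule: poly_mapping_add_induct)
  case zero
  then show ?case by simp
next
  case (single m c)
  show ?case
  proof (induction q rule: poly_mapping_add_induct)
    case zero
    then show ?case by simp
  next
    case (single m' c')
    then show ?case
      by (simp add: mult_single eval_poly_single mono_eval_add of_rat_mult)
  next
    case (add p q)
    then show ?case by (simp add: distrib_left eval_poly_add)
  qed
next
  case (add p q)
  then show ?case by (simp add: distrib_right eval_poly_add)
qed

text \<open>The graph of the partial map that sends a rational function of \<open>x\<close> to its value at \<open>y\<close>. As
  a relation it is symmetric in \<open>x\<close> and \<open>y\<close> and makes sense before it is known to be
  single-valued.\<close>

definition specialises ::
    "'a::field_char_0 ^ 'n::finite \<Rightarrow> 'c::field_char_0 ^ 'n \<Rightarrow> 'a \<Rightarrow> 'c \<Rightarrow> bool" where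
  "specialises x y u r \<longleftrightarrow>
     (\<exists>p q. eval_poly q x \<noteq> 0 \<and> eval_poly q y \<noteq> 0 \<and>
            u = eval_poly p x / eval_poly q x \<and> r = eval_poly p y / eval_poly q y)"

lemma specialises_sym: "specialises x y u r \<longleftrightarrow> specialises y x r u"
  unfolding specialises_def by blast

text \<open>A polynomial identity in algebraically independent elements holds at every point, so
  the value of a rational function does not depend on the fraction that represents it.\<close>

lemma specialises_unique:
  assumes "algebraically_independent x" "specialises x y u r" "specialises x y u r'"
  shows "r = r'"
proof -
  obtain p q where pq: "eval_poly q x \<noteq> 0" "eval_poly q y \<noteq> 0"
    "u = eval_poly p x / eval_poly q x" "r = eval_poly p y / eval_poly q y"
    using assms(2) unfolding specialises_def by blast
  obtain p' q' where pq': "eval_poly q' x \<noteq> 0" "eval_poly q' y \<noteq> 0"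
    "u = eval_poly p' x / eval_poly q' x" "r' = eval_poly p' y / eval_poly q' y"
    using assms(3) unfolding specialises_def by blast
  have "eval_poly (p * q' - p' * q) x = 0"
    using pq pq' by (simp add: eval_poly_diff eval_poly_mult frac_eq_eq)
  then have "p * q' - p' * q = 0"
    using assms(1) unfolding algebraically_independent_def by blast
  then have "eval_poly (p * q' - p' * q) y = 0" by simp
  then show ?thesis
    using pq pq' by (simp add: eval_poly_diff eval_poly_mult frac_eq_eq)
qed

lemma specialises_eval_poly: "specialises x y (eval_poly p x) (eval_poly p y)"
  unfolding specialises_def by (rule exI[of _ p], rule exI[of _ 1]) simp

lemma specialises_var: "specialises x y (x $ i) (y $ i)"
  using specialises_eval_poly[of x y "Poly_Mapping.single (Poly_Mapping.single i 1) 1"]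
  by (simp add: eval_poly_var[simplified])

lemma specialises_zero: "specialises x y 0 0"
  using specialises_eval_poly[of x y 0] by simp

lemma specialises_one: "specialises x y 1 1"
  using specialises_eval_poly[of x y 1] by simp

lemma specialises_add:
  assumes "specialises x y u r" "specialises x y v s"
  shows "specialises x y (u + v) (r + s)"
proof -
  obtain p q where pq: "eval_poly q x \<noteq> 0" "eval_poly q y \<noteq> 0"
    "u = eval_poly p x / eval_poly q x" "r = eval_poly p y / eval_poly q y"
    using assms(1) unfolding specialises_def by blast
  obtain p' q' where pq': "eval_poly q' x \<noteq> 0" "eval_poly q' y \<noteq> 0"
    "v = eval_poly p' x / eval_poly q' x" "s = eval_poly p' y / eval_poly q' y"
    using assms(2) unfolding specialises_def by blast
  show ?thesis
    unfolding specialises_def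
    by (rule exI[of _ "p * q' + p' * q"], rule exI[of _ "q * q'"])
      (use pq pq' in \<open>simp add: eval_poly_add eval_poly_mult add_frac_eq\<close>)
qed

lemma specialises_mult:
  assumes "specialises x y u r" "specialises x y v s"
  shows "specialises x y (u * v) (r * s)"
proof -
  obtain p q where pq: "eval_poly q x \<noteq> 0" "eval_poly q y \<noteq> 0"
    "u = eval_poly p x / eval_poly q x" "r = eval_poly p y / eval_poly q y"
    using assms(1) unfolding specialises_def by blast
  obtain p' q' where pq': "eval_poly q' x \<noteq> 0" "eval_poly q' y \<noteq> 0"
    "v = eval_poly p' x / eval_poly q' x" "s = eval_poly p' y / eval_poly q' y"
    using assms(2) unfolding specialises_def by blast
  show ?thesis
    unfolding specialises_def
    by (rule exI[of _ "p * p'"], rule exI[of _ "q * q'"])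
      (use pq pq' in \<open>simp add: eval_poly_mult\<close>)
qed

lemma specialises_uminus:
  assumes "specialises x y u r"
  shows "specialises x y (- u) (- r)"
proof -
  have "specialises x y (-1) (-1)"
    using specialises_eval_poly[of x y "- 1"] by (simp add: eval_poly_uminus)
  from specialises_mult[OF this assms] show ?thesis by simp
qed

lemma specialises_diff:
  assumes "specialises x y u r" "specialises x y v s"
  shows "specialises x y (u - v) (r - s)"
  using specialises_add[OF assms(1) specialises_uminus[OF assms(2)]] by simp

text \<open>A fraction with a nonzero value has a nonzero numerator, hence is itself nonzero.\<close>

lemma specialises_inverse:
  assumes "algebraically_independent x" "specialises x y u r" "r \<noteq> 0"
  shows "u \<noteq> 0" "specialises x y (inverse u) (inverse r)"
proof -
  obtain p q where pq: "eval_poly q x \<noteq> 0" "eval_poly q y \<noteq> 0"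
    "u = eval_poly p x / eval_poly q x" "r = eval_poly p y / eval_poly q y"
    using assms(2) unfolding specialises_def by blast
  have p: "eval_poly p y \<noteq> 0" using pq assms(3) by auto
  then have "p \<noteq> 0" by auto
  then have px: "eval_poly p x \<noteq> 0"
    using assms(1) by (auto simp: algebraically_independent_def)
  then show "u \<noteq> 0" using pq by simp
  show "specialises x y (inverse u) (inverse r)"
    unfolding specialises_def
    by (rule exI[of _ q], rule exI[of _ p]) (use p px pq in simp)
qed

lemma specialises_divide:
  assumes "algebraically_independent x" "specialises x y u r" "specialises x y v s" "s \<noteq> 0"
  shows "specialises x y (u / v) (r / s)"
  using specialises_mult[OF assms(2) specialises_inverse(2)[OF assms(1,3,4)]]
  by (simp add: divide_inverse)

lemma specialises_power: "specialises x y u r \<Longrightarrow> specialises x y (u ^ k) (r ^ k)"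
  by (induction k) (auto intro: specialises_one specialises_mult)

lemma specialises_prod:
  "(\<And>i. i \<in> I \<Longrightarrow> specialises x y (f i) (g i)) \<Longrightarrow> specialises x y (prod f I) (prod g I)"
  by (induction I rule: infinite_finite_induct) (auto intro: specialises_one specialises_mult)

text \<open>The elements that have a value at \<open>y\<close> form a subfield that contains \<open>x\<close>: independence of
  \<open>y\<close> ensures that only \<open>0\<close> has the value \<open>0\<close>, so inverses cause no trouble.\<close>

lemma specialises_total:
  assumes "free_generators x" "algebraically_independent y"
  shows "\<exists>r. specialises x y u r"
proof -
  have "is_subfield {u. \<exists>r. specialises x y u r}"
    unfolding is_subfield_def is_subring_def
  proof (intro conjI ballI)
    fix a assume "a \<in> {u. \<exists>r. specialises x y u r}"
    then obtain r where r: "specialises x y a r" by blast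
    have "specialises x y (inverse a) (inverse r)"
    proof (cases "r = 0")
      case True
      then have "a = 0"
        using r specialises_unique[OF assms(2), of x 0 a 0] specialises_zero
        by (auto simp: specialises_sym[of x y])
      then show ?thesis using True specialises_zero by simp
    next
      case False
      then show ?thesis
        using specialises_inverse(2)[OF _ r] assms(1) by (simp add: free_generators_def)
    qed
    then show "inverse a \<in> {u. \<exists>r. specialises x y u r}" by blast
  qed (blast intro: specialises_one specialises_diff specialises_mult)+
  moreover have "range (($) x) \<subseteq> {u. \<exists>r. specialises x y u r}"
    using specialises_var by blast
  ultimately have "is_subfield hull (range (($) x)) \<subseteq> {u. \<exists>r. specialises x y u r}"
    by (intro hull_minimal) auto
  then show ?thesis using assms(1) unfolding free_generators_def by blast
qed

text \<open>Induction on the number of variables: for fixed positive values of the other variables the sum is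
  a univariate polynomial with infinitely many roots, so its coefficients vanish, and these are
  sums of the same kind in fewer variables.\<close>

lemma poly_zero_on_positive:
  fixes c :: "'k \<Rightarrow> real" and e :: "'k \<Rightarrow> 'n \<Rightarrow> nat"
  assumes "finite I" "finite K"
    and "\<And>m m'. m \<in> K \<Longrightarrow> m' \<in> K \<Longrightarrow> \<forall>i\<in>I. e m i = e m' i \<Longrightarrow> m = m'"
    and "\<And>y. (\<forall>i. y i > 0) \<Longrightarrow> (\<Sum>m\<in>K. c m * (\<Prod>i\<in>I. y i ^ e m i)) = 0"
    and "m \<in> K"
  shows "c m = 0"
  using assms
proof (induction I arbitrary: K m rule: finite_induct)
  case empty
  then have "K = {m}" by auto
  then show ?case using empty(3)[of "\<lambda>_. 1"] by simp
next
  case (insert j I)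
  let ?K = "{m' \<in> K. e m' j = e m j}"
  show ?case
  proof (rule insert.IH[of ?K])
    show "finite ?K" "m \<in> ?K" using insert.prems by auto
    show "m1 = m2" if "m1 \<in> ?K" "m2 \<in> ?K" "\<forall>i\<in>I. e m1 i = e m2 i" for m1 m2
      using that insert.prems(2)[of m1 m2] by auto
    fix y :: "'n \<Rightarrow> real" assume y: "\<forall>i. y i > 0"
    define P where "P = (\<Sum>m\<in>K. monom (c m * (\<Prod>i\<in>I. y i ^ e m i)) (e m j))"
    have "poly P z = 0" if z: "z > 0" for z
    proof -
      have "poly P z = (\<Sum>m\<in>K. c m * (\<Prod>i\<in>insert j I. (y(j := z)) i ^ e m i))"
        unfolding P_def poly_sum poly_monom
      proof (rule sum.cong)
        fix m' assume "m' \<in> K"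
        have "(\<Prod>i\<in>I. (y(j := z)) i ^ e m' i) = (\<Prod>i\<in>I. y i ^ e m' i)"
          using insert.hyps by (intro prod.cong) auto
        then show "c m' * (\<Prod>i\<in>I. y i ^ e m' i) * z ^ e m' j =
            c m' * (\<Prod>i\<in>insert j I. (y(j := z)) i ^ e m' i)"
          using insert.hyps by simp
      qed simp
      also have "\<dots> = 0" using insert.prems(3)[of "y(j := z)"] y z by simp
      finally show ?thesis .
    qed
    then have "{0<..} \<subseteq> {z. poly P z = 0}" by auto
    then have "infinite {z. poly P z = 0}"
      using infinite_Ioi infinite_super by blast
    then have "P = 0" using poly_roots_finite by blast
    then have "coeff P (e m j) = 0" by simp
    then have "(\<Sum>m'\<in>K. if e m' j = e m j then c m' * (\<Prod>i\<in>I. y i ^ e m' i) else 0) = 0"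
      by (simp add: P_def coeff_sum)
    then show "(\<Sum>m\<in>?K. c m * (\<Prod>i\<in>I. y i ^ e m i)) = 0"
      using insert.prems(1) by (simp add: sum.inter_filter)
  qed
qed

lemma eval_poly_zero_on_positive:
  fixes p :: "('n::finite \<Rightarrow>\<^sub>0 nat) \<Rightarrow>\<^sub>0 rat"
  assumes "\<And>y :: real ^ 'n. (\<forall>i. y $ i > 0) \<Longrightarrow> eval_poly p y = 0"
  shows "p = 0"
proof (rule ccontr)
  assume "p \<noteq> 0"
  then obtain m where m: "m \<in> Poly_Mapping.keys p"
    by (metis in_keys_iff lookup_zero poly_mapping_eqI)
  have "(of_rat (Poly_Mapping.lookup p m) :: real) = 0"
  proof (rule poly_zero_on_positive[where I = UNIV and K = "Poly_Mapping.keys p"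
        and e = Poly_Mapping.lookup and c = "\<lambda>m. of_rat (Poly_Mapping.lookup p m)"])
    fix y :: "'n \<Rightarrow> real" assume "\<forall>i. y i > 0"
    then show "(\<Sum>m\<in>Poly_Mapping.keys p.
        of_rat (Poly_Mapping.lookup p m) * (\<Prod>i\<in>UNIV. y i ^ Poly_Mapping.lookup m i)) = 0"
      using assms[of "\<chi> i. y i"] by (simp add: eval_poly_def)
  qed (use m in \<open>auto intro: poly_mapping_eqI\<close>)
  then show False using m by (simp add: in_keys_iff)
qed


section \<open>Mutations and permutations of labeled seeds\<close>

lemma pos_part_nonneg [simp]: "0 \<le> pos_part a"
  by (simp add: pos_part_def)

lemma pos_part_zero [simp]: "pos_part 0 = 0"
  by (simp add: pos_part_def)

lemma skew_iff: "transpose C = - C \<longleftrightarrow> (\<forall>i j. C $ i $ j = - C $ j $ i)"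
  for C :: "int ^ 'n ^ 'n"
  by (auto simp: transpose_def vec_eq_iff)

lemma skew_diag: "transpose C = - C \<Longrightarrow> C $ i $ i = 0"
  for C :: "int ^ 'n ^ 'n"
  unfolding skew_iff by (metis neg_equal_zero)

lemma mutate_matrix_nth:
  "mutate_matrix k B $ i $ j =
     (if i = k \<or> j = k then - B $ i $ j
      else B $ i $ j + sgn (B $ i $ k) * pos_part (B $ i $ k * B $ k $ j))"
  by (simp add: mutate_matrix_def)

lemma skew_mutate_matrix:
  assumes "transpose C = - C"
  shows "transpose (mutate_matrix k C) = - mutate_matrix k C"
  unfolding skew_iff
proof (intro allI)
  fix i j
  have s: "C $ a $ b = - C $ b $ a" for a b using assms unfolding skew_iff by blast
  have "sgn p * pos_part (- (p * q)) = - (sgn q * pos_part (- (q * p)))" for p q :: int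
  proof (cases "p * q < 0")
    case True
    then show ?thesis by (auto simp: mult_less_0_iff pos_part_def mult.commute)
  next
    case False
    then have "pos_part (- (p * q)) = 0" by (simp add: pos_part_def)
    then show ?thesis by (simp add: mult.commute)
  qed
  from this[of "C $ i $ k" "C $ j $ k"]
  show "mutate_matrix k C $ i $ j = - mutate_matrix k C $ j $ i"
    using s[of i j] s[of k j] s[of k i] by (simp add: mutate_matrix_nth)
qed

lemma mutate_matrix_involution:
  assumes "transpose C = - C"
  shows "mutate_matrix k (mutate_matrix k C) = C"
  using skew_diag[OF assms, of k]
  by (simp add: vec_eq_iff mutate_matrix_nth sgn_minus)

lemma mutate_matrix_uminus: "mutate_matrix k (- C) = - mutate_matrix k C"
  by (simp add: vec_eq_iff mutate_matrix_nth sgn_minus)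

lemma mutate_vars_nth:
  "mutate_vars k (x, B) $ i =
     (if i = k
      then ((\<Prod>j\<in>UNIV. (x $ j) ^ nat (pos_part (B $ j $ k)))
             + (\<Prod>j\<in>UNIV. (x $ j) ^ nat (pos_part (- B $ j $ k)))) / x $ k
      else x $ i)"
  by (simp add: mutate_vars_def)

lemma mutate_vars_uminus: "mutate_vars k (x, - B) = mutate_vars k (x, B)"
  by (simp add: vec_eq_iff mutate_vars_nth add.commute)

lemma mutate_vars_involution:
  assumes "transpose C = - C" "x $ k \<noteq> 0" "mutate_vars k (x, C) $ k \<noteq> 0"
  shows "mutate_vars k (mutate_vars k (x, C), mutate_matrix k C) = x"
proof -
  let ?x = "mutate_vars k (x, C)"
  have a: "(\<Prod>j\<in>UNIV. (?x $ j) ^ nat (pos_part (mutate_matrix k C $ j $ k))) =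
      (\<Prod>j\<in>UNIV. (x $ j) ^ nat (pos_part (- C $ j $ k)))"
    and b: "(\<Prod>j\<in>UNIV. (?x $ j) ^ nat (pos_part (- mutate_matrix k C $ j $ k))) =
      (\<Prod>j\<in>UNIV. (x $ j) ^ nat (pos_part (C $ j $ k)))"
    using skew_diag[OF assms(1), of k]
    by (auto intro!: prod.cong simp: mutate_vars_nth mutate_matrix_nth)
  show ?thesis
    unfolding vec_eq_iff
  proof
    fix i
    show "mutate_vars k (?x, mutate_matrix k C) $ i = x $ i"
    proof (cases "i = k")
      case True
      then show ?thesis
        using assms(2,3)
        by (simp add: mutate_vars_nth[of k ?x] a b) (simp add: mutate_vars_nth add.commute)
    next
      case False
      then show ?thesis by (simp add: mutate_vars_nth)
    qed
  qed
qed

lemma mutate_permute: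
  fixes t :: "('a::field, 'n::finite) seed"
  assumes "bij \<sigma>"
  shows "mutate k (permute \<sigma> t) = permute \<sigma> (mutate (\<sigma> k) t)"
proof -
  obtain x B where t: "t = (x, B)" by (cases t)
  have inj: "\<sigma> i = \<sigma> j \<longleftrightarrow> i = j" for i j using assms by (simp add: bij_is_inj inj_eq)
  have re: "(\<Prod>j\<in>UNIV. g (\<sigma> j)) = (\<Prod>j\<in>UNIV. g j)" for g :: "_ \<Rightarrow> 'a"
    by (rule prod.reindex_bij_betw) (use assms in simp)
  have "mutate_vars k (\<chi> i. x $ \<sigma> i, \<chi> i j. B $ \<sigma> i $ \<sigma> j) =
      (\<chi> i. mutate_vars (\<sigma> k) (x, B) $ \<sigma> i)"
    using re[of "\<lambda>j. x $ j ^ nat (pos_part (B $ j $ \<sigma> k))"]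
      re[of "\<lambda>j. x $ j ^ nat (pos_part (- B $ j $ \<sigma> k))"]
    unfolding vec_eq_iff by (simp add: mutate_vars_nth inj)
  moreover have "mutate_matrix k (\<chi> i j. B $ \<sigma> i $ \<sigma> j) =
      (\<chi> i j. mutate_matrix (\<sigma> k) B $ \<sigma> i $ \<sigma> j)"
    unfolding vec_eq_iff by (simp add: mutate_matrix_nth inj)
  ultimately show ?thesis by (simp add: t mutate_def permute_def)
qed

lemma permute_permute: "permute \<sigma> (permute \<tau> t) = permute (\<tau> \<circ> \<sigma>) t"
  by (simp add: permute_def)

lemma permute_id: "permute id t = t"
  by (cases t) (simp add: permute_def)

text \<open>The exchange relation is built from sums, products and one division by the old variable. At
  positive reals the value of that variable is never zero, so there specialisation commutes with
  every sequence of mutations.\<close>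

lemma specialises_mutate_vars:
  assumes "algebraically_independent x" "\<And>i. specialises x y (u $ i) (r $ i)" "r $ k \<noteq> 0"
  shows "specialises x y (mutate_vars k (u, B) $ i) (mutate_vars k (r, B) $ i)"
  using assms
  by (auto simp: mutate_vars_nth intro!: specialises_divide specialises_add specialises_prod
      specialises_power)

lemma mutate_vars_positive:
  fixes r :: "real ^ 'n"
  assumes "\<And>i. r $ i > 0"
  shows "mutate_vars k (r, B) $ i > 0"
  using assms by (auto simp: mutate_vars_nth intro!: divide_pos_pos add_pos_pos prod_pos)

lemma specialises_of_rat: "specialises x y (of_rat c) (of_rat c)"
  using specialises_eval_poly[of x y "Poly_Mapping.single 0 c"]
  by (simp add: eval_poly_single mono_eval_def)

lemma specialises_sum:
  "(\<And>i. i \<in> I \<Longrightarrow> specialises x y (f i) (g i)) \<Longrightarrow> specialises x y (sum f I) (sum g I)"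
  by (induction I rule: infinite_finite_induct) (auto intro: specialises_zero specialises_add)

lemma specialises_eval_poly_compose:
  assumes "\<And>i. specialises x y (u $ i) (r $ i)"
  shows "specialises x y (eval_poly p u) (eval_poly p r)"
  unfolding eval_poly_def
  using assms by (intro specialises_sum specialises_mult specialises_of_rat specialises_prod
      specialises_power)

text \<open>Every tuple of positive reals is a specialisation of \<open>u\<close>, so a polynomial that
  vanishes at \<open>u\<close> vanishes on the positive orthant.\<close>

lemma algebraically_independent_transfer:
  fixes x :: "'a::field_char_0 ^ 'n::finite" and u :: "'a ^ 'm::finite"
  assumes "algebraically_independent x"
    and "\<And>y :: real ^ 'm. (\<forall>i. y $ i > 0) \<Longrightarrow> \<exists>z. \<forall>i. specialises x z (u $ i) (y $ i)"
  shows "algebraically_independent u"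
  unfolding algebraically_independent_def
proof (intro allI impI)
  fix p assume p: "eval_poly p u = 0"
  show "p = 0"
  proof (rule eval_poly_zero_on_positive)
    fix y :: "real ^ 'm" assume "\<forall>i. y $ i > 0"
    then obtain z where "\<And>i. specialises x z (u $ i) (y $ i)" using assms(2) by blast
    then have "specialises x z (eval_poly p u) (eval_poly p y)"
      by (rule specialises_eval_poly_compose)
    then have "specialises x z 0 (eval_poly p y)" by (simp only: p)
    then show "eval_poly p y = 0" by (rule specialises_unique[OF assms(1) _ specialises_zero])
  qed
qed

lemma specialises_nonzero:
  fixes r :: real
  assumes "algebraically_independent x" "specialises x y u r" "r > 0"
  shows "u \<noteq> 0"
  using specialises_inverse(1)[OF assms(1,2)] assms(3) by simp

lemma algebraically_independent_nonzero:
  assumes "algebraically_independent x"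
  shows "x $ i \<noteq> 0"
  using specialises_nonzero[OF assms specialises_var[of x "1 :: real ^ _"]] by simp

lemma algebraically_independent_inj:
  assumes "algebraically_independent x" "x $ i = x $ j"
  shows "i = j"
proof (rule ccontr)
  let ?y = "(\<chi> l. if l = i then 2 else 1) :: real ^ 'b"
  assume "i \<noteq> j"
  moreover have "?y $ i = ?y $ j"
    using specialises_unique[OF assms(1), of ?y "x $ i"] specialises_var assms(2) by metis
  ultimately show False by simp
qed

lemma mutate_vars_nonzero:
  assumes "algebraically_independent x"
  shows "mutate_vars k (x, B) $ i \<noteq> 0"
proof -
  have "specialises x 1 (x $ i) (1 $ i :: real)" for i by (rule specialises_var)
  then show ?thesis
    by (intro specialises_nonzero[OF assms specialises_mutate_vars[of x 1 x 1]])
      (auto simp: assms mutate_vars_positive)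
qed

lemma mutate_vars_in_subfield:
  assumes "is_subfield K" "\<And>i. u $ i \<in> K"
  shows "mutate_vars k (u, B) $ i \<in> K"
proof -
  have one: "1 \<in> K" and diff: "\<And>a b. a \<in> K \<Longrightarrow> b \<in> K \<Longrightarrow> a - b \<in> K"
    and mult: "\<And>a b. a \<in> K \<Longrightarrow> b \<in> K \<Longrightarrow> a * b \<in> K"
    and inv: "\<And>a. a \<in> K \<Longrightarrow> inverse a \<in> K"
    using assms(1) unfolding is_subfield_def is_subring_def by auto
  have zero: "0 \<in> K" using diff[OF one one] by simp
  have add: "a + b \<in> K" if "a \<in> K" "b \<in> K" for a b
    using diff[OF that(1) diff[OF zero that(2)]] by simp
  have pow: "a ^ m \<in> K" if "a \<in> K" for a and m :: nat
    using that by (induction m) (auto intro: one mult)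
  have prod: "prod f I \<in> K" if "\<And>j. j \<in> I \<Longrightarrow> f j \<in> K" for f and I :: "'b set"
    using that by (induction I rule: infinite_finite_induct) (auto intro: one mult)
  show ?thesis
    using assms(2) by (auto simp: mutate_vars_nth divide_inverse intro!: mult inv add prod pow)
qed

text \<open>Mutation is an involution on positive reals, so every positive tuple is the specialisation of
  the mutated tuple at the point obtained by mutating back. For the generated field, the same
  involution expresses the old variables through the new ones.\<close>

lemma labeled_seed_mutate:
  assumes "labeled_seed t"
  shows "labeled_seed (mutate k t)"
proof -
  obtain x B where t: "t = (x, B)" by (cases t)
  have ind: "algebraically_independent x" and gen: "is_subfield hull (range (($) x)) = UNIV"
    and skew: "transpose B = - B"
    using assms by (auto simp: t labeled_seed_def free_generators_def)
  let ?u = "mutate_vars k (x, B)" and ?C = "mutate_matrix k B"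
  have "algebraically_independent ?u"
  proof (rule algebraically_independent_transfer[OF ind])
    fix y :: "real ^ 'b" assume y: "\<forall>i. y $ i > 0"
    let ?z = "mutate_vars k (y, ?C)"
    have z: "?z $ i > 0" for i using y by (simp add: mutate_vars_positive)
    have "y $ k \<noteq> 0" "?z $ k \<noteq> 0"
      using y z by (metis less_irrefl)+
    then have "mutate_vars k (?z, mutate_matrix k ?C) = y"
      by (intro mutate_vars_involution skew_mutate_matrix skew)
    then have "mutate_vars k (?z, B) = y" by (simp add: mutate_matrix_involution skew)
    moreover have "specialises x ?z (?u $ i) (mutate_vars k (?z, B) $ i)" for i
      by (rule specialises_mutate_vars[OF ind specialises_var])
        (use z[of k] in simp)
    ultimately show "\<exists>z. \<forall>i. specialises x z (?u $ i) (y $ i)" by metis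
  qed
  moreover have "is_subfield hull (range (($) ?u)) = UNIV"
  proof -
    have "UNIV \<subseteq> K" if K: "is_subfield K" "range (($) ?u) \<subseteq> K" for K
    proof -
      have x: "x = mutate_vars k (?u, ?C)"
        by (simp add: mutate_vars_involution skew mutate_vars_nonzero ind
            algebraically_independent_nonzero)
      have "range (($) x) \<subseteq> K"
      proof clarify
        fix i
        show "x $ i \<in> K"
          by (subst x, rule mutate_vars_in_subfield[OF K(1)]) (use K(2) in blast)
      qed
      then show ?thesis using gen hull_minimal[of "range (($) x)" K is_subfield] K(1) by simp
    qed
    then have "UNIV \<subseteq> is_subfield hull (range (($) ?u))"
      unfolding hull_def by (intro Inter_greatest) (simp only: mem_Collect_eq)
    then show ?thesis by (rule top.extremum_uniqueI)
  qed
  ultimately show ?thesis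
    unfolding t labeled_seed_def mutate_def fst_conv snd_conv free_generators_def
    using skew_mutate_matrix[OF skew] by (intro conjI)
qed

lemma labeled_seed_permute:
  assumes "labeled_seed t" "bij \<sigma>"
  shows "labeled_seed (permute \<sigma> t)"
proof -
  obtain x B where t: "t = (x, B)" by (cases t)
  have ind: "algebraically_independent x" and gen: "is_subfield hull (range (($) x)) = UNIV"
    and skew: "transpose B = - B"
    using assms by (auto simp: t labeled_seed_def free_generators_def)
  have "algebraically_independent (\<chi> i. x $ \<sigma> i)"
  proof (rule algebraically_independent_transfer[OF ind])
    fix y :: "real ^ 'b"
    have "specialises x (\<chi> i. y $ inv_into UNIV \<sigma> i) (x $ \<sigma> i) (y $ i)" for i
      using specialises_var[of x "\<chi> i. y $ inv_into UNIV \<sigma> i" "\<sigma> i"] assms(2)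
      by (simp add: bij_is_inj)
    then show "\<exists>z. \<forall>i. specialises x z ((\<chi> i. x $ \<sigma> i) $ i) (y $ i)"
      by (intro exI[of _ "\<chi> i. y $ inv_into UNIV \<sigma> i"]) simp
  qed
  moreover have "range (($) (\<chi> i. x $ \<sigma> i)) = range (($) x)"
  proof -
    have "range (($) (\<chi> i. x $ \<sigma> i)) = ($) x ` range \<sigma>"
      by (simp add: image_image)
    then show ?thesis by (simp only: bij_is_surj[OF assms(2)])
  qed
  moreover have "transpose (\<chi> i j. B $ \<sigma> i $ \<sigma> j) = - (\<chi> i j. B $ \<sigma> i $ \<sigma> j)"
  proof -
    have "B $ i $ j = - B $ j $ i" for i j using skew unfolding skew_iff by blast
    then show ?thesis unfolding skew_iff vec_lambda_beta by blast
  qed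
  ultimately show ?thesis
    unfolding t labeled_seed_def permute_def fst_conv snd_conv free_generators_def
    using gen by simp
qed


section \<open>The labeled mutation class\<close>

lemma labeled_mutation_class_self: "s \<in> labeled_mutation_class s"
  by (simp add: labeled_mutation_class_def)

lemma labeled_mutation_class_mutate:
  "t \<in> labeled_mutation_class s \<Longrightarrow> mutate k t \<in> labeled_mutation_class s"
  unfolding labeled_mutation_class_def mem_Collect_eq
  by (erule rtranclp.rtrancl_into_rtrancl) blast

lemma labeled_mutation_class_permute:
  "t \<in> labeled_mutation_class s \<Longrightarrow> bij \<sigma> \<Longrightarrow> permute \<sigma> t \<in> labeled_mutation_class s"
  unfolding labeled_mutation_class_def mem_Collect_eq
  by (erule rtranclp.rtrancl_into_rtrancl) blast

lemma labeled_mutation_class_induct [consumes 1, case_names self mutate permute]: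
  assumes "t \<in> labeled_mutation_class s" "P s"
    and "\<And>k u. u \<in> labeled_mutation_class s \<Longrightarrow> P u \<Longrightarrow> P (mutate k u)"
    and "\<And>\<sigma> u. u \<in> labeled_mutation_class s \<Longrightarrow> bij \<sigma> \<Longrightarrow> P u \<Longrightarrow> P (permute \<sigma> u)"
  shows "P t"
proof -
  have "(\<lambda>p q. (\<exists>k. q = mutate k p) \<or> (\<exists>\<sigma>. bij \<sigma> \<and> q = permute \<sigma> p))\<^sup>*\<^sup>* s t"
    using assms(1) by (simp add: labeled_mutation_class_def)
  then show ?thesis
  proof (induction rule: rtranclp_induct)
    case base
    then show ?case by (rule assms(2))
  next
    case (step u v)
    have "u \<in> labeled_mutation_class s"
      using step(1) by (simp only: labeled_mutation_class_def mem_Collect_eq)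
    then show ?case using step(2,3) assms(3)[of u] assms(4)[of u] by auto
  qed
qed

lemma labeled_seed_class:
  assumes "labeled_seed s" "t \<in> labeled_mutation_class s"
  shows "labeled_seed t"
  using assms(2)
  by (induction rule: labeled_mutation_class_induct)
    (auto intro: assms(1) labeled_seed_mutate labeled_seed_permute)

lemma labeled_mutation_class_trans:
  assumes "t \<in> labeled_mutation_class s" "u \<in> labeled_mutation_class t"
  shows "u \<in> labeled_mutation_class s"
  using assms(2)
  by (induction rule: labeled_mutation_class_induct)
    (auto intro: assms(1) labeled_mutation_class_mutate labeled_mutation_class_permute)

lemma mutate_involution:
  assumes "labeled_seed t"
  shows "mutate k (mutate k t) = t"
  using assms
  by (cases t) (simp add: labeled_seed_def mutate_def mutate_vars_involution
      mutate_matrix_involution mutate_vars_nonzero algebraically_independent_nonzero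
      free_generators_def)

lemma labeled_mutation_class_sym:
  assumes "labeled_seed s" "t \<in> labeled_mutation_class s"
  shows "s \<in> labeled_mutation_class t"
  using assms(2)
proof (induction rule: labeled_mutation_class_induct)
  case self
  then show ?case by (rule labeled_mutation_class_self)
next
  case (mutate k u)
  have "u \<in> labeled_mutation_class (mutate k u)"
    using labeled_mutation_class_mutate[OF labeled_mutation_class_self, of k "mutate k u"]
      mutate_involution labeled_seed_class[OF assms(1) mutate(1)] by metis
  then show ?case using mutate(2) labeled_mutation_class_trans by blast
next
  case (permute \<sigma> u)
  have "permute (inv_into UNIV \<sigma>) (permute \<sigma> u) = u"
    using permute(2) by (simp add: permute_permute permute_id bij_is_surj surj_iff[THEN iffD1])
  then have "u \<in> labeled_mutation_class (permute \<sigma> u)"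
    using labeled_mutation_class_permute[OF labeled_mutation_class_self, of "inv_into UNIV \<sigma>" "permute \<sigma> u"]
      permute(2) bij_imp_bij_inv by metis
  then show ?case using permute(3) labeled_mutation_class_trans by blast
qed

lemma labeled_mutation_class_eq:
  assumes "labeled_seed s" "t \<in> labeled_mutation_class s"
  shows "labeled_mutation_class t = labeled_mutation_class s"
  using assms labeled_mutation_class_sym labeled_mutation_class_trans by blast

text \<open>Permutations can be moved past mutations, at the price of renaming the direction.\<close>

lemma labeled_mutation_class_unlabeled:
  assumes "t \<in> labeled_mutation_class s"
  shows "\<exists>u\<in>mutation_class s. \<exists>\<sigma>. bij \<sigma> \<and> t = permute \<sigma> u"
  using assms
proof (induction rule: labeled_mutation_class_induct)
  case self
  have "s \<in> mutation_class s" by (simp add: mutation_class_def)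
  then show ?case using permute_id[of s] bij_id by metis
next
  case (mutate k u)
  then obtain v \<sigma> where v: "v \<in> mutation_class s" "bij \<sigma>" "u = permute \<sigma> v" by blast
  then have "mutate (\<sigma> k) v \<in> mutation_class s"
    unfolding mutation_class_def mem_Collect_eq
    by (metis (mono_tags, lifting) rtranclp.rtrancl_into_rtrancl)
  then show ?case using v mutate_permute by blast
next
  case (permute \<tau> u)
  then obtain v \<sigma> where v: "v \<in> mutation_class s" "bij \<sigma>" "u = permute \<sigma> v" by blast
  then show ?case using permute(2) bij_comp permute_permute by blast
qed

lemma mutation_class_subset: "mutation_class s \<subseteq> labeled_mutation_class s"
proof
  fix t assume "t \<in> mutation_class s"
  then have "(\<lambda>p q. \<exists>k. q = mutate k p)\<^sup>*\<^sup>* s t" by (simp add: mutation_class_def)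
  then show "t \<in> labeled_mutation_class s"
    by (induction rule: rtranclp_induct)
      (auto intro: labeled_mutation_class_self labeled_mutation_class_mutate)
qed


section \<open>The invariant two-form\<close>

text \<open>The value of the two-form \<open>\<Sum>i j. b i j * dlog (x i) \<and> dlog (x j)\<close> on two tangent vectors, up
  to a constant factor; the vectors are given by the derivatives \<open>a $ i\<close>, \<open>c $ i\<close> of
  \<open>ln (x i)\<close>.\<close>

definition log_form :: "int ^ 'n::finite ^ 'n \<Rightarrow> real ^ 'n \<Rightarrow> real ^ 'n \<Rightarrow> real" where
  "log_form B a c = (\<Sum>i\<in>UNIV. \<Sum>j\<in>UNIV. of_int (B $ i $ j) * a $ i * c $ j)"

text \<open>The differential of mutation in logarithmic coordinates. The logarithmic derivative of
  \<open>P + Q\<close> is the mean of those of \<open>P\<close> and \<open>Q\<close> with weights \<open>w = P / (P + Q)\<close> and \<open>1 - w\<close>.\<close>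

definition mutate_tangent ::
    "real \<Rightarrow> 'n::finite \<Rightarrow> int ^ 'n ^ 'n \<Rightarrow> real ^ 'n \<Rightarrow> real ^ 'n" where
  "mutate_tangent w k B a = (\<chi> i. if i = k
     then w * (\<Sum>j\<in>UNIV. of_int (pos_part (B $ j $ k)) * a $ j)
          + (1 - w) * (\<Sum>j\<in>UNIV. of_int (pos_part (- B $ j $ k)) * a $ j) - a $ k
     else a $ i)"

lemma sum_UNIV_remove:
  "(\<Sum>i\<in>UNIV. f i) = f k + (\<Sum>i\<in>UNIV - {k}. f i)" for k :: "'n::finite"
  by (simp add: sum.remove)

lemma bilinear_sum_split:
  fixes b :: "'n::finite \<Rightarrow> 'n \<Rightarrow> real"
  assumes "b k k = 0"
  shows "(\<Sum>i\<in>UNIV. \<Sum>j\<in>UNIV. b i j * a i * c j) =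
     (\<Sum>i\<in>UNIV - {k}. \<Sum>j\<in>UNIV - {k}. b i j * a i * c j)
     + a k * (\<Sum>j\<in>UNIV - {k}. b k j * c j) + (\<Sum>i\<in>UNIV - {k}. b i k * a i) * c k"
  using assms
  by (simp add: sum_UNIV_remove[of _ k] sum.distrib sum_distrib_left sum_distrib_right
      algebra_simps)

text \<open>With \<open>P v\<close> and \<open>N v\<close> the pairings of \<open>v\<close> with the positive and the negative part of column
  \<open>k\<close>, the change of the matrix away from row and column \<open>k\<close> adds \<open>P a * N c - N a * P c\<close>, and
  the new velocity of \<open>x k\<close> contributes the opposite. The weight \<open>w\<close> only enters through
  \<open>w * (P a - N a) * (P c - N c)\<close>, which is symmetric in \<open>a\<close> and \<open>c\<close> and cancels; this is why
  the choice of the point does not matter.\<close>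

lemma log_form_mutate:
  assumes skew: "transpose B = - B"
  shows "log_form (mutate_matrix k B) (mutate_tangent w k B a) (mutate_tangent w k B c) =
    log_form B a c"
proof -
  let ?R = "UNIV - {k}"
  let ?B' = "mutate_matrix k B"
  let ?a = "mutate_tangent w k B a" and ?c = "mutate_tangent w k B c"
  define p where "p i = real_of_int (pos_part (B $ i $ k))" for i
  define m where "m i = real_of_int (pos_part (- B $ i $ k))" for i
  define b where "b i j = real_of_int (B $ i $ j)" for i j
  define P where "P v = (\<Sum>j\<in>?R. p j * v $ j)" for v :: "real ^ 'a"
  define N where "N v = (\<Sum>j\<in>?R. m j * v $ j)" for v :: "real ^ 'a"
  have kk: "B $ k $ k = 0" using skew by (rule skew_diag)
  have sk: "B $ i $ j = - B $ j $ i" for i j using skew unfolding skew_iff by blast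
  have bk: "b i k = p i - m i" for i
    by (simp add: b_def p_def m_def pos_part_def max_def)
  have bk': "b k j = m j - p j" for j
    using bk[of j] sk[of k j] by (simp add: b_def)
  have tk: "mutate_tangent w k B v $ k = w * P v + (1 - w) * N v - v $ k" for v
    using kk by (simp add: mutate_tangent_def sum_UNIV_remove[of _ k] P_def N_def p_def m_def)
  have tR: "mutate_tangent w k B v $ i = v $ i" if "i \<in> ?R" for v i
    using that by (simp add: mutate_tangent_def)
  have e1: "real_of_int (sgn u * pos_part (u * v)) =
      of_int (pos_part u) * of_int (pos_part v) - of_int (pos_part (- u)) * of_int (pos_part (- v))"
    for u v :: int
    by (auto simp: pos_part_def max_def sgn_if mult_le_0_iff zero_le_mult_iff)
  have B'R: "of_int (?B' $ i $ j) = b i j + p i * m j - m i * p j" if "i \<in> ?R" "j \<in> ?R" for i j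
    using that e1[of "B $ i $ k" "B $ k $ j"] sk[of k j]
    by (simp add: mutate_matrix_nth b_def p_def m_def del: of_int_mult)
  have B'k: "of_int (?B' $ i $ k) = - b i k" "of_int (?B' $ k $ i) = - b k i" for i
    by (simp_all add: mutate_matrix_nth b_def)
  have prod: "(\<Sum>i\<in>?R. \<Sum>j\<in>?R. f i * g j) = (\<Sum>i\<in>?R. f i) * (\<Sum>j\<in>?R. g j)"
    for f g :: "'a \<Rightarrow> real"
    by (simp add: sum_product)
  have "log_form ?B' ?a ?c =
      (\<Sum>i\<in>?R. \<Sum>j\<in>?R. of_int (?B' $ i $ j) * ?a $ i * ?c $ j)
      + ?a $ k * (\<Sum>j\<in>?R. of_int (?B' $ k $ j) * ?c $ j)
      + (\<Sum>i\<in>?R. of_int (?B' $ i $ k) * ?a $ i) * ?c $ k"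
    unfolding log_form_def by (rule bilinear_sum_split) (simp add: mutate_matrix_nth kk)
  also have "(\<Sum>i\<in>?R. \<Sum>j\<in>?R. of_int (?B' $ i $ j) * ?a $ i * ?c $ j) =
      (\<Sum>i\<in>?R. \<Sum>j\<in>?R. b i j * a $ i * c $ j + (p i * a $ i) * (m j * c $ j)
         - (m i * a $ i) * (p j * c $ j))"
    by (intro sum.cong refl) (simp only: B'R tR, simp add: algebra_simps)
  also have "\<dots> = (\<Sum>i\<in>?R. \<Sum>j\<in>?R. b i j * a $ i * c $ j) + P a * N c - N a * P c"
    by (simp only: sum.distrib sum_subtractf prod P_def N_def)
  also have "(\<Sum>j\<in>?R. of_int (?B' $ k $ j) * ?c $ j) = P c - N c"
    unfolding P_def N_def sum_subtractf[symmetric]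
    by (intro sum.cong refl) (simp only: tR B'k bk', simp add: algebra_simps)
  also have "(\<Sum>i\<in>?R. of_int (?B' $ i $ k) * ?a $ i) = N a - P a"
    unfolding P_def N_def sum_subtractf[symmetric]
    by (intro sum.cong refl) (simp only: tR B'k bk, simp add: algebra_simps)
  finally have 1: "log_form ?B' ?a ?c =
      (\<Sum>i\<in>?R. \<Sum>j\<in>?R. b i j * a $ i * c $ j) + P a * N c - N a * P c
      + (w * P a + (1 - w) * N a - a $ k) * (P c - N c)
      + (N a - P a) * (w * P c + (1 - w) * N c - c $ k)"
    by (simp only: tk)
  have "log_form B a c = (\<Sum>i\<in>?R. \<Sum>j\<in>?R. b i j * a $ i * c $ j)
      + a $ k * (\<Sum>j\<in>?R. b k j * c $ j) + (\<Sum>i\<in>?R. b i k * a $ i) * c $ k"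
    unfolding log_form_def b_def by (rule bilinear_sum_split) (simp add: kk)
  also have "(\<Sum>j\<in>?R. b k j * c $ j) = N c - P c"
    unfolding P_def N_def sum_subtractf[symmetric]
    by (intro sum.cong refl) (simp only: bk', simp add: algebra_simps)
  also have "(\<Sum>i\<in>?R. b i k * a $ i) = P a - N a"
    unfolding P_def N_def sum_subtractf[symmetric]
    by (intro sum.cong refl) (simp only: bk, simp add: algebra_simps)
  finally have 2: "log_form B a c = (\<Sum>i\<in>?R. \<Sum>j\<in>?R. b i j * a $ i * c $ j)
      + a $ k * (N c - P c) + (P a - N a) * c $ k" .
  show ?thesis unfolding 1 2 by (simp add: algebra_simps)
qed

lemma log_form_permute:
  assumes "bij \<sigma>"
  shows "log_form (\<chi> i j. B $ \<sigma> i $ \<sigma> j) (\<chi> i. a $ \<sigma> i) (\<chi> i. c $ \<sigma> i) = log_form B a c"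
proof -
  have re: "(\<Sum>i\<in>UNIV. g (\<sigma> i)) = (\<Sum>i\<in>UNIV. g i)" for g :: "_ \<Rightarrow> real"
    by (rule sum.reindex_bij_betw) (use assms in simp)
  show ?thesis
    using re[of "\<lambda>i. \<Sum>j\<in>UNIV. of_int (B $ i $ j) * a $ i * c $ j"]
    by (simp add: log_form_def re[where g = "\<lambda>j. of_int (B $ _ $ j) * a $ _ * c $ j"])
qed

lemma log_form_axis: "log_form B (axis i 1) (axis j 1) = of_int (B $ i $ j)"
proof -
  have "log_form B (axis i 1) (axis j 1) =
      (\<Sum>l\<in>UNIV. \<Sum>m\<in>UNIV. if l = i \<and> m = j then of_int (B $ l $ m) else 0)"
    unfolding log_form_def by (intro sum.cong refl) (auto simp: axis_def)
  also have "\<dots> = (\<Sum>l\<in>UNIV. if l = i then of_int (B $ l $ j) else 0)"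
    by (intro sum.cong refl) auto
  finally show ?thesis by simp
qed

lemma has_log_derivative_prod:
  fixes f :: "'i \<Rightarrow> real \<Rightarrow> real"
  assumes "finite J" "\<And>j. j \<in> J \<Longrightarrow> (f j has_real_derivative a j * f j z) (at z)"
  shows "((\<lambda>e. \<Prod>j\<in>J. f j e ^ n j) has_real_derivative
     (\<Sum>j\<in>J. real (n j) * a j) * (\<Prod>j\<in>J. f j z ^ n j)) (at z)"
  using assms
proof (induction J rule: finite_induct)
  case empty
  then show ?case by simp
next
  case (insert j J)
  have "((\<lambda>e. f j e ^ n j) has_real_derivative real (n j) * a j * f j z ^ n j) (at z)"
    by (cases "n j") (use DERIV_power[OF insert.prems[of j], of "n j"] in \<open>simp_all add: algebra_simps\<close>)
  from DERIV_mult[OF this insert.IH] insert show ?case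
    by (simp add: algebra_simps)
qed

lemma weighted_mean:
  fixes w :: real
  assumes "w * (P + Q) = P"
  shows "p * P + q * Q = (w * p + (1 - w) * q) * (P + Q)"
proof -
  have "(w * p + (1 - w) * q) * (P + Q) = p * (w * (P + Q)) + q * (P + Q - w * (P + Q))"
    by (simp add: algebra_simps)
  then show ?thesis by (simp add: assms)
qed

text \<open>The tangent \<open>a\<close> consists of logarithmic derivatives, and \<open>w\<close> is the share of the first
  monomial in the exchange binomial.\<close>

lemma has_log_derivative_mutate:
  fixes h :: "real \<Rightarrow> real ^ 'n::finite"
  assumes pos: "\<And>e i. h e $ i > 0"
    and der: "\<And>i. ((\<lambda>e. h e $ i) has_real_derivative a $ i * h 0 $ i) (at 0)"
    and w: "w = (\<Prod>j\<in>UNIV. (h 0 $ j) ^ nat (pos_part (B $ j $ k))) /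
      ((\<Prod>j\<in>UNIV. (h 0 $ j) ^ nat (pos_part (B $ j $ k)))
        + (\<Prod>j\<in>UNIV. (h 0 $ j) ^ nat (pos_part (- B $ j $ k))))"
  shows "((\<lambda>e. mutate_vars k (h e, B) $ i) has_real_derivative
     mutate_tangent w k B a $ i * mutate_vars k (h 0, B) $ i) (at 0)"
proof (cases "i = k")
  case False
  then show ?thesis using der by (simp add: mutate_vars_nth mutate_tangent_def)
next
  case True
  let ?P = "\<lambda>e. \<Prod>j\<in>UNIV. (h e $ j) ^ nat (pos_part (B $ j $ k))"
  let ?Q = "\<lambda>e. \<Prod>j\<in>UNIV. (h e $ j) ^ nat (pos_part (- B $ j $ k))"
  let ?p = "\<Sum>j\<in>UNIV. of_int (pos_part (B $ j $ k)) * a $ j"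
  let ?q = "\<Sum>j\<in>UNIV. of_int (pos_part (- B $ j $ k)) * a $ j"
  have P: "(?P has_real_derivative ?p * ?P 0) (at 0)"
    using has_log_derivative_prod[of UNIV "\<lambda>j e. h e $ j" "\<lambda>j. a $ j" 0
        "\<lambda>j. nat (pos_part (B $ j $ k))"] der by simp
  have Q: "(?Q has_real_derivative ?q * ?Q 0) (at 0)"
    using has_log_derivative_prod[of UNIV "\<lambda>j e. h e $ j" "\<lambda>j. a $ j" 0
        "\<lambda>j. nat (pos_part (- B $ j $ k))"] der by simp
  have hk: "h 0 $ k \<noteq> 0" using pos by (metis less_irrefl)
  have PQ: "?P 0 + ?Q 0 > 0" using pos by (intro add_pos_pos prod_pos) auto
  have "((\<lambda>e. (?P e + ?Q e) / h e $ k) has_real_derivative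
      ((?p * ?P 0 + ?q * ?Q 0) * h 0 $ k - (?P 0 + ?Q 0) * (a $ k * h 0 $ k)) / (h 0 $ k * h 0 $ k))
      (at 0)"
    by (rule DERIV_divide[OF DERIV_add[OF P Q] der hk])
  moreover have "w * (?P 0 + ?Q 0) = ?P 0"
    by (rule nonzero_eq_divide_eq[THEN iffD1, OF less_imp_neq[OF PQ, symmetric] w])
  then have "?p * ?P 0 + ?q * ?Q 0 = (w * ?p + (1 - w) * ?q) * (?P 0 + ?Q 0)"
    by (rule weighted_mean)
  then have "((?p * ?P 0 + ?q * ?Q 0) * h 0 $ k - (?P 0 + ?Q 0) * (a $ k * h 0 $ k)) /
      (h 0 $ k * h 0 $ k) = (w * ?p + (1 - w) * ?q - a $ k) * ((?P 0 + ?Q 0) / h 0 $ k)"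
    using hk by (simp only:) (simp add: field_simps)
  ultimately show ?thesis
    using True by (simp add: mutate_vars_nth mutate_tangent_def)
qed

text \<open>The curve \<open>h\<close> of positive reals is what \<open>u\<close> becomes along
  \<open>x $ i = exp (\<alpha> $ i * e)\<close>, and \<open>a\<close> is its logarithmic velocity at \<open>e = 0\<close>.\<close>

definition tracks ::
    "'a::field_char_0 ^ 'n::finite \<Rightarrow> real ^ 'n \<Rightarrow> 'a ^ 'n \<Rightarrow> (real \<Rightarrow> real ^ 'n) \<Rightarrow> real ^ 'n \<Rightarrow> bool"
  where "tracks x \<alpha> u h a \<longleftrightarrow>
    (\<forall>e i. specialises x (\<chi> j. exp (\<alpha> $ j * e)) (u $ i) (h e $ i) \<and> h e $ i > 0) \<and>
    (\<forall>i. ((\<lambda>e. h e $ i) has_real_derivative a $ i * h 0 $ i) (at 0))"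

lemma tracks_self: "tracks x \<alpha> x (\<lambda>e. \<chi> i. exp (\<alpha> $ i * e)) \<alpha>"
proof -
  have "specialises x (\<chi> j. exp (\<alpha> $ j * e)) (x $ i) (exp (\<alpha> $ i * e))" for e i
    using specialises_var[of x "\<chi> j. exp (\<alpha> $ j * e)" i] by simp
  moreover have "((\<lambda>e. exp (\<alpha> $ i * e)) has_real_derivative \<alpha> $ i) (at 0)" for i
    by (auto intro!: derivative_eq_intros)
  ultimately show ?thesis by (simp add: tracks_def)
qed

lemma tracks_mutate:
  assumes "algebraically_independent x" "tracks x \<alpha> u h a"
    and "w = (\<Prod>j\<in>UNIV. (h 0 $ j) ^ nat (pos_part (B $ j $ k))) /
      ((\<Prod>j\<in>UNIV. (h 0 $ j) ^ nat (pos_part (B $ j $ k)))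
        + (\<Prod>j\<in>UNIV. (h 0 $ j) ^ nat (pos_part (- B $ j $ k))))"
  shows "tracks x \<alpha> (mutate_vars k (u, B)) (\<lambda>e. mutate_vars k (h e, B)) (mutate_tangent w k B a)"
  unfolding tracks_def
proof (intro conjI allI)
  have sp: "\<And>e i. specialises x (\<chi> j. exp (\<alpha> $ j * e)) (u $ i) (h e $ i)"
    and pos: "\<And>e i. h e $ i > 0"
    and der: "\<And>i. ((\<lambda>e. h e $ i) has_real_derivative a $ i * h 0 $ i) (at 0)"
    using assms(2) unfolding tracks_def by blast+
  fix e i
  have "h e $ k \<noteq> 0" using pos[of e k] by simp
  then show "specialises x (\<chi> j. exp (\<alpha> $ j * e)) (mutate_vars k (u, B) $ i)
      (mutate_vars k (h e, B) $ i)"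
    by (rule specialises_mutate_vars[OF assms(1) sp])
  show "mutate_vars k (h e, B) $ i > 0" using pos by (rule mutate_vars_positive)
  show "((\<lambda>e. mutate_vars k (h e, B) $ i) has_real_derivative
      mutate_tangent w k B a $ i * mutate_vars k (h 0, B) $ i) (at 0)"
    using pos der assms(3) by (rule has_log_derivative_mutate)
qed

lemma tracks_permute:
  assumes "tracks x \<alpha> u h a"
  shows "tracks x \<alpha> (\<chi> i. u $ \<sigma> i) (\<lambda>e. \<chi> i. h e $ \<sigma> i) (\<chi> i. a $ \<sigma> i)"
  using assms by (simp add: tracks_def)

lemma log_form_tracks:
  assumes "labeled_seed t" "u \<in> labeled_mutation_class t"
  shows "\<exists>h g a c. tracks (fst t) \<alpha> (fst u) h a \<and> tracks (fst t) \<beta> (fst u) g c \<and> h 0 = g 0 \<and>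
    log_form (snd u) a c = log_form (snd t) \<alpha> \<beta>"
  using assms(2)
proof (induction rule: labeled_mutation_class_induct)
  case self
  show ?case
    by (intro exI conjI) (rule tracks_self, rule tracks_self, simp_all)
next
  case (mutate k u)
  obtain z B where u: "u = (z, B)" by (cases u)
  have ind: "algebraically_independent (fst t)"
    using assms(1) by (simp add: labeled_seed_def free_generators_def)
  have skew: "transpose B = - B"
    using labeled_seed_class[OF assms(1) mutate(1)] by (simp add: u labeled_seed_def)
  from mutate(2) obtain h g a c where
    h: "tracks (fst t) \<alpha> z h a" and g: "tracks (fst t) \<beta> z g c" and hg: "h 0 = g 0"
    and form: "log_form B a c = log_form (snd t) \<alpha> \<beta>"
    by (auto simp: u)
  define w where "w = (\<Prod>j\<in>UNIV. (h 0 $ j) ^ nat (pos_part (B $ j $ k))) /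
      ((\<Prod>j\<in>UNIV. (h 0 $ j) ^ nat (pos_part (B $ j $ k)))
        + (\<Prod>j\<in>UNIV. (h 0 $ j) ^ nat (pos_part (- B $ j $ k))))"
  have "tracks (fst t) \<alpha> (fst (mutate k u)) (\<lambda>e. mutate_vars k (h e, B)) (mutate_tangent w k B a)"
    using tracks_mutate[OF ind h w_def] by (simp add: u mutate_def)
  moreover have
    "tracks (fst t) \<beta> (fst (mutate k u)) (\<lambda>e. mutate_vars k (g e, B)) (mutate_tangent w k B c)"
    using tracks_mutate[OF ind g w_def[unfolded hg]] by (simp add: u mutate_def)
  moreover have "log_form (snd (mutate k u)) (mutate_tangent w k B a) (mutate_tangent w k B c) =
      log_form (snd t) \<alpha> \<beta>"
    using log_form_mutate[OF skew, of k w a c] form by (simp add: u mutate_def)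
  moreover have "mutate_vars k (h 0, B) = mutate_vars k (g 0, B)" by (simp add: hg)
  ultimately show ?case by blast
next
  case (permute \<sigma> u)
  from permute(3) obtain h g a c where
    h: "tracks (fst t) \<alpha> (fst u) h a" and g: "tracks (fst t) \<beta> (fst u) g c" and hg: "h 0 = g 0"
    and form: "log_form (snd u) a c = log_form (snd t) \<alpha> \<beta>"
    by blast
  show ?case
  proof (intro exI conjI)
    show "tracks (fst t) \<alpha> (fst (permute \<sigma> u)) (\<lambda>e. \<chi> i. h e $ \<sigma> i) (\<chi> i. a $ \<sigma> i)"
      using tracks_permute[OF h] by (simp add: permute_def)
    show "tracks (fst t) \<beta> (fst (permute \<sigma> u)) (\<lambda>e. \<chi> i. g e $ \<sigma> i) (\<chi> i. c $ \<sigma> i)"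
      using tracks_permute[OF g] by (simp add: permute_def)
    show "(\<chi> i. h 0 $ \<sigma> i) = (\<chi> i. g 0 $ \<sigma> i)" by (simp add: hg)
    show "log_form (snd (permute \<sigma> u)) (\<chi> i. a $ \<sigma> i) (\<chi> i. c $ \<sigma> i) =
        log_form (snd t) \<alpha> \<beta>"
      using log_form_permute[OF permute(2)] form by (simp add: permute_def)
  qed
qed

lemma tracks_tangent_unique:
  assumes "algebraically_independent x" "tracks x \<alpha> u h a" "tracks x \<alpha> u g c"
  shows "a = c"
proof -
  have "h e $ i = g e $ i" for e i
    using assms specialises_unique[OF assms(1)] unfolding tracks_def by blast
  then have hg: "h = g" by (simp add: fun_eq_iff vec_eq_iff)
  have "a $ i * h 0 $ i = c $ i * h 0 $ i" for i
    using assms(2,3) DERIV_unique unfolding tracks_def hg by blast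
  moreover have "h 0 $ i \<noteq> 0" for i using assms(2) unfolding tracks_def by (metis less_irrefl)
  ultimately show ?thesis by (simp add: vec_eq_iff)
qed

text \<open>Taking \<open>t\<close> as the initial seed, a seed \<open>u\<close> with the same variables has the same velocities along
  every curve, so invariance of the form on the coordinate directions \<open>i\<close>, \<open>j\<close> reads off the
  entry of \<open>snd u\<close>.\<close>

theorem labeled_seed_determined:
  assumes "labeled_seed s" "t \<in> labeled_mutation_class s" "u \<in> labeled_mutation_class s"
    and "fst t = fst u"
  shows "t = u"
proof -
  have t: "labeled_seed t" using assms(1,2) by (rule labeled_seed_class)
  then have ind: "algebraically_independent (fst t)"
    by (simp add: labeled_seed_def free_generators_def)
  have u: "u \<in> labeled_mutation_class t"
    using labeled_mutation_class_eq[OF assms(1,2)] assms(3) by simp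
  have "snd u $ i $ j = snd t $ i $ j" for i j
  proof -
    obtain h g a c where h: "tracks (fst t) (axis i 1) (fst t) h a"
      and g: "tracks (fst t) (axis j 1) (fst t) g c"
      and form: "log_form (snd u) a c = log_form (snd t) (axis i 1) (axis j 1)"
      using log_form_tracks[OF t u, of "axis i 1" "axis j 1"] assms(4) by auto
    have "a = axis i 1" "c = axis j 1"
      using tracks_tangent_unique[OF ind _ tracks_self] h g by blast+
    then show ?thesis using form by (simp add: log_form_axis)
  qed
  then show ?thesis using assms(4) by (simp add: prod_eq_iff vec_eq_iff)
qed


section \<open>Commutation and pentagon relations\<close>

lemma specialises_fold_mutate:
  fixes y :: "real ^ 'n::finite"
  assumes "algebraically_independent x" "\<And>i. specialises x y (u $ i) (r $ i)" "\<And>i. r $ i > 0"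
  shows "specialises x y (fst (fold mutate ks (u, B)) $ i) (fst (fold mutate ks (r, B)) $ i)"
  using assms(2,3)
proof (induction ks arbitrary: u r B i)
  case Nil
  then show ?case by simp
next
  case (Cons k ks)
  have "r $ k \<noteq> 0" using Cons.prems(2)[of k] by simp
  then have "specialises x y (mutate_vars k (u, B) $ i) (mutate_vars k (r, B) $ i)" for i
    by (rule specialises_mutate_vars[OF assms(1) Cons.prems(1)])
  from Cons.IH[OF this mutate_vars_positive[OF Cons.prems(2)]]
  show ?case by (simp add: mutate_def)
qed

lemma fold_mutate_eq_positive:
  fixes y :: "real ^ 'n::finite"
  assumes "algebraically_independent x" "\<And>i. y $ i > 0"
    and "fst (fold mutate ks (x, B)) $ i = fst (fold mutate ls (x, B)) $ j"
  shows "fst (fold mutate ks (y, B)) $ i = fst (fold mutate ls (y, B)) $ j"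
proof (rule specialises_unique[OF assms(1)])
  show "specialises x y (fst (fold mutate ks (x, B)) $ i) (fst (fold mutate ks (y, B)) $ i)"
    using assms(1) specialises_var assms(2) by (rule specialises_fold_mutate)
  show "specialises x y (fst (fold mutate ks (x, B)) $ i) (fst (fold mutate ls (y, B)) $ j)"
    unfolding assms(3) using assms(1) specialises_var assms(2) by (rule specialises_fold_mutate)
qed

lemma mutate_vars_rank_two_at_ones:
  fixes r :: "real ^ 'n::finite"
  assumes "\<And>l. l \<noteq> i \<Longrightarrow> l \<noteq> j \<Longrightarrow> r $ l = 1" "B $ i $ i = 0"
  shows "mutate_vars i (r, B) $ i = (1 + (r $ j) ^ nat \<bar>B $ j $ i\<bar>) / r $ i"
proof -
  have "(\<Prod>l\<in>UNIV. (r $ l) ^ nat (pos_part (c * B $ l $ i))) = (r $ j) ^ nat (pos_part (c * B $ j $ i))"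
    for c :: int
  proof -
    have "(\<Prod>l\<in>UNIV. (r $ l) ^ nat (pos_part (c * B $ l $ i))) =
        (\<Prod>l\<in>UNIV. if l = j then (r $ j) ^ nat (pos_part (c * B $ j $ i)) else 1)"
    proof (intro prod.cong refl)
      fix l
      show "(r $ l) ^ nat (pos_part (c * B $ l $ i)) =
          (if l = j then (r $ j) ^ nat (pos_part (c * B $ j $ i)) else 1)"
        using assms by (cases "l = i") auto
    qed
    then show ?thesis by simp
  qed
  from this[of 1] this[of "-1"] show ?thesis
    by (auto simp: mutate_vars_nth pos_part_def abs_if max_def)
qed

text \<open>If \<open>b = \<bar>B $ i $ j\<bar>\<close> then the two orders of mutation give the variable in direction \<open>i\<close> the
  values \<open>1 + 2 ^ b\<close> and \<open>2\<close> where all initial variables are \<open>1\<close>, so commuting mutations force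
  \<open>b = 0\<close>. If \<open>b = 0\<close> then neither exchange relation involves the other variable; it is enough to
  compare the variables, because they determine the matrix.\<close>

theorem mutate_commute_iff:
  assumes "labeled_seed t" "i \<noteq> j"
  shows "mutate i (mutate j t) = mutate j (mutate i t) \<longleftrightarrow> snd t $ i $ j = 0"
proof -
  obtain x B where t: "t = (x, B)" by (cases t)
  have ind: "algebraically_independent x" and skew: "transpose B = - B"
    using assms by (auto simp: t labeled_seed_def free_generators_def)
  have sk: "B $ k $ l = - B $ l $ k" for k l using skew unfolding skew_iff by blast
  have diag: "B $ i $ i = 0" "B $ j $ j = 0" using skew by (simp_all add: skew_diag)
  show ?thesis
  proof
    assume eq: "mutate i (mutate j t) = mutate j (mutate i t)"
    let ?y = "1 :: real ^ 'b"
    have "fst (fold mutate [j, i] (x, B)) $ i = fst (fold mutate [i, j] (x, B)) $ i"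
      using eq by (simp add: t)
    then have e: "fst (fold mutate [j, i] (?y, B)) $ i = fst (fold mutate [i, j] (?y, B)) $ i"
      by (rule fold_mutate_eq_positive[OF ind, rotated]) simp
    have 1: "mutate_vars i (?y, B) $ i = 2" "mutate_vars j (?y, B) $ j = 2"
      using mutate_vars_rank_two_at_ones[of i j ?y B] mutate_vars_rank_two_at_ones[of j i ?y B] diag
      by simp_all
    have "mutate_vars i (mutate_vars j (?y, B), mutate_matrix j B) $ i =
        (1 + 2 ^ nat \<bar>B $ j $ i\<bar>) / 1"
      using mutate_vars_rank_two_at_ones[of i j "mutate_vars j (?y, B)" "mutate_matrix j B"]
        skew_diag[OF skew_mutate_matrix[OF skew], of j i] 1 assms(2)
      by (simp add: mutate_vars_nth mutate_matrix_nth)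
    moreover have "mutate_vars j (mutate_vars i (?y, B), mutate_matrix i B) $ i = 2"
      using 1 assms(2) by (simp add: mutate_vars_nth[of j])
    ultimately have "(2::real) ^ nat \<bar>B $ j $ i\<bar> = 1" using e by (simp add: mutate_def)
    then have "nat \<bar>B $ j $ i\<bar> = 0"
      using one_less_power[of "2 :: real" "nat \<bar>B $ j $ i\<bar>"] by (cases "nat \<bar>B $ j $ i\<bar> = 0") simp_all
    then have "B $ j $ i = 0" by simp
    then show "snd t $ i $ j = 0" using sk[of i j] by (simp add: t)
  next
    assume "snd t $ i $ j = 0"
    then have ij: "B $ i $ j = 0" "B $ j $ i = 0" using sk[of j i] by (simp_all add: t)
    have slot: "mutate_vars k (mutate_vars l (x, B), mutate_matrix l B) $ k =
        mutate_vars l (mutate_vars k (x, B), mutate_matrix k B) $ k"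
      if "B $ k $ l = 0" "B $ l $ k = 0" "k \<noteq> l" for k l
    proof -
      have p: "(\<Prod>m\<in>UNIV. (mutate_vars l (x, B) $ m) ^ nat (pos_part (c * mutate_matrix l B $ m $ k)))
          = (\<Prod>m\<in>UNIV. (x $ m) ^ nat (pos_part (c * B $ m $ k)))" for c
        using that by (intro prod.cong refl) (auto simp: mutate_vars_nth mutate_matrix_nth)
      show ?thesis
        using that p[of 1] p[of "-1"] by (simp add: mutate_vars_nth[of k] mutate_vars_nth[of l _ _ k])
    qed
    have fst_eq: "fst (mutate i (mutate j t)) = fst (mutate j (mutate i t))"
      unfolding vec_eq_iff
    proof
      fix l
      show "fst (mutate i (mutate j t)) $ l = fst (mutate j (mutate i t)) $ l"
        using slot[OF ij assms(2)] slot[OF ij(2,1) assms(2)[symmetric]]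
        by (cases "l = i"; cases "l = j")
          (simp_all add: t mutate_def mutate_vars_nth[of i _ _ l] mutate_vars_nth[of j _ _ l])
    qed
    show "mutate i (mutate j t) = mutate j (mutate i t)"
      by (rule labeled_seed_determined[OF assms(1) _ _ fst_eq])
        (intro labeled_mutation_class_mutate labeled_mutation_class_self)+
  qed
qed

text \<open>The sequence \<open>x\<^sub>1, x\<^sub>2, \<dots>\<close> of the rank two cluster algebra of type \<open>A\<^sub>2\<close> with
  coefficients has period five up to a swap. The pairs \<open>u, v\<close> are the coefficients of the
  successive exchange relations.\<close>

lemma pentagon_recurrence:
  fixes xi :: "'a::field"
  assumes nz: "xi \<noteq> 0" "xj \<noteq> 0" "X1 \<noteq> 0" "Y1 \<noteq> 0" "X2 \<noteq> 0" "u1 \<noteq> 0" "u2 \<noteq> 0"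
    and X1: "X1 = (u1 + v1 * xj) / xi" and Y1: "Y1 = (u2 + v2 * X1) / xj"
    and X2: "X2 = (u3 + v3 * Y1) / X1" and Y2: "Y2 = (u4 + v4 * X2) / Y1"
    and X3: "X3 = (u5 + v5 * Y2) / X2"
    and r: "u3 * u1 = v3 * v1 * u2" "u4 * u2 = v4 * v2 * u3" "v4 * v3 = u1" "v5 * u1 = v3 * u2"
      "u5 = v3 * v2"
  shows "Y2 = xi" "X3 = xj"
proof -
  have a1: "X1 * xi = u1 + v1 * xj" using X1 nz by simp
  have a2: "Y1 * xj = u2 + v2 * X1" using Y1 nz by simp
  have a3: "X2 * X1 = u3 + v3 * Y1" using X2 nz by simp
  have "(u1 * xj * X2) * X1 = (v3 * (u2 * xi + u1 * v2)) * X1"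
  proof -
    have "(u1 * xj * X2) * X1 = u1 * xj * (X2 * X1)" by (simp add: mult.assoc)
    also have "\<dots> = u3 * u1 * xj + u1 * v3 * (Y1 * xj)"
      unfolding a3 by (simp add: algebra_simps)
    also have "\<dots> = v3 * v1 * u2 * xj + u1 * v3 * (u2 + v2 * X1)" unfolding r(1) a2 ..
    also have "\<dots> = v3 * u2 * (u1 + v1 * xj) + u1 * v3 * v2 * X1" by (simp add: algebra_simps)
    also have "\<dots> = v3 * (u2 * xi + u1 * v2) * X1"
      unfolding a1[symmetric] by (simp add: algebra_simps)
    finally show ?thesis .
  qed
  then have b: "u1 * xj * X2 = v3 * (u2 * xi + u1 * v2)"
    using mult_right_cancel[OF nz(3)] by blast
  have "u2 * u1 * xj * (u4 + v4 * X2) = u2 * u1 * xj * (Y1 * xi)"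
  proof -
    have "u2 * u1 * xj * (u4 + v4 * X2) = u1 * xj * (u4 * u2) + u2 * v4 * (u1 * xj * X2)"
      by (simp add: algebra_simps)
    also have "\<dots> = v4 * v2 * (u3 * u1) * xj + u2 * (v4 * v3) * (u2 * xi + u1 * v2)"
      unfolding r(2) b by (simp add: algebra_simps)
    also have "\<dots> = (v4 * v3) * u2 * (v1 * v2 * xj + u2 * xi + u1 * v2)"
      unfolding r(1) by (simp add: algebra_simps)
    also have "\<dots> = u1 * u2 * (v2 * (u1 + v1 * xj) + u2 * xi)"
      unfolding r(3) by (simp add: algebra_simps)
    also have "\<dots> = u1 * u2 * xi * (u2 + v2 * X1)"
      unfolding a1[symmetric] by (simp add: algebra_simps)
    also have "\<dots> = u2 * u1 * xj * (Y1 * xi)"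
      unfolding a2[symmetric] by (simp add: algebra_simps)
    finally show ?thesis .
  qed
  then have "u4 + v4 * X2 = Y1 * xi" using nz by simp
  then show Y2': "Y2 = xi" using nz by (simp add: Y2)
  have "u1 * (u5 + v5 * xi) = u1 * (xj * X2)"
  proof -
    have "u1 * (u5 + v5 * xi) = u1 * u5 + (v5 * u1) * xi" by (simp add: algebra_simps)
    also have "\<dots> = u1 * (xj * X2)"
      unfolding r(4,5) using b by (simp add: algebra_simps)
    finally show ?thesis .
  qed
  then have "u5 + v5 * xi = xj * X2" using nz by simp
  then show "X3 = xj" using nz by (simp add: X3 Y2')
qed

text \<open>The part of an exchange monomial that comes from the directions \<open>R\<close>, which do not move in the
  rank two subpattern.\<close>

definition exchange_coeff :: "'n set \<Rightarrow> 'a::field ^ 'n::finite \<Rightarrow> ('n \<Rightarrow> int) \<Rightarrow> 'a" where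
  "exchange_coeff R x e = (\<Prod>l\<in>R. (x $ l) ^ nat (pos_part (e l)))"

lemma exchange_coeff_mult:
  "exchange_coeff R x e * exchange_coeff R x f =
     (\<Prod>l\<in>R. (x $ l) ^ nat (pos_part (e l) + pos_part (f l)))"
  by (simp add: exchange_coeff_def prod.distrib[symmetric] power_add[symmetric]
      nat_add_distrib)

lemma exchange_coeff_mult3:
  "exchange_coeff R x e * exchange_coeff R x f * exchange_coeff R x g =
     (\<Prod>l\<in>R. (x $ l) ^ nat (pos_part (e l) + pos_part (f l) + pos_part (g l)))"
  by (simp add: exchange_coeff_def prod.distrib[symmetric] power_add[symmetric]
      nat_add_distrib)

lemma mutate_vars_single_arrow:
  fixes x :: "'a::field ^ 'n::finite"
  assumes "B $ i $ i = 0" "B $ j $ i = -1" "i \<noteq> j"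
  shows "mutate_vars i (x, B) $ i =
    (exchange_coeff (UNIV - {i, j}) x (\<lambda>l. B $ l $ i)
      + exchange_coeff (UNIV - {i, j}) x (\<lambda>l. - B $ l $ i) * x $ j) / x $ i"
proof -
  have "(\<Prod>l\<in>UNIV. f l) = f i * f j * (\<Prod>l\<in>UNIV - {i, j}. f l)" for f :: "'n \<Rightarrow> 'a"
  proof -
    have "UNIV = insert i (insert j (UNIV - {i, j}))" by auto
    then have "(\<Prod>l\<in>UNIV. f l) = (\<Prod>l\<in>insert i (insert j (UNIV - {i, j})). f l)" by simp
    also have "\<dots> = f i * (f j * (\<Prod>l\<in>UNIV - {i, j}. f l))"
      using assms(3) by (subst prod.insert) auto
    finally show ?thesis by (simp add: mult.assoc)
  qed
  note split = this
  show ?thesis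
    using assms
    by (simp add: mutate_vars_nth exchange_coeff_def split pos_part_def mult.commute)
qed

lemma exchange_coeff_cong:
  "(\<And>l. l \<in> R \<Longrightarrow> x $ l = y $ l) \<Longrightarrow> (\<And>l. l \<in> R \<Longrightarrow> e l = f l) \<Longrightarrow>
    exchange_coeff R x e = exchange_coeff R y f"
  by (simp add: exchange_coeff_def)

lemma mutate_matrix_single_arrow:
  assumes "transpose B = - B" "B $ i $ j = 1"
  shows "mutate_matrix i B $ j $ i = 1"
    and "l \<noteq> i \<Longrightarrow> l \<noteq> j \<Longrightarrow> mutate_matrix i B $ l $ i = - B $ l $ i"
    and "l \<noteq> i \<Longrightarrow> l \<noteq> j \<Longrightarrow> mutate_matrix i B $ l $ j = B $ l $ j + pos_part (B $ l $ i)"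
proof -
  have sk: "B $ j $ i = - B $ i $ j" using assms(1) unfolding skew_iff by blast
  have "j \<noteq> i" using skew_diag[OF assms(1), of i] assms(2) by auto
  then show "mutate_matrix i B $ j $ i = 1"
    and "l \<noteq> i \<Longrightarrow> l \<noteq> j \<Longrightarrow> mutate_matrix i B $ l $ i = - B $ l $ i"
    and "l \<noteq> i \<Longrightarrow> l \<noteq> j \<Longrightarrow> mutate_matrix i B $ l $ j = B $ l $ j + pos_part (B $ l $ i)"
    using assms(2) sk by (auto simp: mutate_matrix_nth pos_part_def sgn_if)
qed

lemma mutate_vars_arrow_step:
  assumes "transpose C = - C" "C $ i $ j = 1" "\<forall>l\<in>UNIV - {i, j}. z $ l = x $ l"
  shows "mutate_vars i (z, C) $ i =
      (exchange_coeff (UNIV - {i, j}) x (\<lambda>l. C $ l $ i)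
        + exchange_coeff (UNIV - {i, j}) x (\<lambda>l. - C $ l $ i) * z $ j) / z $ i"
    and "mutate_vars i (z, C) $ j = z $ j"
    and "\<forall>l\<in>UNIV - {i, j}. mutate_vars i (z, C) $ l = x $ l"
proof -
  have ij: "i \<noteq> j" using skew_diag[OF assms(1), of i] assms(2) by auto
  have "C $ j $ i = - C $ i $ j" using assms(1) unfolding skew_iff by blast
  then have ji: "C $ j $ i = -1" using assms(2) by simp
  have e: "exchange_coeff (UNIV - {i, j}) z f = exchange_coeff (UNIV - {i, j}) x f" for f
    by (rule exchange_coeff_cong) (use assms(3) in auto)
  show "mutate_vars i (z, C) $ i =
      (exchange_coeff (UNIV - {i, j}) x (\<lambda>l. C $ l $ i)
        + exchange_coeff (UNIV - {i, j}) x (\<lambda>l. - C $ l $ i) * z $ j) / z $ i"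
    using mutate_vars_single_arrow[of C i j z, OF skew_diag[OF assms(1)] ji ij] by (simp only: e)
  show "mutate_vars i (z, C) $ j = z $ j" using ij by (simp add: mutate_vars_nth)
  show "\<forall>l\<in>UNIV - {i, j}. mutate_vars i (z, C) $ l = x $ l"
    using assms(3) by (simp add: mutate_vars_nth)
qed

definition swap_indices :: "'n \<Rightarrow> 'n \<Rightarrow> 'n \<Rightarrow> 'n" where
  "swap_indices i j l = (if l = i then j else if l = j then i else l)"

lemma bij_swap_indices: "bij (swap_indices i j)"
  by (rule o_bij[of "swap_indices i j"]) (auto simp: fun_eq_iff swap_indices_def)

text \<open>Only the variables have to be compared: the matrices then agree as well, by
  \<open>labeled_seed_determined\<close>. For the variables it remains to see that the coefficients of the
  five exchange relations satisfy the hypotheses of \<open>pentagon_recurrence\<close>.\<close>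

theorem pentagon_relation:
  assumes "labeled_seed t" "snd t $ i $ j = 1"
  shows "fold mutate [i, j, i, j, i] t = permute (swap_indices i j) t"
proof -
  obtain x B where t: "t = (x, B)" by (cases t)
  define B1 where "B1 = mutate_matrix i B"
  define B2 where "B2 = mutate_matrix j B1"
  define B3 where "B3 = mutate_matrix i B2"
  define B4 where "B4 = mutate_matrix j B3"
  define x1 where "x1 = mutate_vars i (x, B)"
  define x2 where "x2 = mutate_vars j (x1, B1)"
  define x3 where "x3 = mutate_vars i (x2, B2)"
  define x4 where "x4 = mutate_vars j (x3, B3)"
  define x5 where "x5 = mutate_vars i (x4, B4)"
  have seeds: "labeled_seed (x, B)" "labeled_seed (x1, B1)" "labeled_seed (x2, B2)"
      "labeled_seed (x3, B3)" "labeled_seed (x4, B4)"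
    using assms(1) labeled_seed_mutate[of "(x, B)" i] labeled_seed_mutate[of "(x1, B1)" j]
      labeled_seed_mutate[of "(x2, B2)" i] labeled_seed_mutate[of "(x3, B3)" j]
    by (simp_all add: t mutate_def B1_def B2_def B3_def B4_def x1_def x2_def x3_def x4_def)
  have skew: "transpose B = - B" "transpose B1 = - B1" "transpose B2 = - B2"
      "transpose B3 = - B3" "transpose B4 = - B4"
    using seeds by (simp_all add: labeled_seed_def)
  have nz: "x $ l \<noteq> 0" "x1 $ l \<noteq> 0" "x2 $ l \<noteq> 0" "x3 $ l \<noteq> 0" for l
    using seeds
    by (simp_all add: labeled_seed_def free_generators_def algebraically_independent_nonzero)
  have arrow0: "B $ i $ j = 1" using assms(2) by (simp add: t)
  have arrow1: "B1 $ j $ i = 1"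
    unfolding B1_def by (rule mutate_matrix_single_arrow(1)[OF skew(1) arrow0])
  have arrow2: "B2 $ i $ j = 1"
    unfolding B2_def by (rule mutate_matrix_single_arrow(1)[OF skew(2) arrow1])
  have arrow3: "B3 $ j $ i = 1"
    unfolding B3_def by (rule mutate_matrix_single_arrow(1)[OF skew(3) arrow2])
  have arrow4: "B4 $ i $ j = 1"
    unfolding B4_def by (rule mutate_matrix_single_arrow(1)[OF skew(4) arrow3])
  have ij: "i \<noteq> j" using skew_diag[OF skew(1), of i] arrow0 by auto
  define R where "R = UNIV - {i, j}"
  have R': "UNIV - {j, i} = R" by (auto simp: R_def)
  have r: "B2 $ l $ i = - B $ l $ i + pos_part (B1 $ l $ j)"
    and s: "B3 $ l $ j = - B1 $ l $ j + pos_part (B2 $ l $ i)"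
    and q: "B4 $ l $ i = - B2 $ l $ i + pos_part (B3 $ l $ j)" if "l \<in> R" for l
  proof -
    have l: "l \<noteq> i" "l \<noteq> j" using that by (auto simp: R_def)
    note st0 = mutate_matrix_single_arrow[OF skew(1) arrow0, folded B1_def]
    note st1 = mutate_matrix_single_arrow[OF skew(2) arrow1, folded B2_def]
    note st2 = mutate_matrix_single_arrow[OF skew(3) arrow2, folded B3_def]
    note st3 = mutate_matrix_single_arrow[OF skew(4) arrow3, folded B4_def]
    show "B2 $ l $ i = - B $ l $ i + pos_part (B1 $ l $ j)"
      "B3 $ l $ j = - B1 $ l $ j + pos_part (B2 $ l $ i)"
      "B4 $ l $ i = - B2 $ l $ i + pos_part (B3 $ l $ j)"
      using st0(2)[of l] st1(2,3)[of l] st2(2,3)[of l] st3(3)[of l] l by simp_all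
  qed
  let ?e = "exchange_coeff R x"
  have triv: "\<forall>l\<in>R. x $ l = x $ l" by simp
  \<comment> \<open>The arrow between the two directions is reversed by each mutation, so the roles of \<open>i\<close> and
    \<open>j\<close> alternate and every step has the same shape.\<close>
  note x1s = mutate_vars_arrow_step[OF skew(1) arrow0, of x x, folded x1_def R_def, OF triv]
  note x2s = mutate_vars_arrow_step[OF skew(2) arrow1, of x1 x, folded x2_def, unfolded R',
      OF x1s(3)]
  note x3s = mutate_vars_arrow_step[OF skew(3) arrow2, of x2 x, folded x3_def R_def, OF x2s(3)]
  note x4s = mutate_vars_arrow_step[OF skew(4) arrow3, of x3 x, folded x4_def, unfolded R',
      OF x3s(3)]
  note x5s = mutate_vars_arrow_step[OF skew(5) arrow4, of x4 x, folded x5_def R_def, OF x4s(3)]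
  have cong: "(\<Prod>l\<in>R. x $ l ^ nat (f l)) = (\<Prod>l\<in>R. x $ l ^ nat (g l))"
    if "\<And>l. l \<in> R \<Longrightarrow> f l = g l" for f g
    using that by (intro prod.cong) simp_all
  \<comment> \<open>The five relations are identities between tropical polynomials in the exponents.\<close>
  have rels:
    "?e (\<lambda>l. B2 $ l $ i) * ?e (\<lambda>l. B $ l $ i) =
      ?e (\<lambda>l. - B2 $ l $ i) * ?e (\<lambda>l. - B $ l $ i) * ?e (\<lambda>l. B1 $ l $ j)"
    "?e (\<lambda>l. B3 $ l $ j) * ?e (\<lambda>l. B1 $ l $ j) =
      ?e (\<lambda>l. - B3 $ l $ j) * ?e (\<lambda>l. - B1 $ l $ j) * ?e (\<lambda>l. B2 $ l $ i)"
    "?e (\<lambda>l. - B3 $ l $ j) * ?e (\<lambda>l. - B2 $ l $ i) = ?e (\<lambda>l. B $ l $ i)"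
    "?e (\<lambda>l. - B4 $ l $ i) * ?e (\<lambda>l. B $ l $ i) =
      ?e (\<lambda>l. - B2 $ l $ i) * ?e (\<lambda>l. B1 $ l $ j)"
    "?e (\<lambda>l. B4 $ l $ i) = ?e (\<lambda>l. - B2 $ l $ i) * ?e (\<lambda>l. - B1 $ l $ j)"
    unfolding exchange_coeff_mult3
    unfolding exchange_coeff_mult
    unfolding exchange_coeff_def
    by (rule cong; simp add: q s r; simp add: pos_part_def max_def)+
  have e_nz: "?e f \<noteq> 0" for f using nz by (simp add: exchange_coeff_def)
  have X1: "x1 $ i = (?e (\<lambda>l. B $ l $ i) + ?e (\<lambda>l. - B $ l $ i) * x $ j) / x $ i"
    using x1s(1) .
  have Y1: "x2 $ j = (?e (\<lambda>l. B1 $ l $ j) + ?e (\<lambda>l. - B1 $ l $ j) * x1 $ i) / x $ j"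
    using x2s(1) x1s(2) by simp
  have X2: "x3 $ i = (?e (\<lambda>l. B2 $ l $ i) + ?e (\<lambda>l. - B2 $ l $ i) * x2 $ j) / x1 $ i"
    using x3s(1) x2s(2) by simp
  have Y2: "x4 $ j = (?e (\<lambda>l. B3 $ l $ j) + ?e (\<lambda>l. - B3 $ l $ j) * x3 $ i) / x2 $ j"
    using x4s(1) x3s(2) by simp
  have X3: "x5 $ i = (?e (\<lambda>l. B4 $ l $ i) + ?e (\<lambda>l. - B4 $ l $ i) * x4 $ j) / x3 $ i"
    using x5s(1) x4s(2) by simp
  note pent = pentagon_recurrence[OF nz(1,1,2,3,4) e_nz e_nz X1 Y1 X2 Y2 X3 rels]
  have x5: "x5 $ l = x $ swap_indices i j l" for l
  proof -
    consider "l = i" | "l = j" | "l \<noteq> i" "l \<noteq> j" by blast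
    then show ?thesis
    proof cases
      case 1
      then show ?thesis using pent(2) by (simp only: swap_indices_def if_True simp_thms)
    next
      case 2
      then show ?thesis
        using pent(1) x5s(2) ij by (simp add: swap_indices_def)
    next
      case 3
      then show ?thesis using x5s(3) by (simp add: swap_indices_def R_def)
    qed
  qed
  have fst_eq: "fst (fold mutate [i, j, i, j, i] t) = fst (permute (swap_indices i j) t)"
    using x5
    by (simp add: t mutate_def permute_def vec_eq_iff x5_def x4_def x3_def x2_def x1_def
        B1_def B2_def B3_def B4_def)
  show ?thesis
    by (rule labeled_seed_determined[OF assms(1) _ _ fst_eq])
      (simp_all add: labeled_mutation_class_mutate labeled_mutation_class_permute
        labeled_mutation_class_self bij_swap_indices)
qed

text \<open>Where all initial variables are \<open>1\<close> and \<open>b\<close> is the absolute value of the entry, the first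
  three mutations produce \<open>2\<close>, \<open>1 + 2 ^ b\<close> and \<open>(1 + (1 + 2 ^ b) ^ b) / 2\<close>. By the relation the
  fourth produces \<open>1\<close>, which forces the third value to be \<open>2\<close>, that is \<open>(1 + 2 ^ b) ^ b = 3\<close>.\<close>

theorem pentagon_relation_imp:
  assumes "labeled_seed t" "i \<noteq> j" "snd t $ i $ j \<noteq> 0"
    and "fold mutate [i, j, i, j, i] t = permute (swap_indices i j) t"
  shows "\<bar>snd t $ i $ j\<bar> = 1"
proof -
  obtain x B where t: "t = (x, B)" by (cases t)
  have ind: "algebraically_independent x" and skew: "transpose B = - B"
    using assms by (auto simp: t labeled_seed_def free_generators_def)
  have sk: "C $ k $ l = - C $ l $ k" if "transpose C = - C" for C :: "int ^ 'b ^ 'b" and k l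
    using that unfolding skew_iff by blast
  define b where "b = nat \<bar>B $ i $ j\<bar>"
  have b0: "b \<noteq> 0" using assms(3) by (simp add: b_def t)
  let ?y = "1 :: real ^ 'b"
  define B1 where "B1 = mutate_matrix i B"
  define B2 where "B2 = mutate_matrix j B1"
  define B3 where "B3 = mutate_matrix i B2"
  define y1 where "y1 = mutate_vars i (?y, B)"
  define y2 where "y2 = mutate_vars j (y1, B1)"
  define y3 where "y3 = mutate_vars i (y2, B2)"
  define y4 where "y4 = mutate_vars j (y3, B3)"
  have skews: "transpose B1 = - B1" "transpose B2 = - B2" "transpose B3 = - B3"
    by (simp_all add: B1_def B2_def B3_def skew_mutate_matrix skew)
  have mult: "nat \<bar>B $ j $ i\<bar> = b" "nat \<bar>B1 $ i $ j\<bar> = b" "nat \<bar>B2 $ j $ i\<bar> = b"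
      "nat \<bar>B3 $ i $ j\<bar> = b"
    using sk[OF skew, of j i] by (simp_all add: b_def B3_def B2_def B1_def mutate_matrix_nth)
  have other: "y1 $ l = 1" "y2 $ l = 1" "y3 $ l = 1" if "l \<noteq> i" "l \<noteq> j" for l
    using that by (simp_all add: y1_def y2_def y3_def mutate_vars_nth)
  have v1: "y1 $ i = 2" "y1 $ j = 1"
    using mutate_vars_rank_two_at_ones[of i j ?y B] skew_diag[OF skew] assms(2)
    by (simp_all add: y1_def mutate_vars_nth[of i _ _ j])
  have v2: "y2 $ j = 1 + 2 ^ b" "y2 $ i = 2"
    using mutate_vars_rank_two_at_ones[of j i y1 B1] skew_diag[OF skews(1)] assms(2) other(1) v1 mult
    by (simp_all add: y2_def mutate_vars_nth[of j _ _ i])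
  have v3: "y3 $ i = (1 + (1 + 2 ^ b) ^ b) / 2" "y3 $ j = 1 + 2 ^ b"
    using mutate_vars_rank_two_at_ones[of i j y2 B2] skew_diag[OF skews(2)] assms(2) other(2) v2 mult
    by (simp_all add: y3_def mutate_vars_nth[of i _ _ j])
  have v4: "y4 $ j = (1 + (y3 $ i) ^ b) / (1 + 2 ^ b)"
    using mutate_vars_rank_two_at_ones[of j i y3 B3] skew_diag[OF skews(3)] assms(2) other(3) v3(2) mult
    by (simp add: y4_def)
  have "fst (fold mutate [i, j, i, j] t) $ j = fst (fold mutate [i, j, i, j, i] t) $ j"
    using assms(2) by (simp add: t mutate_def mutate_vars_nth[of i _ _ j])
  also have "\<dots> = fst (fold mutate [] t) $ i"
    unfolding assms(4) using assms(2) by (simp add: permute_def swap_indices_def)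
  finally have "fst (fold mutate [i, j, i, j] (?y, B)) $ j = fst (fold mutate [] (?y, B)) $ i"
    unfolding t by (rule fold_mutate_eq_positive[OF ind, rotated]) simp
  then have "y4 $ j = 1"
    by (simp add: mutate_def y4_def y3_def y2_def y1_def B1_def B2_def B3_def)
  moreover have "(1::real) + 2 ^ b > 0" by (simp add: add_pos_pos)
  ultimately have "(y3 $ i) ^ b = 2 ^ b" using v4 by (simp add: field_simps)
  moreover have "y3 $ i > 0" unfolding v3 by (simp add: add_pos_pos)
  ultimately have "y3 $ i = 2"
    using power_eq_iff_eq_base[of b "y3 $ i" 2] b0 by simp
  then have three: "(1 + 2 ^ b) ^ b = (3::real)" unfolding v3 by simp
  have "b = 1"
  proof (rule ccontr)
    assume "b \<noteq> 1"
    then have "b \<ge> 2" using b0 by simp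
    then have "(2::real) ^ 2 \<le> 2 ^ b" by (intro power_increasing) auto
    then have "(5::real) \<le> 1 + 2 ^ b" by simp
    moreover have "(1 + 2 ^ b :: real) ^ 1 \<le> (1 + 2 ^ b) ^ b"
      using b0 by (intro power_increasing) auto
    ultimately show False using three by simp
  qed
  then show ?thesis by (simp add: t b_def)
qed


section \<open>Automorphisms of the labeled mutation class\<close>

lemma Aut_M_in_class:
  "f \<in> Aut_M s \<Longrightarrow> t \<in> labeled_mutation_class s \<Longrightarrow> f t \<in> labeled_mutation_class s"
  unfolding Aut_M_def by (auto dest: Bij_imp_funcset)

lemma Aut_M_inj:
  "f \<in> Aut_M s \<Longrightarrow> t \<in> labeled_mutation_class s \<Longrightarrow> u \<in> labeled_mutation_class s \<Longrightarrow>
    f t = f u \<longleftrightarrow> t = u"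
  unfolding Aut_M_def Bij_def by (auto dest: bij_betw_imp_inj_on inj_onD)

lemma Aut_M_mutate:
  "f \<in> Aut_M s \<Longrightarrow> t \<in> labeled_mutation_class s \<Longrightarrow> f (mutate k t) = mutate k (f t)"
  unfolding Aut_M_def by blast

lemma Aut_M_permute:
  "f \<in> Aut_M s \<Longrightarrow> t \<in> labeled_mutation_class s \<Longrightarrow> bij \<sigma> \<Longrightarrow>
    f (permute \<sigma> t) = permute \<sigma> (f t)"
  unfolding Aut_M_def by blast

lemma Aut_M_fold_mutate:
  assumes "f \<in> Aut_M s" "t \<in> labeled_mutation_class s"
  shows "f (fold mutate ks t) = fold mutate ks (f t)"
  using assms(2)
  by (induction ks arbitrary: t) (simp_all add: Aut_M_mutate[OF assms(1)] labeled_mutation_class_mutate)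

text \<open>Vanishing of an entry is the commutation of two mutations, which \<open>f\<close> preserves and, being
  injective, reflects.\<close>

lemma Aut_M_zero_iff:
  assumes "labeled_seed s" "f \<in> Aut_M s" "t \<in> labeled_mutation_class s"
  shows "snd (f t) $ i $ j = 0 \<longleftrightarrow> snd t $ i $ j = 0"
proof -
  have ft: "f t \<in> labeled_mutation_class s" using assms(2,3) by (rule Aut_M_in_class)
  have seeds: "labeled_seed t" "labeled_seed (f t)"
    using assms(1,3) ft labeled_seed_class by blast+
  show ?thesis
  proof (cases "i = j")
    case True
    then show ?thesis using seeds by (simp add: labeled_seed_def skew_diag)
  next
    case False
    have "mutate i (mutate j (f t)) = f (mutate i (mutate j t))"
      "mutate j (mutate i (f t)) = f (mutate j (mutate i t))"
      using assms(2,3) by (simp_all add: Aut_M_mutate labeled_mutation_class_mutate)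
    then have "mutate i (mutate j (f t)) = mutate j (mutate i (f t)) \<longleftrightarrow>
        mutate i (mutate j t) = mutate j (mutate i t)"
      using Aut_M_inj[OF assms(2)] assms(3) by (simp add: labeled_mutation_class_mutate)
    then show ?thesis
      using mutate_commute_iff[OF seeds(1) False] mutate_commute_iff[OF seeds(2) False] by simp
  qed
qed

lemma Aut_M_one:
  assumes "labeled_seed s" "f \<in> Aut_M s" "t \<in> labeled_mutation_class s"
    and "\<bar>snd t $ i $ j\<bar> = 1"
  shows "\<bar>snd (f t) $ i $ j\<bar> = 1"
proof -
  have seeds: "labeled_seed t" "labeled_seed (f t)"
    using assms(1-3) Aut_M_in_class labeled_seed_class by blast+
  have 1: "\<bar>snd (f t) $ k $ l\<bar> = 1" if kl: "snd t $ k $ l = 1" for k l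
  proof (rule pentagon_relation_imp[OF seeds(2)])
    show "k \<noteq> l" using kl seeds(1) skew_diag[of "snd t" k] by (auto simp: labeled_seed_def)
    show "snd (f t) $ k $ l \<noteq> 0" using kl Aut_M_zero_iff[OF assms(1-3)] by simp
    show "fold mutate [k, l, k, l, k] (f t) = permute (swap_indices k l) (f t)"
      using pentagon_relation[OF seeds(1) kl] Aut_M_fold_mutate[OF assms(2,3)]
        Aut_M_permute[OF assms(2,3) bij_swap_indices] by metis
  qed
  have sk: "C $ i $ j = - C $ j $ i" if "transpose C = - C" for C :: "int ^ 'b ^ 'b"
    using that unfolding skew_iff by blast
  consider "snd t $ i $ j = 1" | "snd t $ j $ i = 1"
    using assms(4) sk[of "snd t"] seeds(1) by (auto simp: labeled_seed_def abs_if split: if_splits)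
  then show ?thesis
    using 1[of i j] 1[of j i] sk[of "snd (f t)"] seeds(2) by cases (auto simp: labeled_seed_def)
qed

lemma snd_mutate: "snd (mutate k t) = mutate_matrix k (snd t)"
  by (simp add: mutate_def)

text \<open>Mutation and permutation of matrices commute with the sign change, so the sign at the initial
  seed propagates to the whole class.\<close>

lemma W_eq_Aut_M:
  assumes "\<And>f. f \<in> Aut_M s \<Longrightarrow> snd (f s) = snd s \<or> snd (f s) = - snd s"
  shows "W s = Aut_M s"
proof -
  have "\<forall>t\<in>labeled_mutation_class s. snd (f t) = snd t \<or> snd (f t) = - snd t"
    if f: "f \<in> Aut_M s" for f
  proof
    fix t assume "t \<in> labeled_mutation_class s"
    then show "snd (f t) = snd t \<or> snd (f t) = - snd t"
    proof (induction rule: labeled_mutation_class_induct)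
      case self
      then show ?case using assms[OF f] .
    next
      case (mutate k u)
      have "snd (f (mutate k u)) = mutate_matrix k (snd (f u))"
        unfolding Aut_M_mutate[OF f mutate(1)] by (simp add: mutate_def)
      then show ?case using mutate(2) by (auto simp: mutate_def mutate_matrix_uminus)
    next
      case (permute \<sigma> u)
      have "snd (f (permute \<sigma> u)) = (\<chi> i j. snd (f u) $ \<sigma> i $ \<sigma> j)"
        unfolding Aut_M_permute[OF f permute(1,2)] by (simp add: permute_def)
      then show ?case using permute(3) by (auto simp: permute_def vec_eq_iff)
    qed
  qed
  then show ?thesis by (auto simp: W_def)
qed


section \<open>Matrices of infinite mutation type\<close>

definition mutation_reaches :: "int ^ 'n::finite ^ 'n \<Rightarrow> int ^ 'n ^ 'n \<Rightarrow> bool" where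
  "mutation_reaches B C \<longleftrightarrow> (\<lambda>P Q. \<exists>k. Q = mutate_matrix k P)\<^sup>*\<^sup>* B C"

lemma mutation_reaches_refl: "mutation_reaches B B"
  by (simp add: mutation_reaches_def)

lemma mutation_reaches_mutate:
  "mutation_reaches B C \<Longrightarrow> mutation_reaches B (mutate_matrix k C)"
  unfolding mutation_reaches_def by (erule rtranclp.rtrancl_into_rtrancl) blast

text \<open>An oriented triangle with one arrow of weight three, the larger of the two other weights being
  \<open>p\<close>. Mutation at the head of that arrow turns the weights \<open>p\<close> and \<open>q\<close> into
  \<open>3 * p - q\<close> and \<open>p\<close>, and \<open>3 * p - q > p\<close> if \<open>q \<le> p\<close>.\<close>

definition growing_triangle :: "int ^ 'n::finite ^ 'n \<Rightarrow> int \<Rightarrow> bool" where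
  "growing_triangle C p \<longleftrightarrow> transpose C = - C \<and>
     (\<exists>i j k. distinct [i, j, k] \<and> C $ i $ j = 3 \<and> C $ j $ k = p \<and> 0 < C $ k $ i \<and> C $ k $ i \<le> p)"

lemma growing_triangle_mutate:
  assumes "growing_triangle C p"
  shows "\<exists>k p'. growing_triangle (mutate_matrix k C) p' \<and> p' > p"
proof -
  obtain i j k where skew: "transpose C = - C" and d: "distinct [i, j, k]"
    and e: "C $ i $ j = 3" "C $ j $ k = p" "0 < C $ k $ i" "C $ k $ i \<le> p"
    using assms unfolding growing_triangle_def by blast
  let ?D = "mutate_matrix j C"
  have sk: "C $ a $ b = - C $ b $ a" for a b using skew unfolding skew_iff by blast
  have "?D $ j $ i = 3" using sk[of j i] e by (simp add: mutate_matrix_nth)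
  moreover have "?D $ i $ k = 3 * p - C $ k $ i"
    using d e sk[of i k] by (auto simp: mutate_matrix_nth pos_part_def)
  moreover have "?D $ k $ j = p" using sk[of k j] e by (simp add: mutate_matrix_nth)
  ultimately have "growing_triangle ?D (3 * p - C $ k $ i)"
    unfolding growing_triangle_def
    by (intro conjI skew_mutate_matrix skew exI[of _ j] exI[of _ i] exI[of _ k])
      (use d e in auto)
  moreover have "3 * p - C $ k $ i > p" using e by simp
  ultimately show ?thesis by blast
qed

lemma growing_triangle_not_finite_mutation_type:
  fixes B :: "int ^ 'n::finite ^ 'n"
  assumes "mutation_reaches B C" "growing_triangle C p"
  shows "\<not> finite_mutation_type B"
proof
  assume "finite_mutation_type B"
  then have fin: "finite {D. mutation_reaches B D}"
    by (simp add: finite_mutation_type_def mutation_reaches_def)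
  have grow: "\<exists>D p'. mutation_reaches B D \<and> growing_triangle D p' \<and> p' \<ge> int N" for N
  proof (induction N)
    case 0
    have "p \<ge> 0" using assms(2) by (auto simp: growing_triangle_def)
    then show ?case using assms by auto
  next
    case (Suc N)
    then obtain D p' where D: "mutation_reaches B D" "growing_triangle D p'" "p' \<ge> int N" by blast
    obtain k p'' where "growing_triangle (mutate_matrix k D) p''" "p'' > p'"
      using growing_triangle_mutate[OF D(2)] by blast
    then show ?case
      using mutation_reaches_mutate[OF D(1), of k] D(3)
      by (intro exI[of _ "mutate_matrix k D"] exI[of _ p'']) simp
  qed
  let ?E = "(\<lambda>(D, i, j). D $ i $ j) ` ({D. mutation_reaches B D} \<times> UNIV \<times> (UNIV :: 'n set))"
  have "finite ?E" using fin by simp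
  then obtain M where M: "\<And>e. e \<in> ?E \<Longrightarrow> e \<le> M" using Max_ge by blast
  obtain D p' where D: "mutation_reaches B D" "growing_triangle D p'"
    and p': "p' \<ge> int (nat M + 1)"
    using grow by blast
  obtain i j where "D $ i $ j = p'" using D(2) unfolding growing_triangle_def by blast
  then have "p' \<in> ?E" using D(1) by (intro image_eqI[of _ _ "(D, i, j)"]) simp_all
  then have "p' \<le> M" by (rule M)
  then show False using p' by (simp split: if_splits)
qed


section \<open>The Markov constant in rank three\<close>

text \<open>The polynomial \<open>a\<^sup>2 + b\<^sup>2 + c\<^sup>2 - a * b * c\<close> in the weights of an oriented triangle. For an
  acyclic orientation the sign of the last term changes; with this convention the value is
  invariant under mutation, as the replacement \<open>c \<mapsto> a * b - c\<close> exchanges the two roots of a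
  quadratic equation.\<close>

definition markov :: "int \<Rightarrow> int \<Rightarrow> int \<Rightarrow> int" where
  "markov a b c = a\<^sup>2 + b\<^sup>2 + c\<^sup>2 +
     (if (a > 0 \<and> b > 0 \<and> c > 0) \<or> (a < 0 \<and> b < 0 \<and> c < 0) then - \<bar>a * b * c\<bar> else \<bar>a * b * c\<bar>)"

lemma markov_rotate: "markov b c a = markov a b c"
  by (auto simp: markov_def ac_simps)

lemma markov_flip: "markov b a c = markov a b c"
  by (auto simp: markov_def ac_simps)

lemma markov_uminus: "markov (- a) (- b) (- c) = markov a b c"
  by (auto simp: markov_def)

lemma markov_pos:
  assumes "a * b > 0"
  shows "markov a b c = a\<^sup>2 + b\<^sup>2 + c\<^sup>2 - sgn a * (a * b * c)"
proof -
  have abs: "\<bar>a * b * c\<bar> = a * b * \<bar>c\<bar>" using assms abs_mult[of "a * b" c] by simp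
  consider "a > 0" "b > 0" | "a < 0" "b < 0" using assms by (auto simp: zero_less_mult_iff)
  then show ?thesis
    unfolding markov_def abs by cases (auto simp: abs_if)
qed

lemma markov_mutate: "markov (- a) (- b) (c - sgn a * pos_part (a * b)) = markov a b c"
proof (cases "a * b > 0")
  case True
  then have "a \<noteq> 0" by auto
  then have s: "sgn a * sgn a = 1" by (simp add: sgn_if)
  have "markov (- a) (- b) (c - sgn a * (a * b)) =
      a\<^sup>2 + b\<^sup>2 + (c - sgn a * (a * b))\<^sup>2 + sgn a * (a * b * (c - sgn a * (a * b)))"
    using markov_pos[of "- a" "- b"] True by (simp add: sgn_minus)
  also have "\<dots> = a\<^sup>2 + b\<^sup>2 + c\<^sup>2 - sgn a * (a * b * c)
      + (sgn a * sgn a) * (a * b)\<^sup>2 - (sgn a * sgn a) * (a * b)\<^sup>2"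
    by (simp add: power2_eq_square algebra_simps)
  finally show ?thesis using True by (simp add: markov_pos pos_part_def)
next
  case False
  then have "pos_part (a * b) = 0" by (simp add: pos_part_def)
  moreover have "\<not> (a > 0 \<and> b > 0)" "\<not> (a < 0 \<and> b < 0)"
    using False by (auto simp: zero_less_mult_iff)
  ultimately show ?thesis by (auto simp: markov_def)
qed

definition markov_constant :: "int ^ 3 ^ 3 \<Rightarrow> int" where
  "markov_constant C = markov (C $ 1 $ 2) (C $ 2 $ 3) (C $ 3 $ 1)"

lemma markov_constant_mutate:
  assumes "transpose C = - C"
  shows "markov_constant (mutate_matrix k C) = markov_constant C"
proof -
  have sk: "C $ a $ b = - C $ b $ a" for a b using assms unfolding skew_iff by blast
  let ?D = "mutate_matrix k C"
  let ?a = "C $ 1 $ 2" and ?b = "C $ 2 $ 3" and ?c = "C $ 3 $ 1"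
  have sg: "sgn a * pos_part (a * b) = sgn b * pos_part (b * a)" for a b :: int
  proof (cases "a * b > 0")
    case True
    then show ?thesis by (auto simp: zero_less_mult_iff mult.commute)
  next
    case False
    then show ?thesis by (simp add: pos_part_def mult.commute)
  qed
  consider "k = 1" | "k = 2" | "k = 3" using exhaust_3 by blast
  then show ?thesis
  proof cases
    case 1
    have "?D $ 1 $ 2 = - ?a" "?D $ 3 $ 1 = - ?c" "?D $ 2 $ 3 = ?b - sgn ?c * pos_part (?c * ?a)"
      using 1 sk[of 2 1] sk[of 1 3] sg[of ?a ?c] by (simp_all add: mutate_matrix_nth sgn_minus)
    then show ?thesis
      unfolding markov_constant_def using markov_mutate[of ?c ?a ?b] by (metis markov_rotate)
  next
    case 2
    have "?D $ 1 $ 2 = - ?a" "?D $ 2 $ 3 = - ?b" "?D $ 3 $ 1 = ?c - sgn ?a * pos_part (?a * ?b)"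
      using 2 sk[of 3 2] sk[of 2 1] sg[of ?b ?a] by (simp_all add: mutate_matrix_nth sgn_minus)
    then show ?thesis
      unfolding markov_constant_def using markov_mutate[of ?a ?b ?c] by metis
  next
    case 3
    have "?D $ 2 $ 3 = - ?b" "?D $ 3 $ 1 = - ?c" "?D $ 1 $ 2 = ?a - sgn ?b * pos_part (?b * ?c)"
      using 3 sk[of 1 3] sk[of 3 2] sg[of ?c ?b] by (simp_all add: mutate_matrix_nth sgn_minus)
    then show ?thesis
      unfolding markov_constant_def using markov_mutate[of ?b ?c ?a] by (metis markov_rotate)
  qed
qed

lemma markov_constant_permute:
  assumes "transpose C = - C" "bij \<sigma>"
  shows "markov_constant (\<chi> i j. C $ \<sigma> i $ \<sigma> j) = markov_constant C"
proof -
  have sk: "C $ a $ b = - C $ b $ a" for a b using assms unfolding skew_iff by blast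
  let ?a = "C $ 1 $ 2" and ?b = "C $ 2 $ 3" and ?c = "C $ 3 $ 1"
  have inj: "\<sigma> 1 \<noteq> \<sigma> 2" "\<sigma> 2 \<noteq> \<sigma> 3" "\<sigma> 1 \<noteq> \<sigma> 3"
    using assms(2) by (simp_all add: bij_is_inj inj_eq)
  have eqs: "C $ 2 $ 1 = - ?a" "C $ 3 $ 2 = - ?b" "C $ 1 $ 3 = - ?c" by (rule sk)+
  have "markov ?b ?c ?a = markov ?a ?b ?c" "markov ?c ?a ?b = markov ?a ?b ?c"
    "markov (- ?a) (- ?c) (- ?b) = markov ?a ?b ?c" "markov (- ?c) (- ?b) (- ?a) = markov ?a ?b ?c"
    "markov (- ?b) (- ?a) (- ?c) = markov ?a ?b ?c"
    unfolding markov_uminus by (metis markov_rotate markov_flip)+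
  then show ?thesis
    using exhaust_3[of "\<sigma> 1"] exhaust_3[of "\<sigma> 2"] exhaust_3[of "\<sigma> 3"] inj
    by (elim disjE) (simp_all add: markov_constant_def eqs)
qed

lemma markov_constant_class:
  fixes s :: "('a::field_char_0, 3) seed"
  assumes "labeled_seed s" "t \<in> labeled_mutation_class s"
  shows "markov_constant (snd t) = markov_constant (snd s)"
  using assms(2)
proof (induction rule: labeled_mutation_class_induct)
  case self
  then show ?case by (rule refl)
next
  case (mutate k u)
  have "transpose (snd u) = - snd u"
    using labeled_seed_class[OF assms(1) mutate(1)] by (simp add: labeled_seed_def)
  then show ?case using mutate(2) by (simp add: mutate_def markov_constant_mutate)
next
  case (permute \<sigma> u)
  have "transpose (snd u) = - snd u"
    using labeled_seed_class[OF assms(1) permute(1)] by (simp add: labeled_seed_def)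
  then show ?case using permute(2,3) by (simp add: permute_def markov_constant_permute)
qed


section \<open>The two exchange matrices\<close>

lemma B3_entries:
  "B3 $ 1 $ 1 = 0" "B3 $ 1 $ 2 = 2" "B3 $ 1 $ 3 = 0"
  "B3 $ 2 $ 1 = -2" "B3 $ 2 $ 2 = 0" "B3 $ 2 $ 3 = 1"
  "B3 $ 3 $ 1 = 0" "B3 $ 3 $ 2 = -1" "B3 $ 3 $ 3 = 0"
  by (simp_all add: B3_def)

lemma vector_4: 
  "(vector [a, b, c, d] :: 'z::zero ^ 4) $ 1 = a"
  "(vector [a, b, c, d] :: 'z::zero ^ 4) $ 2 = b"
  "(vector [a, b, c, d] :: 'z::zero ^ 4) $ 3 = c"
  "(vector [a, b, c, d] :: 'z::zero ^ 4) $ 4 = d"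
  unfolding vector_def by simp_all

lemma B4_entries:
  "B4 $ 1 $ 1 = 0" "B4 $ 1 $ 2 = 1" "B4 $ 1 $ 3 = 1" "B4 $ 1 $ 4 = 1"
  "B4 $ 2 $ 1 = -1" "B4 $ 2 $ 2 = 0" "B4 $ 2 $ 3 = 1" "B4 $ 2 $ 4 = 0"
  "B4 $ 3 $ 1 = -1" "B4 $ 3 $ 2 = -1" "B4 $ 3 $ 3 = 0" "B4 $ 3 $ 4 = -1"
  "B4 $ 4 $ 1 = -1" "B4 $ 4 $ 2 = 0" "B4 $ 4 $ 3 = 1" "B4 $ 4 $ 4 = 0"
  by (simp_all add: B4_def vector_4)

lemma skew_B3: "transpose B3 = - B3"
  by (simp add: skew_iff forall_3 B3_entries)

lemma skew_B4: "transpose B4 = - B4"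
  by (simp add: skew_iff forall_4 B4_entries)

lemma B3_not_finite_mutation_type: "\<not> finite_mutation_type B3"
proof (rule growing_triangle_not_finite_mutation_type)
  let ?C = "mutate_matrix 1 (mutate_matrix 2 B3)"
  show "mutation_reaches B3 ?C"
    by (intro mutation_reaches_mutate mutation_reaches_refl)
  have "?C $ 2 $ 3 = 3" "?C $ 3 $ 1 = 2" "?C $ 1 $ 2 = 2"
    by (simp_all add: mutate_matrix_nth B3_entries pos_part_def)
  then show "growing_triangle ?C 2"
    unfolding growing_triangle_def
    by (intro conjI skew_mutate_matrix skew_B3 exI[of _ 2] exI[of _ 3] exI[of _ 1]) simp_all
qed

lemma B4_not_finite_mutation_type: "\<not> finite_mutation_type B4"
proof (rule growing_triangle_not_finite_mutation_type)
  let ?C = "mutate_matrix 4 (mutate_matrix 2 B4)"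
  show "mutation_reaches B4 ?C"
    by (intro mutation_reaches_mutate mutation_reaches_refl)
  have "?C $ 1 $ 3 = 3" "?C $ 3 $ 2 = 1" "?C $ 2 $ 1 = 1"
    by (simp_all add: mutate_matrix_nth B4_entries pos_part_def)
  then show "growing_triangle ?C 1"
    unfolding growing_triangle_def
    by (intro conjI skew_mutate_matrix skew_B4 exI[of _ 1] exI[of _ 3] exI[of _ 2]) simp_all
qed

text \<open>The relations give a path with an arrow of weight one and an arrow of unknown weight; as
  mutation at the middle vertex creates a new arrow, the path is linearly oriented. The Markov
  constant of a path is the sum of the squares of its weights, which is five for \<open>B3\<close>.\<close>

lemma W_eq_Aut_M_B3:
  fixes y :: "'b::field_char_0 ^ 3"
  assumes "labeled_seed (y, B3)"
  shows "W (y, B3) = Aut_M (y, B3)"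
proof (rule W_eq_Aut_M)
  fix f assume f: "f \<in> Aut_M (y, B3)"
  let ?s = "(y, B3)"
  define C where "C = snd (f ?s)"
  note self = labeled_mutation_class_self[of ?s]
  have fs: "f ?s \<in> labeled_mutation_class ?s" using f self by (rule Aut_M_in_class)
  then have skew: "transpose C = - C"
    using labeled_seed_class[OF assms] by (simp add: labeled_seed_def C_def)
  have sk: "C $ a $ b = - C $ b $ a" for a b using skew unfolding skew_iff by blast
  have one: "\<bar>C $ 2 $ 3\<bar> = 1"
    using Aut_M_one[OF assms f self, of 2 3] by (simp add: C_def B3_entries)
  have c0: "C $ 3 $ 1 = 0" "C $ 1 $ 3 = 0"
    using Aut_M_zero_iff[OF assms f self, of 3 1] Aut_M_zero_iff[OF assms f self, of 1 3]
    by (simp_all add: C_def B3_entries)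
  have "mutate_matrix 2 C $ 1 $ 3 \<noteq> 0"
    using Aut_M_zero_iff[OF assms f labeled_mutation_class_mutate[OF self], of 2 1 3]
    unfolding Aut_M_mutate[OF f self] snd_mutate C_def[symmetric]
    by (simp add: mutate_matrix_nth B3_entries pos_part_def)
  then have "pos_part (C $ 1 $ 2 * C $ 2 $ 3) \<noteq> 0" by (auto simp: mutate_matrix_nth c0)
  then have pos: "C $ 1 $ 2 * C $ 2 $ 3 > 0" by (simp add: pos_part_def max_def split: if_splits)
  have "markov_constant C = markov_constant B3"
    using markov_constant_class[OF assms fs] by (simp add: C_def)
  then have "(C $ 1 $ 2)\<^sup>2 + (C $ 2 $ 3)\<^sup>2 = 5"
    by (simp add: markov_constant_def markov_def c0 B3_entries)
  moreover have "(C $ 2 $ 3)\<^sup>2 = 1" using one by (metis power2_abs one_power2)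
  ultimately have "(C $ 1 $ 2)\<^sup>2 = 2\<^sup>2" by simp
  then have two: "C $ 1 $ 2 = 2 \<or> C $ 1 $ 2 = -2" by (simp only: power2_eq_iff)
  have "C = B3 \<or> C = - B3"
    using two
  proof
    assume h: "C $ 1 $ 2 = 2"
    then have "C $ 2 $ 3 = 1" using one pos by (simp add: abs_if split: if_splits)
    then have "C = B3"
      using h c0 sk[of 2 1] sk[of 3 2] skew_diag[OF skew]
      by (simp add: vec_eq_iff forall_3 B3_entries)
    then show ?thesis ..
  next
    assume h: "C $ 1 $ 2 = -2"
    then have "C $ 2 $ 3 = -1" using one pos by (simp add: abs_if split: if_splits)
    then have "C = - B3"
      using h c0 sk[of 2 1] sk[of 3 2] skew_diag[OF skew]
      by (simp add: vec_eq_iff forall_3 B3_entries)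
    then show ?thesis ..
  qed
  then show "snd (f ?s) = snd ?s \<or> snd (f ?s) = - snd ?s" by (simp add: C_def)
qed

text \<open>All nonzero entries are \<open>1\<close> or \<open>-1\<close>, which leaves the orientations of five arrows. Mutation at
  \<open>1\<close> and at \<open>3\<close> creates no arrow between \<open>2\<close> and \<open>4\<close>, so these vertices are oriented alike.
  The remaining orientations other than those of \<open>B4\<close> and \<open>- B4\<close> differ from \<open>B4\<close> after one
  mutation, at \<open>1\<close>, \<open>2\<close> or \<open>3\<close>.\<close>

lemma W_eq_Aut_M_B4:
  fixes x :: "'a::field_char_0 ^ 4"
  assumes "labeled_seed (x, B4)"
  shows "W (x, B4) = Aut_M (x, B4)"
proof (rule W_eq_Aut_M)
  fix f assume f: "f \<in> Aut_M (x, B4)"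
  let ?s = "(x, B4)"
  define C where "C = snd (f ?s)"
  note self = labeled_mutation_class_self[of ?s]
  have fs: "f ?s \<in> labeled_mutation_class ?s" using f self by (rule Aut_M_in_class)
  then have skew: "transpose C = - C"
    using labeled_seed_class[OF assms] by (simp add: labeled_seed_def C_def)
  have sk: "C $ a $ b = - C $ b $ a" for a b using skew unfolding skew_iff by blast
  note eqs = sk[of 2 1] sk[of 3 1] sk[of 4 1] sk[of 3 2] sk[of 4 2] sk[of 4 3]
  have one: "\<bar>C $ 1 $ 2\<bar> = 1" "\<bar>C $ 1 $ 3\<bar> = 1" "\<bar>C $ 1 $ 4\<bar> = 1" "\<bar>C $ 2 $ 3\<bar> = 1"
      "\<bar>C $ 3 $ 4\<bar> = 1"
    using Aut_M_one[OF assms f self, of 1 2] Aut_M_one[OF assms f self, of 1 3]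
      Aut_M_one[OF assms f self, of 1 4] Aut_M_one[OF assms f self, of 2 3]
      Aut_M_one[OF assms f self, of 3 4]
    by (simp_all add: C_def B4_entries)
  have c0: "C $ 2 $ 4 = 0"
    using Aut_M_zero_iff[OF assms f self, of 2 4] by (simp add: C_def B4_entries)
  have mz: "mutate_matrix k C $ i $ j = 0 \<longleftrightarrow> mutate_matrix k B4 $ i $ j = 0" for k i j
    using Aut_M_zero_iff[OF assms f labeled_mutation_class_mutate[OF self], of k i j]
    unfolding Aut_M_mutate[OF f self] snd_mutate C_def[symmetric] by simp
  have mo: "\<bar>mutate_matrix k B4 $ i $ j\<bar> = 1 \<Longrightarrow> \<bar>mutate_matrix k C $ i $ j\<bar> = 1" for k i j
    using Aut_M_one[OF assms f labeled_mutation_class_mutate[OF self], of k i j]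
    unfolding Aut_M_mutate[OF f self] snd_mutate C_def[symmetric] by simp
  have m1: "mutate_matrix 1 C $ 2 $ 4 = 0"
    and m2: "mutate_matrix 3 C $ 2 $ 4 = 0"
    and m3: "mutate_matrix 2 C $ 1 $ 3 \<noteq> 0"
    unfolding mz by (simp_all add: mutate_matrix_nth B4_entries pos_part_def)
  have m4: "\<bar>mutate_matrix 3 C $ 1 $ 2\<bar> = 1" and m5: "\<bar>mutate_matrix 1 C $ 2 $ 3\<bar> = 1"
    by (rule mo, simp add: mutate_matrix_nth B4_entries pos_part_def)+
  note ms = m1 m2 m3 m4 m5
  have pm: "a = 1 \<or> a = -1" if "\<bar>a\<bar> = 1" for a :: int using that by arith
  have "(C $ 1 $ 2 = 1 \<and> C $ 1 $ 3 = 1 \<and> C $ 1 $ 4 = 1 \<and> C $ 2 $ 3 = 1 \<and> C $ 3 $ 4 = -1) \<or>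
      (C $ 1 $ 2 = -1 \<and> C $ 1 $ 3 = -1 \<and> C $ 1 $ 4 = -1 \<and> C $ 2 $ 3 = -1 \<and> C $ 3 $ 4 = 1)"
    using pm[OF one(1)] pm[OF one(2)] pm[OF one(3)] pm[OF one(4)] pm[OF one(5)] ms
    unfolding mutate_matrix_nth eqs c0
    by (elim disjE) (simp_all add: pos_part_def)
  then have "C = B4 \<or> C = - B4"
    using c0 eqs skew_diag[OF skew]
    by (elim disjE conjE) (simp_all add: vec_eq_iff forall_4 B4_entries)
  then show "snd (f ?s) = snd ?s \<or> snd (f ?s) = - snd ?s" by (simp add: C_def)
qed

definition connected_matrix :: "int ^ 'n::finite ^ 'n \<Rightarrow> bool" where
  "connected_matrix B \<longleftrightarrow>
     (\<forall>I. I \<noteq> {} \<longrightarrow> I \<noteq> UNIV \<longrightarrow> (\<exists>i\<in>I. \<exists>j\<in>- I. B $ i $ j \<noteq> 0))"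

lemma connected_matrix_hub:
  assumes "\<And>i. i \<noteq> h \<Longrightarrow> B $ h $ i \<noteq> 0 \<and> B $ i $ h \<noteq> 0"
  shows "connected_matrix B"
  unfolding connected_matrix_def
proof (intro allI impI)
  fix I :: "'a set" assume I: "I \<noteq> {}" "I \<noteq> UNIV"
  show "\<exists>i\<in>I. \<exists>j\<in>- I. B $ i $ j \<noteq> 0"
  proof (cases "h \<in> I")
    case True
    then obtain j where "j \<notin> I" using I by blast
    then show ?thesis using True assms[of j] by (intro bexI[of _ h] bexI[of _ j]) auto
  next
    case False
    then obtain i where "i \<in> I" using I by blast
    then show ?thesis using False assms[of i] by (intro bexI[of _ i] bexI[of _ h]) auto
  qed
qed

lemma connected_B3: "connected_matrix B3"
proof (rule connected_matrix_hub[of 2])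
  fix i :: 3 assume "i \<noteq> 2"
  then show "B3 $ 2 $ i \<noteq> 0 \<and> B3 $ i $ 2 \<noteq> 0"
    using exhaust_3[of i] by (auto simp: B3_entries)
qed

lemma connected_B4: "connected_matrix B4"
proof (rule connected_matrix_hub[of 1])
  fix i :: 4 assume "i \<noteq> 1"
  then show "B4 $ 1 $ i \<noteq> 0 \<and> B4 $ i $ 1 \<noteq> 0"
    using exhaust_4[of i] by (auto simp: B4_entries)
qed


section \<open>Connectedness along the mutation class\<close>

lemma connected_matrixE:
  assumes "connected_matrix B" "I \<noteq> {}" "I \<noteq> UNIV"
  obtains i j where "i \<in> I" "j \<notin> I" "B $ i $ j \<noteq> 0"
  using assms unfolding connected_matrix_def by (metis ComplD)

text \<open>If no nonzero entry joined \<open>I\<close> to its complement after the mutation, the same would be true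
  after mutating back.\<close>

lemma connected_matrix_mutate:
  assumes "transpose B = - B" "connected_matrix B"
  shows "connected_matrix (mutate_matrix k B)"
  unfolding connected_matrix_def
proof (intro allI impI, rule ccontr)
  fix I assume I: "I \<noteq> {}" "I \<noteq> UNIV"
    and "\<not> (\<exists>i\<in>I. \<exists>j\<in>- I. mutate_matrix k B $ i $ j \<noteq> 0)"
  then have z: "\<And>i j. i \<in> I \<Longrightarrow> j \<notin> I \<Longrightarrow> mutate_matrix k B $ i $ j = 0" by blast
  have "mutate_matrix k (mutate_matrix k B) $ i $ j = 0" if "i \<in> I" "j \<notin> I" for i j
    using z[OF that] z[of k j] z[of i k] that
    by (cases "k \<in> I") (simp_all add: mutate_matrix_nth[of k "mutate_matrix k B"])
  then have "\<And>i j. i \<in> I \<Longrightarrow> j \<notin> I \<Longrightarrow> B $ i $ j = 0"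
    unfolding mutate_matrix_involution[OF assms(1)] .
  then show False using connected_matrixE[OF assms(2) I] by metis
qed

lemma connected_matrix_permute:
  assumes "bij \<sigma>" "connected_matrix B"
  shows "connected_matrix (\<chi> i j. B $ \<sigma> i $ \<sigma> j)"
  unfolding connected_matrix_def
proof (intro allI impI)
  fix I :: "'a set" assume I: "I \<noteq> {}" "I \<noteq> UNIV"
  have "\<sigma> ` I \<noteq> {}" using I by blast
  moreover have "\<sigma> ` I \<noteq> UNIV"
  proof -
    obtain j where "j \<notin> I" using I by blast
    then have "\<sigma> j \<notin> \<sigma> ` I" by (simp add: inj_image_mem_iff[OF bij_is_inj[OF assms(1)]])
    then show ?thesis by blast
  qed
  ultimately obtain a b where "a \<in> \<sigma> ` I" "b \<notin> \<sigma> ` I" "B $ a $ b \<noteq> 0"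
    by (rule connected_matrixE[OF assms(2)])
  moreover obtain j where "b = \<sigma> j" using bij_is_surj[OF assms(1)] by blast
  ultimately show "\<exists>i\<in>I. \<exists>j\<in>- I. (\<chi> i j. B $ \<sigma> i $ \<sigma> j) $ i $ j \<noteq> 0" by auto
qed

lemma connected_matrix_class:
  assumes "labeled_seed s" "connected_matrix (snd s)" "t \<in> labeled_mutation_class s"
  shows "connected_matrix (snd t)"
  using assms(3)
proof (induction rule: labeled_mutation_class_induct)
  case self
  then show ?case by (rule assms(2))
next
  case (mutate k u)
  have "transpose (snd u) = - snd u"
    using labeled_seed_class[OF assms(1) mutate(1)] by (simp add: labeled_seed_def)
  then show ?case using mutate(2) by (simp add: snd_mutate connected_matrix_mutate)
next
  case (permute \<sigma> u)
  then show ?case by (simp add: permute_def connected_matrix_permute)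
qed

text \<open>Choosing a sign for each column, skew-symmetry propagates the sign along the nonzero
  entries.\<close>

lemma connected_matrix_sign:
  assumes "transpose B = - B" "transpose C = - C" "connected_matrix B"
    and "\<And>k. (\<forall>j. C $ j $ k = B $ j $ k) \<or> (\<forall>j. C $ j $ k = - B $ j $ k)"
  shows "C = B \<or> C = - B"
proof -
  have sB: "B $ i $ j = - B $ j $ i" and sC: "C $ i $ j = - C $ j $ i" for i j
    using assms(1,2) unfolding skew_iff by blast+
  define I where "I = {k. \<forall>j. C $ j $ k = B $ j $ k}"
  have inI: "C $ j $ k = B $ j $ k" if "k \<in> I" for j k using that by (simp add: I_def)
  have notI: "C $ j $ k = - B $ j $ k" if "k \<notin> I" for j k
    using that assms(4)[of k] by (auto simp: I_def)
  have "B $ i $ j = 0" if "i \<in> I" "j \<notin> I" for i j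
    using inI[OF that(1), of j] notI[OF that(2), of i] sB[of i j] sC[of i j] by simp
  then have "I = {} \<or> I = UNIV" using connected_matrixE[OF assms(3), of I] by metis
  then show ?thesis using inI notI by (auto simp: vec_eq_iff)
qed


section \<open>Exchange binomials\<close>

lemma single_pair_eq:
  fixes m1 m2 m3 m4 :: 'k
  assumes "Poly_Mapping.single m1 (1::rat) + Poly_Mapping.single m2 1 =
    Poly_Mapping.single m3 1 + Poly_Mapping.single m4 1"
  shows "m1 = m3 \<and> m2 = m4 \<or> m1 = m4 \<and> m2 = m3"
proof -
  have l: "(1 when m1 = k) + (1 when m2 = k) = (1 when m3 = k) + ((1::rat) when m4 = k)" for k
    using arg_cong[OF assms, of "\<lambda>p. Poly_Mapping.lookup p k"]
    by (simp add: lookup_add lookup_single)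
  show ?thesis
    using l[of m1] l[of m2] by (auto simp: when_def split: if_splits)
qed

text \<open>The two monomials of an exchange binomial are the positive and the negative part of the
  column, and algebraic independence lets one compare monomials up to their order.\<close>

lemma exchange_binomial_determines_column:
  assumes "algebraically_independent z" "z $ k \<noteq> 0"
    and "mutate_vars k (z, B) $ k = mutate_vars k (z, C) $ k"
  shows "(\<forall>j. C $ j $ k = B $ j $ k) \<or> (\<forall>j. C $ j $ k = - B $ j $ k)"
proof -
  define m where "m c D = Poly_Mapping.Abs_poly_mapping (\<lambda>j. nat (pos_part (c * D $ j $ k)))"
    for c :: int and D :: "int ^ 'b ^ 'b"
  have lm: "Poly_Mapping.lookup (m c D) j = nat (pos_part (c * D $ j $ k))" for c D j
    by (simp add: m_def)
  have ev: "mono_eval (m c D) z = (\<Prod>j\<in>UNIV. (z $ j) ^ nat (pos_part (c * D $ j $ k)))" for c D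
    by (simp add: mono_eval_def lm)
  have "mono_eval (m 1 B) z + mono_eval (m (-1) B) z =
      mono_eval (m 1 C) z + mono_eval (m (-1) C) z"
    using assms(2,3) by (simp add: mutate_vars_nth ev)
  then have "eval_poly (Poly_Mapping.single (m 1 B) 1 + Poly_Mapping.single (m (-1) B) 1
      - (Poly_Mapping.single (m 1 C) 1 + Poly_Mapping.single (m (-1) C) 1)) z = 0"
    by (simp add: eval_poly_diff eval_poly_add eval_poly_single)
  then have "Poly_Mapping.single (m 1 B) 1 + Poly_Mapping.single (m (-1) B) 1
      - (Poly_Mapping.single (m 1 C) 1 + Poly_Mapping.single (m (-1) C) 1) = (0 :: _ \<Rightarrow>\<^sub>0 rat)"
    using assms(1) unfolding algebraically_independent_def by blast
  then have "m 1 B = m 1 C \<and> m (-1) B = m (-1) C \<or> m 1 B = m (-1) C \<and> m (-1) B = m 1 C"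
    by (intro single_pair_eq) simp
  moreover have "D $ j $ k =
      int (Poly_Mapping.lookup (m 1 D) j) - int (Poly_Mapping.lookup (m (-1) D) j)" for D j
    by (simp add: lm pos_part_def max_def)
  ultimately show ?thesis by auto
qed


section \<open>The cluster algebra and its seeds\<close>

lemma is_subring_cluster_algebra: "is_subring (cluster_algebra s)"
  unfolding cluster_algebra_def by (rule hull_in) (auto simp: is_subring_def)

lemma is_subring_closed:
  assumes "is_subring R"
  shows "1 \<in> R" "0 \<in> R" "a \<in> R \<Longrightarrow> b \<in> R \<Longrightarrow> a + b \<in> R" "a \<in> R \<Longrightarrow> b \<in> R \<Longrightarrow> a - b \<in> R"
    "a \<in> R \<Longrightarrow> b \<in> R \<Longrightarrow> a * b \<in> R"
proof -
  have one: "1 \<in> R" and diff: "\<And>a b. a \<in> R \<Longrightarrow> b \<in> R \<Longrightarrow> a - b \<in> R"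
    and mult: "\<And>a b. a \<in> R \<Longrightarrow> b \<in> R \<Longrightarrow> a * b \<in> R"
    using assms by (auto simp: is_subring_def)
  have zero: "0 \<in> R" using diff[OF one one] by simp
  show "1 \<in> R" "0 \<in> R" using one zero .
  show "a \<in> R \<Longrightarrow> b \<in> R \<Longrightarrow> a - b \<in> R" "a \<in> R \<Longrightarrow> b \<in> R \<Longrightarrow> a * b \<in> R"
    using diff mult by blast+
  show "a + b \<in> R" if "a \<in> R" "b \<in> R"
    using diff[OF that(1) diff[OF zero that(2)]] by simp
qed

lemma is_subring_power: "is_subring R \<Longrightarrow> a \<in> R \<Longrightarrow> a ^ m \<in> R" for a :: "'a::comm_ring_1"
  by (induction m) (auto intro: is_subring_closed)

lemma is_subring_prod:
  fixes g :: "'i \<Rightarrow> 'a::comm_ring_1"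
  shows "is_subring R \<Longrightarrow> (\<And>j. j \<in> J \<Longrightarrow> g j \<in> R) \<Longrightarrow> prod g J \<in> R"
  by (induction J rule: infinite_finite_induct) (auto intro: is_subring_closed)

lemma cluster_permute:
  assumes "bij \<sigma>"
  shows "cluster (permute \<sigma> t) = cluster t"
proof -
  have "range (($) (\<chi> i. fst t $ \<sigma> i)) = ($) (fst t) ` range \<sigma>"
    by (simp add: image_image)
  then show ?thesis unfolding cluster_def permute_def fst_conv by (simp only: bij_is_surj[OF assms])
qed

lemma cluster_in_clusters:
  assumes "t \<in> labeled_mutation_class s"
  shows "cluster t \<in> clusters s"
proof -
  obtain u \<sigma> where "u \<in> mutation_class s" "bij \<sigma>" "t = permute \<sigma> u"
    using labeled_mutation_class_unlabeled[OF assms] by blast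
  then show ?thesis by (simp add: clusters_def cluster_permute)
qed

lemma cluster_variable_in_clusters:
  "t \<in> labeled_mutation_class s \<Longrightarrow> fst t $ i \<in> \<Union>(clusters s)"
  using cluster_in_clusters[of t s] by (auto simp: cluster_def)

lemma cluster_variable_in_algebra:
  "t \<in> labeled_mutation_class s \<Longrightarrow> fst t $ i \<in> cluster_algebra s"
  unfolding cluster_algebra_def by (rule hull_inc) (rule cluster_variable_in_clusters)

lemma clusters_cases:
  assumes "a \<in> \<Union>(clusters s)"
  obtains t i where "t \<in> labeled_mutation_class s" "a = fst t $ i"
  using assms mutation_class_subset[of s] unfolding clusters_def cluster_def by blast

lemma cluster_variable_inj:
  assumes "labeled_seed t"
  shows "fst t $ i = fst t $ j \<longleftrightarrow> i = j"
  using assms algebraically_independent_inj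
  by (auto simp: labeled_seed_def free_generators_def)

lemma cluster_variable_nonzero:
  assumes "labeled_seed t"
  shows "fst t $ i \<noteq> 0"
  using assms algebraically_independent_nonzero
  by (auto simp: labeled_seed_def free_generators_def)

lemma relabel_cluster:
  fixes t :: "('a::field_char_0, 'n::finite) seed"
  assumes "inj v" "range v = cluster t"
  shows "\<exists>\<sigma>. bij \<sigma> \<and> (\<forall>i. fst (permute \<sigma> t) $ i = v i)"
proof -
  have "\<forall>i. \<exists>j. fst t $ j = v i"
    using assms(2) unfolding cluster_def by (metis rangeE rangeI)
  then obtain \<sigma> where \<sigma>: "\<And>i. fst t $ \<sigma> i = v i" by metis
  then have "inj \<sigma>" using assms(1) by (metis injD injI)
  then have "bij \<sigma>" by (simp add: bij_def finite_UNIV_inj_surj)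
  then show ?thesis using \<sigma> by (auto simp: permute_def)
qed

text \<open>The description in the definition is unique: a seed with the same cluster is, after
  relabeling, a seed with the same tuple of variables, hence the same seed.\<close>

lemma exchange_eq:
  assumes s: "labeled_seed s" and t: "t \<in> labeled_mutation_class s"
  shows "exchange s (cluster t) (fst t $ k) = fst (mutate k t) $ k"
  unfolding exchange_def
proof (rule the_equality)
  obtain u \<sigma> where u: "u \<in> mutation_class s" "bij \<sigma>" "t = permute \<sigma> u"
    using labeled_mutation_class_unlabeled[OF t] by blast
  have "fst (mutate (\<sigma> k) u) $ \<sigma> k = fst (mutate k t) $ k"
    by (simp add: u(2,3) mutate_permute) (simp add: permute_def)
  moreover have "cluster u = cluster t" by (simp add: u(2,3) cluster_permute)
  moreover have "fst u $ \<sigma> k = fst t $ k" by (simp add: u(3) permute_def)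
  ultimately show "\<exists>v\<in>mutation_class s. \<exists>l. cluster v = cluster t \<and> fst v $ l = fst t $ k \<and>
      fst (mutate l v) $ l = fst (mutate k t) $ k"
    using u(1) by blast
next
  fix v' assume "\<exists>v\<in>mutation_class s. \<exists>l. cluster v = cluster t \<and> fst v $ l = fst t $ k \<and>
      fst (mutate l v) $ l = v'"
  then obtain v l where v: "v \<in> mutation_class s" "cluster v = cluster t" "fst v $ l = fst t $ k"
    "fst (mutate l v) $ l = v'" by blast
  have v_class: "v \<in> labeled_mutation_class s" using v(1) mutation_class_subset by blast
  have "inj (($) (fst v))"
    using cluster_variable_inj[OF labeled_seed_class[OF s v_class]] by (simp add: inj_def)
  moreover have "range (($) (fst v)) = cluster t" using v(2) by (simp add: cluster_def)
  ultimately obtain \<sigma> where \<sigma>: "bij \<sigma>" "\<And>i. fst (permute \<sigma> t) $ i = fst v $ i"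
    using relabel_cluster by blast
  have v_eq: "v = permute \<sigma> t"
    by (rule labeled_seed_determined[OF s v_class labeled_mutation_class_permute[OF t \<sigma>(1)]])
      (simp add: vec_eq_iff \<sigma>(2))
  have "fst t $ \<sigma> l = fst t $ k" using v(3) by (simp add: v_eq permute_def)
  then have "\<sigma> l = k" using cluster_variable_inj[OF labeled_seed_class[OF s t]] by blast
  then show "v' = fst (mutate k t) $ k"
    using v(4) by (simp add: v_eq mutate_permute[OF \<sigma>(1)]) (simp add: permute_def)
qed


section \<open>Cluster automorphisms as maps of seeds\<close>

text \<open>A cluster automorphism may reverse all arrows; \<open>e\<close> is true if it keeps them.\<close>

definition transport :: "('a \<Rightarrow> 'a) \<Rightarrow> bool \<Rightarrow> ('a, 'n::finite) seed \<Rightarrow> ('a, 'n) seed" where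
  "transport f e t = (\<chi> i. f (fst t $ i), if e then snd t else - snd t)"

lemma fst_transport: "fst (transport f e t) $ i = f (fst t $ i)"
  by (simp add: transport_def)

lemma transport_permute: "transport f e (permute \<sigma> t) = permute \<sigma> (transport f e t)"
  by (simp add: transport_def permute_def vec_eq_iff)

lemma algebra_automorphismsD:
  assumes "f \<in> algebra_automorphisms A"
  shows "f \<in> Bij A" "f 1 = 1" "a \<in> A \<Longrightarrow> b \<in> A \<Longrightarrow> f (a + b) = f a + f b"
    "a \<in> A \<Longrightarrow> b \<in> A \<Longrightarrow> f (a * b) = f a * f b"
  using assms by (auto simp: algebra_automorphisms_def)

lemma algebra_automorphism_power:
  fixes a :: "'a::comm_ring_1"
  assumes "f \<in> algebra_automorphisms A" "is_subring A" "a \<in> A"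
  shows "f (a ^ m) = f a ^ m"
  by (induction m)
    (simp_all add: algebra_automorphismsD[OF assms(1)] is_subring_power[OF assms(2)] assms(3))

lemma algebra_automorphism_prod:
  fixes g :: "'i \<Rightarrow> 'a::comm_ring_1"
  assumes "f \<in> algebra_automorphisms A" "is_subring A" "\<And>j. j \<in> J \<Longrightarrow> g j \<in> A"
  shows "f (prod g J) = (\<Prod>j\<in>J. f (g j))"
  using assms(3)
  by (induction J rule: infinite_finite_induct)
    (simp_all add: algebra_automorphismsD[OF assms(1)] is_subring_prod[OF assms(2)])

text \<open>\<open>f\<close> is a ring homomorphism on the cluster algebra only, where the division in the exchange
  relation is not available; its image is computed from the relation between the two
  variables in multiplied form.\<close>

lemma algebra_automorphism_exchange:
  assumes s: "labeled_seed s" and f: "f \<in> algebra_automorphisms (cluster_algebra s)"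
    and t: "t \<in> labeled_mutation_class s" and nz: "f (fst t $ k) \<noteq> 0"
  shows "f (fst (mutate k t) $ k) = mutate_vars k (\<chi> i. f (fst t $ i), snd t) $ k"
proof -
  let ?A = "cluster_algebra s"
  note ring = is_subring_cluster_algebra[of s]
  note hom = algebra_automorphismsD[OF f]
  define P where "P c = (\<Prod>j\<in>UNIV. (fst t $ j) ^ nat (pos_part (c * snd t $ j $ k)))" for c
  have var: "fst t $ j \<in> ?A" for j using t by (rule cluster_variable_in_algebra)
  have new: "fst (mutate k t) $ k \<in> ?A"
    by (rule cluster_variable_in_algebra) (rule labeled_mutation_class_mutate[OF t])
  have P_in: "P c \<in> ?A" for c
    unfolding P_def by (intro is_subring_prod[OF ring] is_subring_power[OF ring] var)
  have fP: "f (P c) = (\<Prod>j\<in>UNIV. (f (fst t $ j)) ^ nat (pos_part (c * snd t $ j $ k)))" for c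
    unfolding P_def
    by (simp add: algebra_automorphism_prod[OF f ring is_subring_power[OF ring var]]
        algebra_automorphism_power[OF f ring var])
  have eq: "fst (mutate k t) $ k = (P 1 + P (-1)) / fst t $ k"
    by (cases t) (simp add: mutate_def mutate_vars_nth P_def)
  have "fst (mutate k t) $ k * fst t $ k = P 1 + P (-1)"
    using cluster_variable_nonzero[OF labeled_seed_class[OF s t], of k] unfolding eq by simp
  then have "f (fst (mutate k t) $ k * fst t $ k) = f (P 1 + P (-1))" by simp
  then have "f (fst (mutate k t) $ k) * f (fst t $ k) = f (P 1) + f (P (-1))"
    by (simp add: hom(3,4) new var P_in)
  then have "f (fst (mutate k t) $ k) = (f (P 1) + f (P (-1))) / f (fst t $ k)"
    using nz by (simp add: field_simps)
  then show ?thesis by (simp add: mutate_vars_nth fP)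
qed

lemma transport_mutate:
  assumes s: "labeled_seed s" and f: "f \<in> algebra_automorphisms (cluster_algebra s)"
    and t: "t \<in> labeled_mutation_class s" and tr: "transport f e t \<in> labeled_mutation_class s"
  shows "transport f e (mutate k t) = mutate k (transport f e t)"
proof -
  have nz: "f (fst t $ k) \<noteq> 0"
    using cluster_variable_nonzero[OF labeled_seed_class[OF s tr], of k] by (simp add: fst_transport)
  have "f (fst (mutate k t) $ i) = mutate_vars k (\<chi> i. f (fst t $ i), snd t) $ i" for i
  proof (cases "i = k")
    case True
    then show ?thesis using algebra_automorphism_exchange[OF s f t nz] by simp
  next
    case False
    then show ?thesis by (cases t) (simp add: mutate_def mutate_vars_nth)
  qed
  then show ?thesis
    by (simp add: transport_def mutate_def mutate_vars_uminus mutate_matrix_uminus vec_eq_iff)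
qed

lemma transport_class:
  assumes s: "labeled_seed s" and f: "f \<in> algebra_automorphisms (cluster_algebra s)"
    and t: "t \<in> labeled_mutation_class s" and tr: "transport f e t \<in> labeled_mutation_class s"
    and u: "u \<in> labeled_mutation_class s"
  shows "transport f e u \<in> labeled_mutation_class s"
proof -
  have "u \<in> labeled_mutation_class t" using u labeled_mutation_class_eq[OF s t] by simp
  then have "u \<in> labeled_mutation_class s \<and> transport f e u \<in> labeled_mutation_class s"
  proof (induction rule: labeled_mutation_class_induct)
    case self
    then show ?case using t tr by simp
  next
    case (mutate k u)
    then show ?case by (simp add: transport_mutate[OF s f] labeled_mutation_class_mutate)
  next
    case (permute \<sigma> u)
    then show ?case by (simp add: transport_permute labeled_mutation_class_permute)
  qed
  then show ?thesis ..
qed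

lemma transport_surj:
  assumes s: "labeled_seed s" and f: "f \<in> algebra_automorphisms (cluster_algebra s)"
    and tr: "\<And>t. t \<in> labeled_mutation_class s \<Longrightarrow> transport f e t \<in> labeled_mutation_class s"
    and u: "u \<in> labeled_mutation_class s"
  shows "\<exists>t\<in>labeled_mutation_class s. transport f e t = u"
proof -
  have self: "s \<in> labeled_mutation_class s" by (rule labeled_mutation_class_self)
  have "u \<in> labeled_mutation_class (transport f e s)"
    using u labeled_mutation_class_eq[OF s tr[OF self]] by simp
  then show ?thesis
  proof (induction rule: labeled_mutation_class_induct)
    case self
    then show ?case using labeled_mutation_class_self[of s] by blast
  next
    case (mutate k u)
    then obtain t where t: "t \<in> labeled_mutation_class s" "transport f e t = u" by blast
    then have "transport f e (mutate k t) = mutate k u" using transport_mutate[OF s f t(1) tr] by simp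
    then show ?case using labeled_mutation_class_mutate[OF t(1)] by blast
  next
    case (permute \<sigma> u)
    then obtain t where t: "t \<in> labeled_mutation_class s" "transport f e t = u" by blast
    then have "transport f e (permute \<sigma> t) = permute \<sigma> u" by (simp add: transport_permute)
    then show ?case using labeled_mutation_class_permute[OF t(1) permute(2)] by blast
  qed
qed

lemma algebra_automorphism_inj:
  assumes "f \<in> algebra_automorphisms A" "a \<in> A" "b \<in> A"
  shows "f a = f b \<longleftrightarrow> a = b"
  using algebra_automorphismsD(1)[OF assms(1)] assms(2,3)
  unfolding Bij_def bij_betw_def by (auto dest: inj_onD)

text \<open>Compatibility with exchange at a single cluster propagates to all seeds. It identifies the
  exchange binomials of a seed \<open>t\<close> and of the seed \<open>u\<close> on the image cluster, hence their
  matrices up to a global sign; after that, the images under \<open>f\<close> are mutated exactly as the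
  originals.\<close>

theorem cluster_automorphisms_iff:
  assumes s: "labeled_seed s" and conn: "connected_matrix (snd s)"
  shows "f \<in> cluster_automorphisms s \<longleftrightarrow> f \<in> algebra_automorphisms (cluster_algebra s) \<and>
    (\<exists>e. \<forall>t\<in>labeled_mutation_class s. transport f e t \<in> labeled_mutation_class s)"
proof
  assume "f \<in> cluster_automorphisms s"
  then obtain X where f: "f \<in> algebra_automorphisms (cluster_algebra s)"
    and X: "X \<in> clusters s" "f ` X \<in> clusters s"
    and ex: "\<And>v. v \<in> X \<Longrightarrow> f (exchange s X v) = exchange s (f ` X) (f v)"
    unfolding cluster_automorphisms_def by blast
  obtain t where t: "t \<in> labeled_mutation_class s" "X = cluster t"
    using X(1) mutation_class_subset unfolding clusters_def by blast
  obtain t' where t': "t' \<in> labeled_mutation_class s" "f ` X = cluster t'"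
    using X(2) mutation_class_subset unfolding clusters_def by blast
  let ?v = "\<lambda>i. f (fst t $ i)"
  have "inj ?v"
    using algebra_automorphism_inj[OF f cluster_variable_in_algebra[OF t(1)]
        cluster_variable_in_algebra[OF t(1)]]
      cluster_variable_inj[OF labeled_seed_class[OF s t(1)]] by (simp add: inj_def)
  moreover have "range ?v = cluster t'"
    unfolding t'(2)[symmetric] by (simp add: t(2) cluster_def image_image)
  ultimately obtain \<sigma> where \<sigma>: "bij \<sigma>" "\<And>i. fst (permute \<sigma> t') $ i = f (fst t $ i)"
    using relabel_cluster by blast
  define u where "u = permute \<sigma> t'"
  have u: "u \<in> labeled_mutation_class s"
    unfolding u_def by (rule labeled_mutation_class_permute[OF t'(1) \<sigma>(1)])
  have u_fst: "fst u $ i = f (fst t $ i)" for i unfolding u_def by (rule \<sigma>(2))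
  then have u_fst': "fst u = (\<chi> i. f (fst t $ i))" by (simp add: vec_eq_iff)
  have X': "f ` X = cluster u" by (simp add: u_def cluster_permute \<sigma>(1) t'(2))
  have seeds: "labeled_seed t" "labeled_seed u"
    using labeled_seed_class[OF s] t(1) u by blast+
  have col: "(\<forall>j. snd u $ j $ k = snd t $ j $ k) \<or> (\<forall>j. snd u $ j $ k = - snd t $ j $ k)" for k
  proof (rule exchange_binomial_determines_column)
    show "algebraically_independent (fst u)"
      using seeds(2) by (simp add: labeled_seed_def free_generators_def)
    show nz: "fst u $ k \<noteq> 0" using seeds(2) by (rule cluster_variable_nonzero)
    have "fst t $ k \<in> X" by (simp add: t(2) cluster_def)
    from ex[OF this] have "f (fst (mutate k t) $ k) = fst (mutate k u) $ k"
      unfolding X' u_fst[symmetric] unfolding t(2) exchange_eq[OF s t(1)] exchange_eq[OF s u] .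
    moreover have "f (fst (mutate k t) $ k) = mutate_vars k (fst u, snd t) $ k"
      using algebra_automorphism_exchange[OF s f t(1)] nz by (simp add: u_fst')
    ultimately show "mutate_vars k (fst u, snd t) $ k = mutate_vars k (fst u, snd u) $ k"
      by (simp add: mutate_def)
  qed
  have "snd u = snd t \<or> snd u = - snd t"
    using seeds connected_matrix_class[OF s conn t(1)] col
    by (intro connected_matrix_sign) (simp_all add: labeled_seed_def)
  then have "transport f True t = u \<or> transport f False t = u"
    unfolding transport_def prod_eq_iff fst_conv snd_conv if_True if_False u_fst' by metis
  then obtain e where "transport f e t \<in> labeled_mutation_class s" using u by metis
  then show "f \<in> algebra_automorphisms (cluster_algebra s) \<and>
      (\<exists>e. \<forall>t\<in>labeled_mutation_class s. transport f e t \<in> labeled_mutation_class s)"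
    using f transport_class[OF s f t(1)] by blast
next
  assume "f \<in> algebra_automorphisms (cluster_algebra s) \<and>
      (\<exists>e. \<forall>t\<in>labeled_mutation_class s. transport f e t \<in> labeled_mutation_class s)"
  then obtain e where f: "f \<in> algebra_automorphisms (cluster_algebra s)"
    and tr: "\<And>t. t \<in> labeled_mutation_class s \<Longrightarrow> transport f e t \<in> labeled_mutation_class s"
    by blast
  note self = labeled_mutation_class_self[of s]
  have X': "f ` cluster s = cluster (transport f e s)"
    unfolding cluster_def by (simp add: image_image fst_transport)
  have "\<forall>v\<in>cluster s. f (exchange s (cluster s) v) = exchange s (f ` cluster s) (f v)"
  proof
    fix v assume "v \<in> cluster s"
    then obtain k where v: "v = fst s $ k" by (auto simp: cluster_def)
    have "f (exchange s (cluster s) v) = fst (transport f e (mutate k s)) $ k"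
      by (simp add: v exchange_eq[OF s self] fst_transport)
    also have "\<dots> = fst (mutate k (transport f e s)) $ k"
      by (simp add: transport_mutate[OF s f self tr[OF self]])
    also have "\<dots> = exchange s (cluster (transport f e s)) (fst (transport f e s) $ k)"
      by (simp add: exchange_eq[OF s tr[OF self]])
    finally show "f (exchange s (cluster s) v) = exchange s (f ` cluster s) (f v)"
      by (simp add: X' v fst_transport)
  qed
  moreover have "f ` cluster s \<in> clusters s"
    unfolding X' by (rule cluster_in_clusters[OF tr[OF self]])
  ultimately show "f \<in> cluster_automorphisms s"
    unfolding cluster_automorphisms_def using f cluster_in_clusters[OF self] by blast
qed


section \<open>The group of cluster automorphisms\<close>

lemma mult_BijGroup:
  "f \<in> Bij A \<Longrightarrow> g \<in> Bij A \<Longrightarrow> f \<otimes>\<^bsub>BijGroup A\<^esub> g = compose A f g"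
  by (simp add: BijGroup_def)

lemma algebra_automorphisms_compose:
  assumes "is_subring A" "f \<in> algebra_automorphisms A" "g \<in> algebra_automorphisms A"
  shows "compose A f g \<in> algebra_automorphisms A"
proof -
  note f = algebra_automorphismsD[OF assms(2)] and g = algebra_automorphismsD[OF assms(3)]
  have gA: "g a \<in> A" if "a \<in> A" for a using Bij_imp_funcset[OF g(1)] that by blast
  show ?thesis
    unfolding algebra_automorphisms_def
    using is_subring_closed[OF assms(1)]
    by (simp add: compose_Bij f g compose_eq gA)
qed

lemma algebra_automorphisms_id:
  assumes "is_subring A"
  shows "(\<lambda>a\<in>A. a) \<in> algebra_automorphisms A"
  unfolding algebra_automorphisms_def
  using is_subring_closed[OF assms] by (simp add: id_Bij)

lemma algebra_automorphisms_inverse: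
  assumes "is_subring A" "f \<in> algebra_automorphisms A"
  shows "restrict (inv_into A f) A \<in> algebra_automorphisms A"
proof -
  note f = algebra_automorphismsD[OF assms(2)] and closed = is_subring_closed[OF assms(1)]
  have bij: "bij_betw f A A" using f(1) by (simp add: Bij_def)
  have inA: "inv_into A f a \<in> A" if "a \<in> A" for a using Bij_inv_into_mem[OF f(1) that] .
  have fi: "f (inv_into A f a) = a" if "a \<in> A" for a
    using bij that by (simp add: bij_betw_inv_into_right)
  have "inv_into A f b = a" if "a \<in> A" "f a = b" for a b
    using bij that by (metis bij_betw_inv_into_left)
  then show ?thesis
    unfolding algebra_automorphisms_def
    using closed by (auto simp: restrict_inv_into_Bij f inA fi)
qed

lemma transport_compose:
  assumes "t \<in> labeled_mutation_class s"
  shows "transport (compose (cluster_algebra s) f g) (e = e') t = transport f e (transport g e' t)"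
  using cluster_variable_in_algebra[OF assms]
  by (simp add: transport_def compose_eq)

theorem subgroup_cluster_automorphisms:
  assumes s: "labeled_seed s" and conn: "connected_matrix (snd s)"
  shows "subgroup (cluster_automorphisms s) (BijGroup (cluster_algebra s))"
proof -
  let ?A = "cluster_algebra s" and ?S = "labeled_mutation_class s"
  note iff = cluster_automorphisms_iff[OF s conn] and ring = is_subring_cluster_algebra[of s]
  have bij: "f \<in> Bij ?A" if "f \<in> cluster_automorphisms s" for f
    using that algebra_automorphismsD(1) iff by blast
  show ?thesis
  proof (rule group.subgroupI[OF group_BijGroup])
    show "cluster_automorphisms s \<subseteq> carrier (BijGroup ?A)"
      using bij by (auto simp: BijGroup_def)
    have "transport (\<lambda>a\<in>?A. a) True t = t" if "t \<in> ?S" for t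
      using cluster_variable_in_algebra[OF that] by (simp add: transport_def)
    then have "(\<lambda>a\<in>?A. a) \<in> cluster_automorphisms s"
      using algebra_automorphisms_id[OF ring] unfolding iff
      by (intro conjI exI[of _ True]) simp_all
    then show "cluster_automorphisms s \<noteq> {}" by blast
  next
    fix f assume f: "f \<in> cluster_automorphisms s"
    let ?g = "restrict (inv_into ?A f) ?A"
    from f obtain e where fA: "f \<in> algebra_automorphisms ?A"
      and tr: "\<And>t. t \<in> ?S \<Longrightarrow> transport f e t \<in> ?S"
      unfolding iff by blast
    have "transport ?g e u \<in> ?S" if u: "u \<in> ?S" for u
    proof -
      obtain t where t: "t \<in> ?S" "transport f e t = u"
        using transport_surj[OF s fA tr u] by blast
      have "?g (fst u $ i) = fst t $ i" for i
      proof -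
        have "fst t $ i \<in> ?A" using t(1) by (rule cluster_variable_in_algebra)
        moreover have "fst u $ i = f (fst t $ i)" by (simp add: t(2)[symmetric] fst_transport)
        moreover have "fst u $ i \<in> ?A" using u by (rule cluster_variable_in_algebra)
        ultimately show ?thesis
          using bij_betw_inv_into_left[of f ?A ?A] bij[OF f] by (simp add: Bij_def)
      qed
      moreover have "snd u = (if e then snd t else - snd t)"
        by (simp add: t(2)[symmetric] transport_def)
      ultimately have "transport ?g e u = t" by (simp add: transport_def prod_eq_iff vec_eq_iff)
      then show ?thesis using t(1) by simp
    qed
    then have "?g \<in> cluster_automorphisms s"
      using algebra_automorphisms_inverse[OF ring fA] unfolding iff by blast
    then show "inv\<^bsub>BijGroup ?A\<^esub> f \<in> cluster_automorphisms s"
      by (simp add: inv_BijGroup bij[OF f])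
  next
    fix f g assume f: "f \<in> cluster_automorphisms s" and g: "g \<in> cluster_automorphisms s"
    from f obtain e where fA: "f \<in> algebra_automorphisms ?A"
      and trf: "\<And>t. t \<in> ?S \<Longrightarrow> transport f e t \<in> ?S"
      unfolding iff by blast
    from g obtain e' where gA: "g \<in> algebra_automorphisms ?A"
      and trg: "\<And>t. t \<in> ?S \<Longrightarrow> transport g e' t \<in> ?S"
      unfolding iff by blast
    have "transport (compose ?A f g) (e = e') t \<in> ?S" if "t \<in> ?S" for t
      unfolding transport_compose[OF that] by (intro trf trg that)
    then show "f \<otimes>\<^bsub>BijGroup ?A\<^esub> g \<in> cluster_automorphisms s"
      unfolding mult_BijGroup[OF bij[OF f] bij[OF g]]
      unfolding iff using algebra_automorphisms_compose[OF ring fA gA] by blast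
  qed
qed

text \<open>Since the variables determine the seed, the sign in \<open>transport\<close> need not be chosen, and
  multiplicativity follows by comparing variables.\<close>

definition seed_map ::
    "('a::field_char_0, 'n::finite) seed \<Rightarrow> ('a \<Rightarrow> 'a) \<Rightarrow> ('a, 'n) seed \<Rightarrow> ('a, 'n) seed" where
  "seed_map s f = (\<lambda>t\<in>labeled_mutation_class s.
     THE u. u \<in> labeled_mutation_class s \<and> fst u = (\<chi> i. f (fst t $ i)))"

lemma seed_map_eqI:
  assumes "labeled_seed s" "t \<in> labeled_mutation_class s" "u \<in> labeled_mutation_class s"
    and "\<And>i. fst u $ i = f (fst t $ i)"
  shows "seed_map s f t = u"
proof -
  have u: "fst u = (\<chi> i. f (fst t $ i))" using assms(4) by (simp add: vec_eq_iff)
  have "(THE v. v \<in> labeled_mutation_class s \<and> fst v = (\<chi> i. f (fst t $ i))) = u"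
  proof (rule the_equality)
    show "u \<in> labeled_mutation_class s \<and> fst u = (\<chi> i. f (fst t $ i))"
      using assms(3) u by (rule conjI)
    fix v assume "v \<in> labeled_mutation_class s \<and> fst v = (\<chi> i. f (fst t $ i))"
    then show "v = u"
      using labeled_seed_determined[OF assms(1) _ assms(3), of v] unfolding u by blast
  qed
  then show ?thesis using assms(2) by (simp add: seed_map_def)
qed

lemma seed_map_transport:
  assumes "labeled_seed s" "\<And>t. t \<in> labeled_mutation_class s \<Longrightarrow> transport f e t \<in> labeled_mutation_class s"
    and "t \<in> labeled_mutation_class s"
  shows "seed_map s f t = transport f e t"
  using assms by (intro seed_map_eqI) (simp_all add: fst_transport)

lemma seed_map_in_Aut_M:
  assumes s: "labeled_seed s" and conn: "connected_matrix (snd s)"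
    and f: "f \<in> cluster_automorphisms s"
  shows "seed_map s f \<in> Aut_M s"
proof -
  let ?A = "cluster_algebra s" and ?S = "labeled_mutation_class s"
  from f obtain e where fA: "f \<in> algebra_automorphisms ?A"
    and tr: "\<And>t. t \<in> ?S \<Longrightarrow> transport f e t \<in> ?S"
    unfolding cluster_automorphisms_iff[OF s conn] by blast
  have eq: "seed_map s f t = transport f e t" if "t \<in> ?S" for t
    using s tr that by (rule seed_map_transport)
  have inj: "inj_on (transport f e) ?S"
  proof (rule inj_onI)
    fix t u assume t: "t \<in> ?S" and u: "u \<in> ?S" and tu: "transport f e t = transport f e u"
    have "fst t $ i = fst u $ i" for i
    proof -
      have "f (fst t $ i) = f (fst u $ i)" using tu by (metis fst_transport)
      then show ?thesis
        using algebra_automorphism_inj[OF fA cluster_variable_in_algebra[OF t]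
            cluster_variable_in_algebra[OF u]] by blast
    qed
    then show "t = u" by (intro labeled_seed_determined[OF s t u]) (simp add: vec_eq_iff)
  qed
  have "transport f e ` ?S = ?S"
  proof
    show "transport f e ` ?S \<subseteq> ?S" using tr by blast
    show "?S \<subseteq> transport f e ` ?S"
    proof
      fix u assume "u \<in> ?S"
      from transport_surj[OF s fA tr this] show "u \<in> transport f e ` ?S" by blast
    qed
  qed
  with inj have "bij_betw (transport f e) ?S ?S" by (simp add: bij_betw_def)
  then have "bij_betw (seed_map s f) ?S ?S" using bij_betw_cong[of ?S "seed_map s f"] eq by blast
  then have "seed_map s f \<in> Bij ?S" by (simp add: Bij_def seed_map_def)
  moreover have "seed_map s f (mutate k t) = mutate k (seed_map s f t)" if "t \<in> ?S" for k t
    using that by (simp add: eq labeled_mutation_class_mutate transport_mutate[OF s fA that tr[OF that]])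
  moreover have "seed_map s f (permute \<sigma> t) = permute \<sigma> (seed_map s f t)"
    if "t \<in> ?S" "bij \<sigma>" for \<sigma> t
    using that by (simp add: eq labeled_mutation_class_permute transport_permute)
  ultimately show ?thesis unfolding Aut_M_def by blast
qed

lemma seed_map_compose:
  assumes s: "labeled_seed s" and conn: "connected_matrix (snd s)"
    and f: "f \<in> cluster_automorphisms s" and g: "g \<in> cluster_automorphisms s"
  shows "seed_map s (compose (cluster_algebra s) f g) =
    compose (labeled_mutation_class s) (seed_map s f) (seed_map s g)"
proof
  fix t
  let ?A = "cluster_algebra s" and ?S = "labeled_mutation_class s"
  from f obtain e where trf: "\<And>t. t \<in> ?S \<Longrightarrow> transport f e t \<in> ?S"
    unfolding cluster_automorphisms_iff[OF s conn] by blast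
  from g obtain e' where trg: "\<And>t. t \<in> ?S \<Longrightarrow> transport g e' t \<in> ?S"
    unfolding cluster_automorphisms_iff[OF s conn] by blast
  show "seed_map s (compose ?A f g) t = compose ?S (seed_map s f) (seed_map s g) t"
  proof (cases "t \<in> ?S")
    case True
    have "seed_map s (compose ?A f g) t = transport f e (transport g e' t)"
      using cluster_variable_in_algebra[OF True]
      by (intro seed_map_eqI s True trf trg) (simp add: fst_transport compose_eq)
    also have "\<dots> = seed_map s f (seed_map s g t)"
      by (simp add: seed_map_transport[OF s trf] seed_map_transport[OF s trg] True trg)
    finally show ?thesis using True by (simp add: compose_eq)
  next
    case False
    then show ?thesis by (simp add: seed_map_def compose_def)
  qed
qed

lemma algebra_automorphisms_eqI:
  assumes s: "labeled_seed s"
    and f: "f \<in> algebra_automorphisms (cluster_algebra s)"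
    and g: "g \<in> algebra_automorphisms (cluster_algebra s)"
    and eq: "\<And>t i. t \<in> labeled_mutation_class s \<Longrightarrow> f (fst t $ i) = g (fst t $ i)"
  shows "f = g"
proof (rule extensionalityI)
  let ?A = "cluster_algebra s"
  show "f \<in> extensional ?A" "g \<in> extensional ?A"
    using algebra_automorphismsD(1)[OF f] algebra_automorphismsD(1)[OF g]
    by (simp_all add: Bij_def)
  note closed = is_subring_closed[OF is_subring_cluster_algebra[of s]]
  note fD = algebra_automorphismsD[OF f] and gD = algebra_automorphismsD[OF g]
  have diff: "h (a - b) = h a - h b"
    if h: "h \<in> algebra_automorphisms ?A" and ab: "a \<in> ?A" "b \<in> ?A" for h a b
    using algebra_automorphismsD(3)[OF h closed(4)[OF ab] ab(2)] by simp
  have "is_subring {a \<in> ?A. f a = g a}"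
    unfolding is_subring_def
    by (auto simp: closed fD gD diff[OF f] diff[OF g])
  moreover have "\<Union>(clusters s) \<subseteq> {a \<in> ?A. f a = g a}"
  proof
    fix a assume "a \<in> \<Union>(clusters s)"
    then obtain t i where t: "t \<in> labeled_mutation_class s" "a = fst t $ i"
      by (rule clusters_cases)
    then show "a \<in> {a \<in> ?A. f a = g a}"
      using eq[OF t(1), of i] cluster_variable_in_algebra[OF t(1), of i] by simp
  qed
  ultimately have "?A \<subseteq> {a \<in> ?A. f a = g a}"
    unfolding cluster_algebra_def[of s] by (intro hull_minimal) auto
  then show "f a = g a" if "a \<in> ?A" for a using that by blast
qed

lemma seed_map_inj:
  assumes s: "labeled_seed s" and conn: "connected_matrix (snd s)"
  shows "inj_on (seed_map s) (cluster_automorphisms s)"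
proof (rule inj_onI)
  let ?A = "cluster_algebra s" and ?S = "labeled_mutation_class s"
  fix f g assume f: "f \<in> cluster_automorphisms s" and g: "g \<in> cluster_automorphisms s"
    and eq: "seed_map s f = seed_map s g"
  from f obtain e where fA: "f \<in> algebra_automorphisms ?A"
    and trf: "\<And>t. t \<in> ?S \<Longrightarrow> transport f e t \<in> ?S"
    unfolding cluster_automorphisms_iff[OF s conn] by blast
  from g obtain e' where gA: "g \<in> algebra_automorphisms ?A"
    and trg: "\<And>t. t \<in> ?S \<Longrightarrow> transport g e' t \<in> ?S"
    unfolding cluster_automorphisms_iff[OF s conn] by blast
  have "f (fst t $ i) = g (fst t $ i)" if "t \<in> ?S" for t i
  proof -
    have "transport f e t = transport g e' t"
      using eq seed_map_transport[OF s trf that] seed_map_transport[OF s trg that] by simp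
    then show ?thesis by (metis fst_transport)
  qed
  then show "f = g" by (rule algebra_automorphisms_eqI[OF s fA gA])
qed


text \<open>An automorphism of the labeled mutation class sends \<open>fst s\<close> to another tuple of free
  generators, and so induces an automorphism of the field.\<close>

lemma field_automorphism_exists:
  fixes x x' :: "'a::field_char_0 ^ 'n::finite"
  assumes "free_generators x" "free_generators x'"
  obtains \<phi> where "\<And>u. specialises x x' u (\<phi> u)" "bij \<phi>" "\<And>i. \<phi> (x $ i) = x' $ i" "\<phi> 1 = 1"
    "\<And>u v. \<phi> (u + v) = \<phi> u + \<phi> v" "\<And>u v. \<phi> (u - v) = \<phi> u - \<phi> v"
    "\<And>u v. \<phi> (u * v) = \<phi> u * \<phi> v"
proof -
  have ind: "algebraically_independent x" "algebraically_independent x'"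
    using assms by (simp_all add: free_generators_def)
  have "\<exists>\<phi>. \<forall>u. specialises x x' u (\<phi> u)"
    using specialises_total[OF assms(1) ind(2)] by metis
  then obtain \<phi> where \<phi>: "\<And>u. specialises x x' u (\<phi> u)" by blast
  have unique: "\<phi> u = r" if "specialises x x' u r" for u r
    by (rule specialises_unique[OF ind(1) \<phi> that])
  have "inj \<phi>"
  proof (rule injI)
    fix u v assume "\<phi> u = \<phi> v"
    then have "specialises x' x (\<phi> u) u" "specialises x' x (\<phi> u) v"
      using \<phi>[of u] \<phi>[of v] by (simp_all add: specialises_sym[of x x'])
    then show "u = v" by (rule specialises_unique[OF ind(2)])
  qed
  moreover have "surj \<phi>"
    unfolding surj_def
  proof
    fix r
    obtain u where "specialises x' x r u" using specialises_total[OF assms(2) ind(1)] by blast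
    then have "specialises x x' u r" by (simp add: specialises_sym[of x x'])
    then show "\<exists>u. r = \<phi> u" using unique by blast
  qed
  ultimately have "bij \<phi>" by (simp add: bij_def)
  show ?thesis
  proof (rule that[of \<phi>])
    show "bij \<phi>" by fact
    show "\<phi> (x $ i) = x' $ i" for i by (intro unique specialises_var)
    show "\<phi> 1 = 1" by (intro unique specialises_one)
    show "\<phi> (u + v) = \<phi> u + \<phi> v" "\<phi> (u - v) = \<phi> u - \<phi> v" "\<phi> (u * v) = \<phi> u * \<phi> v" for u v
      by (intro unique specialises_add specialises_diff specialises_mult \<phi>)+
  qed (rule \<phi>)
qed

text \<open>The field automorphism that sends \<open>fst s\<close> to \<open>fst (h s)\<close> agrees with \<open>h\<close> on all variables,
  because both are compatible with mutation, and mutation does not see the sign of the matrix.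
  As \<open>h\<close> permutes the class, the cluster algebra is mapped onto itself.\<close>

lemma seed_map_surj:
  assumes s: "labeled_seed s" and conn: "connected_matrix (snd s)"
    and h: "h \<in> Aut_M s" and sgn: "snd (h s) = snd s \<or> snd (h s) = - snd s"
  shows "\<exists>f\<in>cluster_automorphisms s. seed_map s f = h"
proof -
  let ?A = "cluster_algebra s" and ?S = "labeled_mutation_class s"
  note self = labeled_mutation_class_self[of s]
  have hs: "h s \<in> ?S" using h self by (rule Aut_M_in_class)
  have free: "free_generators (fst s)" "free_generators (fst (h s))"
    using s labeled_seed_class[OF s hs] by (simp_all add: labeled_seed_def)
  have ind: "algebraically_independent (fst s)" using free(1) by (simp add: free_generators_def)
  obtain \<phi> where sp: "\<And>u. specialises (fst s) (fst (h s)) u (\<phi> u)" and bij: "bij \<phi>"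
    and var: "\<And>i. \<phi> (fst s $ i) = fst (h s) $ i" and one: "\<phi> 1 = 1"
    and add: "\<And>u v. \<phi> (u + v) = \<phi> u + \<phi> v" and diff: "\<And>u v. \<phi> (u - v) = \<phi> u - \<phi> v"
    and mult: "\<And>u v. \<phi> (u * v) = \<phi> u * \<phi> v"
    using field_automorphism_exists[OF free] by blast
  have inj: "\<phi> u = \<phi> v \<longleftrightarrow> u = v" for u v using bij by (simp add: bij_is_inj inj_eq)
  have \<phi>0: "\<phi> 0 = 0" using diff[of 0 0] by simp
  define e where "e \<longleftrightarrow> snd (h s) = snd s"
  have tr: "transport \<phi> e t = h t" if "t \<in> ?S" for t
    using that
  proof (induction rule: labeled_mutation_class_induct)
    case self
    show ?case using sgn by (auto simp: transport_def e_def prod_eq_iff vec_eq_iff var)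
  next
    case (mutate k u)
    have nz: "\<phi> (fst u $ k) \<noteq> 0"
      using cluster_variable_nonzero[OF labeled_seed_class[OF s mutate(1)], of k] inj \<phi>0 by metis
    have "\<phi> (fst (mutate k u) $ i) = mutate_vars k (\<chi> i. \<phi> (fst u $ i), snd u) $ i" for i
    proof (rule specialises_unique[OF ind sp])
      have "specialises (fst s) (fst (h s)) (mutate_vars k (fst u, snd u) $ i)
          (mutate_vars k (\<chi> i. \<phi> (fst u $ i), snd u) $ i)"
        by (rule specialises_mutate_vars[OF ind]) (simp_all add: sp nz)
      then show "specialises (fst s) (fst (h s)) (fst (mutate k u) $ i)
          (mutate_vars k (\<chi> i. \<phi> (fst u $ i), snd u) $ i)" by (simp add: mutate_def)
    qed
    then have "transport \<phi> e (mutate k u) = mutate k (transport \<phi> e u)"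
      by (simp add: transport_def mutate_def mutate_vars_uminus mutate_matrix_uminus vec_eq_iff)
    then show ?case by (simp add: mutate(2) Aut_M_mutate[OF h mutate(1)])
  next
    case (permute \<sigma> u)
    then show ?case by (simp add: transport_permute Aut_M_permute[OF h])
  qed
  have A_sub: "?A \<subseteq> R" if "is_subring R" "\<And>t i. t \<in> ?S \<Longrightarrow> fst t $ i \<in> R" for R
    unfolding cluster_algebra_def
  proof (intro hull_minimal subsetI that(1))
    fix a assume "a \<in> \<Union>(clusters s)"
    then obtain t i where "t \<in> ?S" "a = fst t $ i" by (rule clusters_cases)
    then show "a \<in> R" using that(2) by simp
  qed
  have ring: "is_subring ?A" by (rule is_subring_cluster_algebra)
  note closed = is_subring_closed[OF ring]
  have "?A \<subseteq> {a. \<phi> a \<in> ?A}"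
  proof (rule A_sub)
    show "is_subring {a. \<phi> a \<in> ?A}"
      by (auto simp: is_subring_def one diff mult closed)
    fix t i assume t: "t \<in> ?S"
    have "\<phi> (fst t $ i) = fst (h t) $ i" using tr[OF t] by (metis fst_transport)
    then show "fst t $ i \<in> {a. \<phi> a \<in> ?A}"
      using cluster_variable_in_algebra[OF Aut_M_in_class[OF h t]] by simp
  qed
  moreover have "?A \<subseteq> \<phi> ` ?A"
  proof (rule A_sub)
    have one': "1 \<in> \<phi> ` ?A" using one closed(1) by (metis imageI)
    have closed': "a - b \<in> \<phi> ` ?A \<and> a * b \<in> \<phi> ` ?A" if ab: "a \<in> \<phi> ` ?A" "b \<in> \<phi> ` ?A" for a b
    proof -
      obtain c d where cd: "c \<in> ?A" "d \<in> ?A" "a = \<phi> c" "b = \<phi> d" using ab by blast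
      have "a - b = \<phi> (c - d)" "a * b = \<phi> (c * d)" by (simp_all add: cd diff mult)
      then show ?thesis using closed(4,5)[OF cd(1,2)] by blast
    qed
    show "is_subring (\<phi> ` ?A)"
      unfolding is_subring_def
      by (intro conjI ballI one' conjunct1[OF closed'] conjunct2[OF closed'])
    fix u i assume "u \<in> ?S"
    moreover have "h ` ?S = ?S" using h by (simp add: Aut_M_def Bij_def bij_betw_def)
    ultimately have "u \<in> h ` ?S" by simp
    then obtain t where t: "u = h t" "t \<in> ?S" by (rule imageE)
    have "fst u $ i = \<phi> (fst t $ i)" using tr[OF t(2)] t(1) by (metis fst_transport)
    then show "fst u $ i \<in> \<phi> ` ?A" using cluster_variable_in_algebra[OF t(2)] by simp
  qed
  ultimately have image: "\<phi> ` ?A = ?A" by blast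
  define f where "f = restrict \<phi> ?A"
  have f: "f a = \<phi> a" if "a \<in> ?A" for a using that by (simp add: f_def)
  have "bij_betw \<phi> ?A ?A" using bij image by (auto simp: bij_betw_def bij_def intro: inj_on_subset)
  then have "f \<in> Bij ?A" by (simp add: f_def Bij_def)
  then have fA: "f \<in> algebra_automorphisms ?A"
    by (simp add: algebra_automorphisms_def f closed one add mult)
  have trf: "transport f e t = h t" if "t \<in> ?S" for t
    unfolding tr[OF that, symmetric]
    using cluster_variable_in_algebra[OF that] by (simp add: transport_def f)
  have "f \<in> cluster_automorphisms s"
    unfolding cluster_automorphisms_iff[OF s conn]
    using fA trf Aut_M_in_class[OF h] by metis
  moreover have "seed_map s f = h"
  proof (rule extensionalityI[of _ ?S])
    show "seed_map s f \<in> extensional ?S" by (simp add: seed_map_def)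
    show "h \<in> extensional ?S" using h by (simp add: Aut_M_def Bij_def)
    show "seed_map s f t = h t" if "t \<in> ?S" for t
      using that Aut_M_in_class[OF h that] trf[OF that]
      by (intro seed_map_eqI[OF s]) (metis fst_transport)+
  qed
  ultimately show ?thesis by blast
qed

theorem cluster_aut_group_iso:
  assumes s: "labeled_seed s" and conn: "connected_matrix (snd s)" and W: "W s = Aut_M s"
  shows "group (cluster_aut_group s)" and "cluster_aut_group s \<cong> Aut_M_group s"
proof -
  let ?A = "cluster_algebra s" and ?S = "labeled_mutation_class s"
  show "group (cluster_aut_group s)"
    unfolding cluster_aut_group_def
    by (rule group.subgroup_imp_group[OF group_BijGroup subgroup_cluster_automorphisms[OF s conn]])
  have bijA: "f \<in> Bij ?A" if "f \<in> cluster_automorphisms s" for f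
    using that algebra_automorphismsD(1) cluster_automorphisms_iff[OF s conn] by blast
  have bijS: "f \<in> Bij ?S" if "f \<in> Aut_M s" for f
    using that by (simp add: Aut_M_def)
  have "seed_map s (f \<otimes>\<^bsub>cluster_aut_group s\<^esub> g) =
      seed_map s f \<otimes>\<^bsub>Aut_M_group s\<^esub> seed_map s g"
    if f: "f \<in> cluster_automorphisms s" and g: "g \<in> cluster_automorphisms s" for f g
    using mult_BijGroup[OF bijA[OF f] bijA[OF g]]
      mult_BijGroup[OF bijS[OF seed_map_in_Aut_M[OF s conn f]] bijS[OF seed_map_in_Aut_M[OF s conn g]]]
      seed_map_compose[OF s conn f g]
    by (simp add: cluster_aut_group_def Aut_M_group_def)
  moreover have "bij_betw (seed_map s) (cluster_automorphisms s) (Aut_M s)"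
    unfolding bij_betw_def
  proof (intro conjI seed_map_inj[OF s conn] equalityI subsetI)
    fix h assume "h \<in> seed_map s ` cluster_automorphisms s"
    then show "h \<in> Aut_M s" using seed_map_in_Aut_M[OF s conn] by blast
  next
    fix h assume h: "h \<in> Aut_M s"
    then have "h \<in> W s" by (simp add: W)
    then have "snd (h s) = snd s \<or> snd (h s) = - snd s"
      using labeled_mutation_class_self[of s] unfolding W_def by blast
    from seed_map_surj[OF s conn h this] show "h \<in> seed_map s ` cluster_automorphisms s" by blast
  qed
  ultimately have "seed_map s \<in> iso (cluster_aut_group s) (Aut_M_group s)"
    using seed_map_in_Aut_M[OF s conn]
    by (auto simp: iso_def hom_def cluster_aut_group_def Aut_M_group_def)
  then show "cluster_aut_group s \<cong> Aut_M_group s" unfolding is_iso_def by blast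
qed


section \<open>The two examples\<close>

lemma infinite_type_with_W_eq_Aut_M:
  fixes z :: "'c::field_char_0 ^ 'n::finite"
  assumes s: "labeled_seed (z, B)" and B: "\<not> finite_mutation_type B" "connected_matrix B"
    and W: "W (z, B) = Aut_M (z, B)"
  shows "\<not> finite_mutation_type B \<and> W (z, B) = Aut_M (z, B) \<and>
      group (cluster_aut_group (z, B)) \<and> cluster_aut_group (z, B) \<cong> Aut_M_group (z, B) \<and>
      \<not> (\<forall>s :: ('c, 'n) seed. labeled_seed s \<longrightarrow>
            (W s = Aut_M s \<longleftrightarrow> finite_mutation_type (snd s)))"
proof -
  have conn: "connected_matrix (snd (z, B))" using B(2) by simp
  have "\<not> (W (z, B) = Aut_M (z, B) \<longleftrightarrow> finite_mutation_type (snd (z, B)))"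
    using B(1) W by simp
  then have "\<not> (\<forall>s :: ('c, 'n) seed. labeled_seed s \<longrightarrow>
            (W s = Aut_M s \<longleftrightarrow> finite_mutation_type (snd s)))"
    using s by metis
  then show ?thesis using B(1) W cluster_aut_group_iso[OF s conn W] by simp
qed

theorem mainTheorem4:
  fixes x :: "'a::field_char_0 ^ 4" and y :: "'b::field_char_0 ^ 3"
  shows
    "(labeled_seed (x, B4) \<longrightarrow>
        \<not> finite_mutation_type B4 \<and>
        W (x, B4) = Aut_M (x, B4) \<and>
        group (cluster_aut_group (x, B4)) \<and>
        cluster_aut_group (x, B4) \<cong> Aut_M_group (x, B4) \<and>
        \<not> (\<forall>s :: ('a, 4) seed. labeled_seed s \<longrightarrow>
              (W s = Aut_M s \<longleftrightarrow> finite_mutation_type (snd s)))) \<and>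
     (labeled_seed (y, B3) \<longrightarrow>
        \<not> finite_mutation_type B3 \<and>
        W (y, B3) = Aut_M (y, B3) \<and>
        group (cluster_aut_group (y, B3)) \<and>
        cluster_aut_group (y, B3) \<cong> Aut_M_group (y, B3) \<and>
        \<not> (\<forall>s :: ('b, 3) seed. labeled_seed s \<longrightarrow>
              (W s = Aut_M s \<longleftrightarrow> finite_mutation_type (snd s))))"
  using infinite_type_with_W_eq_Aut_M[OF _ B4_not_finite_mutation_type connected_B4 W_eq_Aut_M_B4]
    infinite_type_with_W_eq_Aut_M[OF _ B3_not_finite_mutation_type connected_B3 W_eq_Aut_M_B3]
  by blast

end
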